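(* Let $d \in \mathbb{N}$. Assume that $A [0,1]^d = R^{-1} H [0,1]^d$, where $A \in \mathbb{R}^{d \times d}$ is a nonsingular matrix, $R \in \mathbb{Z}^{d \times d}$ is a nonsingular integer matrix, and $H \in \mathbb{R}^{d \times d}$ is a lower triangular matrix whose diagonal entries all lie in $(0,1]$. Then there exists a set $\Gamma \subseteq \mathbb{Z}^d$ such that $\mathcal{E}(\Gamma)$ is a Riesz basis for $L^2(A [0,1]^d)$.
   Context: For a matrix $M \in \mathbb{R}^{d\times d}$ and a set $S \subseteq \mathbb{R}^d$, $M S := \{Mx : x \in S\}$. For a discrete set $\Gamma \subseteq \mathbb{R}^d$, $\mathcal{E}(\Gamma) := \{ e^{2\pi i \gamma \cdot (\cdot)} : \gamma \in \Gamma\}$, regarded as a family of functions, indexed by $\Gamma$, on the domain under consideration. A countable family $\{f_n\}_{n \in I}$ in a separable Hilbert space $\mathcal{H}$ is a Riesz basis for $\mathcal{H}$ if its closed linear span is $\mathcal{H}$ and there are constants $0 < \alpha \le \beta < \infty$ such that $\alpha \sum_{n\in I} |c_n|^2 \le \| \sum_{n \in I} c_n f_n \|^2 \le \beta \sum_{n \in I} |c_n|^2$ for all $\{c_n\}_{n \in I} \in \ell_2(I)$. *)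

theory Defs
  imports "HOL-Analysis.Analysis"
begin

text \<open>
  Elements of \<open>L\<^sup>2(M)\<close> are represented by square-integrable functions rather than by classes
  modulo null sets, so \<open>l2_norm M\<close> is a seminorm; the notions below are invariant under changing
  the square-integrable functions involved on null sets.
\<close>

definition l2_space :: "'a measure \<Rightarrow> ('a \<Rightarrow> complex) set" where
  "l2_space M = {f. f \<in> borel_measurable M \<and> integrable M (\<lambda>x. (cmod (f x))\<^sup>2)}"

definition l2_norm :: "'a measure \<Rightarrow> ('a \<Rightarrow> complex) \<Rightarrow> real" where
  "l2_norm M f = sqrt (LINT x|M. (cmod (f x))\<^sup>2)"

definition lin_span :: "('i \<Rightarrow> 'a \<Rightarrow> complex) \<Rightarrow> 'i set \<Rightarrow> ('a \<Rightarrow> complex) set" where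
  "lin_span f I = {h. \<exists>F c. finite F \<and> F \<subseteq> I \<and> h = (\<lambda>x. \<Sum>n\<in>F. c n * f n x)}"

definition l2_closure :: "'a measure \<Rightarrow> ('a \<Rightarrow> complex) set \<Rightarrow> ('a \<Rightarrow> complex) set" where
  "l2_closure M V = {g \<in> l2_space M. \<forall>\<epsilon>>0. \<exists>h\<in>V. l2_norm M (\<lambda>x. g x - h x) < \<epsilon>}"

text \<open>
  Unconditional convergence in \<open>L\<^sup>2(M)\<close>, along the finite subsets of the index set.
\<close>

definition has_l2_sum ::
    "'a measure \<Rightarrow> ('i \<Rightarrow> 'a \<Rightarrow> complex) \<Rightarrow> 'i set \<Rightarrow> ('a \<Rightarrow> complex) \<Rightarrow> bool" where
  "has_l2_sum M f I g \<longleftrightarrow> g \<in> l2_space M \<and>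
     ((\<lambda>F. l2_norm M (\<lambda>x. g x - (\<Sum>n\<in>F. f n x))) \<longlongrightarrow> 0) (finite_subsets_at_top I)"

definition ell2 :: "'i set \<Rightarrow> ('i \<Rightarrow> complex) set" where
  "ell2 I = {c. (\<lambda>n. (cmod (c n))\<^sup>2) summable_on I}"

text \<open>
  The convergence of \<open>\<Sum>n\<in>I. c n * f n\<close> for every \<open>\<ell>\<^sup>2\<close> sequence \<open>c\<close>, implicit in the usual
  formulation of the two inequalities, is part of the definition; the limit \<open>g\<close> is unique up to
  a null set.
\<close>

definition l2_riesz_basis :: "'a measure \<Rightarrow> ('i \<Rightarrow> 'a \<Rightarrow> complex) \<Rightarrow> 'i set \<Rightarrow> bool" where
  "l2_riesz_basis M f I \<longleftrightarrow>
     countable I \<and>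
     (\<forall>n\<in>I. f n \<in> l2_space M) \<and>
     l2_closure M (lin_span f I) = l2_space M \<and>
     (\<exists>\<alpha> \<beta> :: real. 0 < \<alpha> \<and> \<alpha> \<le> \<beta> \<and>
        (\<forall>c \<in> ell2 I. \<exists>g. has_l2_sum M (\<lambda>n x. c n * f n x) I g \<and>
           \<alpha> * (\<Sum>\<^sub>\<infinity>n\<in>I. (cmod (c n))\<^sup>2) \<le> (l2_norm M g)\<^sup>2 \<and>
           (l2_norm M g)\<^sup>2 \<le> \<beta> * (\<Sum>\<^sub>\<infinity>n\<in>I. (cmod (c n))\<^sup>2)))"

definition exponential :: "real ^ 'n \<Rightarrow> real ^ 'n \<Rightarrow> complex" where
  "exponential \<gamma> x = exp (2 * complex_of_real pi * \<i> * complex_of_real (\<gamma> \<bullet> x))"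

definition integer_lattice :: "(real ^ 'n) set" where
  "integer_lattice = {\<gamma>. \<forall>i. \<gamma> $ i \<in> \<int>}"

text \<open>In \<open>real ^ 'n\<close>, \<open>1\<close> is the vector all of whose components are 1.\<close>

definition unit_cube :: "(real ^ 'n) set" where
  "unit_cube = cbox 0 1"

definition lower_triangular :: "real ^ 'n::{finite,wellorder} ^ 'n::{finite,wellorder} \<Rightarrow> bool" where
  "lower_triangular H \<longleftrightarrow> (\<forall>i j. i < j \<longrightarrow> H $ i $ j = 0)"

end

theory Submission
  imports Defs
begin

text \<open>
  The inverse of \<open>R\<close> disappears in a change of variables: for a frequency of the form \<open>R\<^sup>T k\<close> the
  exponential at the point \<open>R\<^sup>-\<^sup>1 H x\<close> has the phase \<open>k \<bullet> H x\<close>. As \<open>R\<close> is an integer matrix, the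
  claim becomes that the functions \<open>x \<mapsto> exp (2\<pi>\<i> k \<bullet> H x)\<close>, for \<open>k\<close> in a suitable set of integer
  vectors, are a Riesz basis on the unit cube. That set is a product of sets \<open>\<Delta> i\<close> of integers, one for
  each coordinate, such that the frequencies \<open>\<Delta> i\<close> give a Riesz basis of exponentials on the interval
  \<open>[0, H i i]\<close>. Since \<open>H\<close> is lower triangular, the functions on the cube are built by adding the coordinates
  in increasing order, and each new coordinate contributes a one-dimensional exponential times a
  phase that depends only on the earlier coordinates. Phases do not affect the absolute values of
  coefficients, and a Riesz basis tensored with a Riesz basis remains one after such a twist
  (\<open>riesz_system_twisted_product\<close>, \<open>triangular_riesz_system\<close>).

  This leaves dimension one: every interval \<open>[0,h]\<close> with \<open>0 < h \<le> 1\<close> has a Riesz basis of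
  exponentials with integer frequencies (\<open>interval_riesz_system\<close>), a theorem of Seip. The proof
  combines two constructions. If the interval is short, rounding the frequencies
  \<open>n/h\<close> of an orthogonal basis to integers is a small perturbation
  in the sense of Paley and Wiener (\<open>paley_wiener_perturbation\<close>, \<open>short_interval_riesz_system\<close>).
  And a basis on an interval can be prolonged by a length \<open>1/N\<close>: if none of its frequencies is a
  multiple of \<open>N\<close>, then adding all multiples of \<open>N\<close> gives a basis on the longer interval, because the
  difference operator with step \<open>1/N\<close> annihilates exactly the new exponentials
  (\<open>glue_riesz_systems\<close>). For suitable \<open>N\<close> the number \<open>N * h\<close> is only slightly larger than
  an integer \<open>k\<close>, and \<open>k\<close> prolongations lead from a short interval to \<open>[0,h]\<close>.

  The starting point of all this is that the exponentials with integer frequencies are total on the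
  unit interval (\<open>wave_total\<close>). The Fourier series of the sawtooth converges in \<open>L\<^sup>2\<close> because of
  \<open>\<Sum> 1/n\<^sup>2 = \<pi>\<^sup>2/6\<close>, and differences of cyclic shifts of the sawtooth are indicator functions of intervals.
\<close>

section \<open>Square-integrable functions\<close>

lemma l2_spaceD:
  assumes "f \<in> l2_space M"
  shows "f \<in> borel_measurable M" "integrable M (\<lambda>x. (cmod (f x))\<^sup>2)"
  using assms by (auto simp: l2_space_def)

lemma l2_space_of_dominated:
  assumes "g \<in> borel_measurable M" "integrable M w" "\<And>x. x \<in> space M \<Longrightarrow> (cmod (g x))\<^sup>2 \<le> w x"
  shows "g \<in> l2_space M"
  unfolding l2_space_def
proof (intro CollectI conjI)
  show "integrable M (\<lambda>x. (cmod (g x))\<^sup>2)"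
    by (rule Bochner_Integration.integrable_bound[OF assms(2)])
       (use assms(1,3) in \<open>auto intro!: AE_I2 order_trans[OF assms(3) abs_ge_self]\<close>)
qed (rule assms(1))

lemma l2_space_0: "(\<lambda>x. 0) \<in> l2_space M"
  by (simp add: l2_space_def)

lemma l2_space_scale:
  assumes "f \<in> l2_space M" shows "(\<lambda>x. c * f x) \<in> l2_space M"
  using assms by (auto simp: l2_space_def norm_mult power_mult_distrib)

lemma cmod_add_square_le:
  assumes "0 < t"
  shows "(cmod (a + b))\<^sup>2 \<le> (1 + t) * (cmod a)\<^sup>2 + (1 + 1 / t) * (cmod b)\<^sup>2"
proof -
  have "(cmod (a + b))\<^sup>2 \<le> (cmod a + cmod b)\<^sup>2"
    by (intro power_mono norm_triangle_ineq) auto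
  moreover have "(cmod a + cmod b)\<^sup>2 = (cmod a)\<^sup>2 + 2 * cmod a * cmod b + (cmod b)\<^sup>2"
    by (simp add: power2_sum)
  moreover have "2 * cmod a * cmod b \<le> t * (cmod a)\<^sup>2 + 1 / t * (cmod b)\<^sup>2"
  proof -
    have "0 \<le> (t * cmod a - cmod b)\<^sup>2 / t" using assms by simp
    also have "\<dots> = t * (cmod a)\<^sup>2 + 1 / t * (cmod b)\<^sup>2 - 2 * cmod a * cmod b"
      using assms by (simp add: power2_eq_square field_simps)
    finally show ?thesis by simp
  qed
  ultimately show ?thesis by (simp add: distrib_right)
qed

lemma l2_space_add:
  assumes "f \<in> l2_space M" "g \<in> l2_space M"
  shows "(\<lambda>x. f x + g x) \<in> l2_space M"
proof (rule l2_space_of_dominated)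
  show "integrable M (\<lambda>x. (1 + 1) * (cmod (f x))\<^sup>2 + (1 + 1 / 1) * (cmod (g x))\<^sup>2)"
    using assms by (auto dest!: l2_spaceD(2))
  show "(cmod (f x + g x))\<^sup>2 \<le> (1 + 1) * (cmod (f x))\<^sup>2 + (1 + 1 / 1) * (cmod (g x))\<^sup>2" for x
    by (rule cmod_add_square_le) simp
  show "(\<lambda>x. f x + g x) \<in> borel_measurable M"
    using assms by (auto dest!: l2_spaceD(1))
qed

lemma l2_space_diff:
  assumes "f \<in> l2_space M" "g \<in> l2_space M"
  shows "(\<lambda>x. f x - g x) \<in> l2_space M"
  using l2_space_add[OF assms(1) l2_space_scale[OF assms(2), of "-1"]] by simp

lemma l2_space_sum:
  assumes "\<And>n. n \<in> F \<Longrightarrow> f n \<in> l2_space M"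
  shows "(\<lambda>x. \<Sum>n\<in>F. f n x) \<in> l2_space M"
  using assms by (induction F rule: infinite_finite_induct) (auto intro: l2_space_0 l2_space_add)

lemma l2_space_lincomb:
  assumes "\<And>n. n \<in> F \<Longrightarrow> f n \<in> l2_space M"
  shows "(\<lambda>x. \<Sum>n\<in>F. c n * f n x) \<in> l2_space M"
  using assms by (intro l2_space_sum l2_space_scale)

lemma l2_norm_nonneg [simp]: "0 \<le> l2_norm M f"
  by (simp add: l2_norm_def)

lemma l2_norm_square: "(l2_norm M f)\<^sup>2 = (LINT x|M. (cmod (f x))\<^sup>2)"
  by (simp add: l2_norm_def)

lemma l2_norm_scale: "l2_norm M (\<lambda>x. c * f x) = cmod c * l2_norm M f"
  by (simp add: l2_norm_def norm_mult power_mult_distrib real_sqrt_mult)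

lemma l2_norm_0 [simp]: "l2_norm M (\<lambda>x. 0) = 0"
  by (simp add: l2_norm_def)

lemma l2_norm_minus_commute: "l2_norm M (\<lambda>x. f x - g x) = l2_norm M (\<lambda>x. g x - f x)"
  by (simp add: l2_norm_def norm_minus_commute)

lemma l2_norm_mono:
  assumes "g \<in> borel_measurable M" "f \<in> l2_space M"
    and "\<And>x. x \<in> space M \<Longrightarrow> cmod (g x) \<le> cmod (f x)"
  shows "l2_norm M g \<le> l2_norm M f"
proof -
  have "(cmod (g x))\<^sup>2 \<le> (cmod (f x))\<^sup>2" if "x \<in> space M" for x
    using assms(3)[OF that] by (intro power_mono) auto
  moreover from this have "g \<in> l2_space M"
    using assms(1) l2_spaceD(2)[OF assms(2)] by (rule_tac l2_space_of_dominated) auto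
  ultimately show ?thesis
    unfolding l2_norm_def using l2_spaceD(2)[OF assms(2)]
    by (intro real_sqrt_le_mono integral_mono) (auto dest: l2_spaceD(2))
qed

text \<open>
  Minkowski's inequality is obtained by integrating the pointwise bound
  \<open>cmod_add_square_le\<close> and then choosing the free weight \<open>t\<close> optimally, namely as the quotient
  of the two norms; small positive numbers are added to the norms so that the quotient exists.
\<close>

lemma l2_norm_triangle:
  assumes "f \<in> l2_space M" "g \<in> l2_space M"
  shows "l2_norm M (\<lambda>x. f x + g x) \<le> l2_norm M f + l2_norm M g"
proof (rule field_le_epsilon)
  fix e :: real assume "0 < e"
  define a where "a = l2_norm M f + e / 2"
  define b where "b = l2_norm M g + e / 2"
  have pos: "a > 0" "b > 0"
    using \<open>0 < e\<close> by (auto simp: a_def b_def add_nonneg_pos)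
  define t where "t = b / a"
  have t: "t > 0" using pos by (simp add: t_def)
  have i: "integrable M (\<lambda>x. (cmod (f x))\<^sup>2)" "integrable M (\<lambda>x. (cmod (g x))\<^sup>2)"
    "integrable M (\<lambda>x. (cmod (f x + g x))\<^sup>2)"
    using assms l2_space_add[OF assms] by (auto dest: l2_spaceD(2))
  have "(l2_norm M (\<lambda>x. f x + g x))\<^sup>2
      \<le> (LINT x|M. (1 + t) * (cmod (f x))\<^sup>2 + (1 + 1 / t) * (cmod (g x))\<^sup>2)"
    unfolding l2_norm_square using i t by (intro integral_mono cmod_add_square_le) auto
  also have "\<dots> = (1 + t) * (l2_norm M f)\<^sup>2 + (1 + 1 / t) * (l2_norm M g)\<^sup>2"
    using i by (simp add: l2_norm_square)
  also have "\<dots> \<le> (1 + t) * a\<^sup>2 + (1 + 1 / t) * b\<^sup>2"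
    using t \<open>0 < e\<close> by (intro add_mono mult_left_mono power_mono) (auto simp: a_def b_def)
  also have "\<dots> = (a + b)\<^sup>2"
  proof -
    have "(1 + t) * a\<^sup>2 = a\<^sup>2 + a * b" "(1 + 1 / t) * b\<^sup>2 = b\<^sup>2 + a * b"
      using pos by (simp_all add: t_def power2_eq_square distrib_right)
    then show ?thesis by (simp add: power2_eq_square algebra_simps)
  qed
  finally have "l2_norm M (\<lambda>x. f x + g x) \<le> a + b"
    by (rule power2_le_imp_le) (use pos in simp)
  then show "l2_norm M (\<lambda>x. f x + g x) \<le> l2_norm M f + l2_norm M g + e"
    by (simp add: a_def b_def)
qed

lemma l2_norm_triangle_diff:
  assumes "f \<in> l2_space M" "g \<in> l2_space M" "h \<in> l2_space M"
  shows "l2_norm M (\<lambda>x. f x - h x) \<le> l2_norm M (\<lambda>x. f x - g x) + l2_norm M (\<lambda>x. g x - h x)"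
  using l2_norm_triangle[OF l2_space_diff[OF assms(1,2)] l2_space_diff[OF assms(2,3)]] by simp

lemma l2_norm_diff_le:
  assumes "f \<in> l2_space M" "g \<in> l2_space M"
  shows "l2_norm M (\<lambda>x. f x - g x) \<le> l2_norm M f + l2_norm M g"
  using l2_norm_triangle_diff[OF assms(1) l2_space_0 assms(2)]
  by (simp add: l2_norm_def)

lemma l2_norm_le_diff:
  assumes "f \<in> l2_space M" "g \<in> l2_space M"
  shows "l2_norm M f \<le> l2_norm M (\<lambda>x. f x - g x) + l2_norm M g"
  using l2_norm_triangle[OF l2_space_diff[OF assms] assms(2)] by simp

lemma l2_norm_sum_le:
  assumes "\<And>n. n \<in> F \<Longrightarrow> f n \<in> l2_space M"
  shows "l2_norm M (\<lambda>x. \<Sum>n\<in>F. f n x) \<le> (\<Sum>n\<in>F. l2_norm M (f n))"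
  using assms
proof (induction F rule: infinite_finite_induct)
  case (insert n F)
  have "l2_norm M (\<lambda>x. \<Sum>k\<in>insert n F. f k x) = l2_norm M (\<lambda>x. f n x + (\<Sum>k\<in>F. f k x))"
    using insert by simp
  also have "\<dots> \<le> l2_norm M (f n) + l2_norm M (\<lambda>x. \<Sum>k\<in>F. f k x)"
    using insert by (intro l2_norm_triangle l2_space_sum) auto
  finally show ?case using insert by simp
qed auto

lemma l2_mult_unimodular:
  assumes g: "g \<in> l2_space M" and m: "\<phi> \<in> borel_measurable M" and norm: "\<And>x. x \<in> space M \<Longrightarrow> cmod (\<phi> x) = 1"
  shows "(\<lambda>x. \<phi> x * g x) \<in> l2_space M"
  by (rule l2_space_of_dominated[OF _ l2_spaceD(2)[OF g]])
     (use m l2_spaceD(1)[OF g] norm in \<open>auto simp: norm_mult\<close>)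

lemma ennreal_l2_norm_square:
  assumes "f \<in> l2_space M"
  shows "ennreal ((l2_norm M f)\<^sup>2) = (\<integral>\<^sup>+x. ennreal ((cmod (f x))\<^sup>2) \<partial>M)"
  unfolding l2_norm_square using l2_spaceD(2)[OF assms] by (simp add: nn_integral_eq_integral)

lemma l2_space_iff_nn_integral:
  "f \<in> l2_space M \<longleftrightarrow> f \<in> borel_measurable M \<and> (\<integral>\<^sup>+x. ennreal ((cmod (f x))\<^sup>2) \<partial>M) < \<infinity>"
proof -
  have "integrable M (\<lambda>x. (cmod (f x))\<^sup>2) \<longleftrightarrow> (\<integral>\<^sup>+x. ennreal ((cmod (f x))\<^sup>2) \<partial>M) < \<infinity>"
    if "f \<in> borel_measurable M"
    using that by (subst integrable_iff_bounded) auto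
  then show ?thesis by (auto simp: l2_space_def)
qed

lemma l2_norm_cong_AE:
  assumes "f \<in> borel_measurable M" "g \<in> borel_measurable M" "AE x in M. f x = g x"
  shows "l2_norm M f = l2_norm M g"
  unfolding l2_norm_def
  by (intro arg_cong[where f=sqrt] integral_cong_AE) (use assms in auto)

lemma l2_norm_cong:
  assumes "\<And>x. x \<in> space M \<Longrightarrow> cmod (f x) = cmod (g x)"
  shows "l2_norm M f = l2_norm M g"
  unfolding l2_norm_def
  by (intro arg_cong[where f=sqrt] Bochner_Integration.integral_cong) (use assms in auto)

lemma l2_space_of_bounded:
  assumes "finite_measure M" "f \<in> borel_measurable M" "\<And>x. x \<in> space M \<Longrightarrow> cmod (f x) \<le> B"
  shows "f \<in> l2_space M"
proof (rule l2_space_of_dominated[OF assms(2)])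
  interpret finite_measure M by fact
  show "integrable M (\<lambda>x. B\<^sup>2)" by simp
  show "(cmod (f x))\<^sup>2 \<le> B\<^sup>2" if "x \<in> space M" for x
    using assms(3)[OF that] by (intro power_mono) auto
qed

lemma l2_norm_le_sup:
  assumes "finite_measure M" "f \<in> borel_measurable M" "\<And>x. x \<in> space M \<Longrightarrow> cmod (f x) \<le> B" "0 \<le> B"
  shows "l2_norm M f \<le> B * sqrt (measure M (space M))"
proof -
  interpret finite_measure M by fact
  have "(l2_norm M f)\<^sup>2 \<le> (LINT x|M. B\<^sup>2)"
    unfolding l2_norm_square
    using l2_spaceD(2)[OF l2_space_of_bounded[OF assms(1-3)]]
    by (intro integral_mono power_mono) (use assms in auto)
  also have "\<dots> = (B * sqrt (measure M (space M)))\<^sup>2"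
    by (simp add: power_mult_distrib)
  finally show ?thesis
    by (rule power2_le_imp_le) (use assms(4) in simp)
qed

text \<open>
  The second part is the Cauchy-Schwarz inequality against the constant 1. As for Minkowski's
  inequality, the pointwise bound \<open>2 * |f| \<le> t + |f|\<^sup>2 / t\<close> is integrated and \<open>t\<close> is taken to
  be the quotient of the norms of \<open>f\<close> and of 1, made positive by small summands.
\<close>

lemma (in finite_measure) l2_imp_integrable:
  assumes "f \<in> l2_space M"
  shows "integrable M f" "(LINT x|M. cmod (f x)) \<le> sqrt (measure M (space M)) * l2_norm M f"
proof -
  have m [measurable]: "f \<in> borel_measurable M" using l2_spaceD(1)[OF assms] .
  have bd: "cmod (f x) \<le> (t + (cmod (f x))\<^sup>2 / t) / 2" if "t > 0" for t x
  proof -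
    have "0 \<le> (t - cmod (f x))\<^sup>2 / t" using that by simp
    then show ?thesis using that by (simp add: power2_eq_square field_simps)
  qed
  have i2: "integrable M (\<lambda>x. (t + (cmod (f x))\<^sup>2 / t) / 2)" for t :: real
    using l2_spaceD(2)[OF assms] by auto
  show i: "integrable M f"
    by (rule Bochner_Integration.integrable_bound[OF i2[of 1]]) (use bd[of 1] in auto)
  show "(LINT x|M. cmod (f x)) \<le> sqrt (measure M (space M)) * l2_norm M f"
  proof (rule field_le_epsilon)
    fix e :: real assume "e > 0"
    define m where "m = sqrt (measure M (space M))"
    define c where "c = l2_norm M f"
    have nn: "m \<ge> 0" "c \<ge> 0" by (auto simp: m_def c_def)
    define \<eta> where "\<eta> = e / (1 + m)"
    have \<eta>: "\<eta> > 0" using nn \<open>e > 0\<close> by (simp add: \<eta>_def add_pos_nonneg)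
    define \<zeta> where "\<zeta> = \<eta> / (1 + c + \<eta>)"
    have \<zeta>: "\<zeta> > 0" using nn \<eta> by (simp add: \<zeta>_def add_pos_nonneg)
    define t where "t = (c + \<eta>) / (m + \<zeta>)"
    have t: "t > 0" using nn \<eta> \<zeta> by (simp add: t_def add_nonneg_pos)
    have "(LINT x|M. cmod (f x)) \<le> (LINT x|M. (t + (cmod (f x))\<^sup>2 / t) / 2)"
      using i i2 bd[OF t] by (intro integral_mono) auto
    also have "\<dots> = (t * m\<^sup>2 + c\<^sup>2 / t) / 2"
      using l2_spaceD(2)[OF assms] by (simp add: m_def c_def l2_norm_square)
    also have "\<dots> \<le> (t * (m + \<zeta>)\<^sup>2 + (c + \<eta>)\<^sup>2 / t) / 2"
      using t nn \<eta> \<zeta> by (intro divide_right_mono add_mono mult_left_mono power_mono) auto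
    also have "\<dots> = (m + \<zeta>) * (c + \<eta>)"
    proof -
      have "m + \<zeta> > 0" "c + \<eta> > 0" using nn \<eta> \<zeta> by auto
      then have "t * (m + \<zeta>)\<^sup>2 = (m + \<zeta>) * (c + \<eta>)" "(c + \<eta>)\<^sup>2 / t = (m + \<zeta>) * (c + \<eta>)"
        by (simp_all add: t_def power2_eq_square)
      then show ?thesis by simp
    qed
    also have "\<dots> = m * c + m * \<eta> + \<zeta> * (c + \<eta>)" by (simp add: algebra_simps)
    also have "\<zeta> * (c + \<eta>) \<le> \<eta>"
      using nn \<eta> by (simp add: \<zeta>_def field_simps add_pos_nonneg)
    also have "m * c + m * \<eta> + \<eta> = m * c + e"
    proof -
      have "(1 + m) * \<eta> = e" using nn by (simp add: \<eta>_def)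
      then show ?thesis by (simp add: algebra_simps)
    qed
    finally show "(LINT x|M. cmod (f x)) \<le> sqrt (measure M (space M)) * l2_norm M f + e"
      by (simp add: m_def c_def)
  qed
qed

text \<open>
  The Riesz-Fischer theorem. On a space of finite measure a Cauchy sequence in \<open>L\<^sup>2\<close> is Cauchy in
  \<open>L\<^sup>1\<close>, so a subsequence converges almost everywhere; by Fatou's lemma its limit is also the limit
  in \<open>L\<^sup>2\<close>.
\<close>

lemma (in finite_measure) l2_complete:
  assumes s: "\<And>n. s n \<in> l2_space M"
    and cauchy: "\<And>e. e > 0 \<Longrightarrow> \<exists>N. \<forall>i\<ge>N. \<forall>j\<ge>N. l2_norm M (\<lambda>x. s i x - s j x) \<le> e"
  shows "\<exists>g\<in>l2_space M. (\<lambda>n. l2_norm M (\<lambda>x. g x - s n x)) \<longlonglongrightarrow> 0"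
proof -
  have sm [measurable]: "s n \<in> borel_measurable M" for n using s l2_spaceD(1) by blast
  define m where "m = sqrt (measure M (space M))"
  have "\<exists>N. \<forall>i\<ge>N. \<forall>j\<ge>N. (LINT x|M. norm (s i x - s j x)) < e" if e: "e > 0" for e
  proof -
    have p: "e / (1 + m) > 0" using e by (simp add: m_def add_pos_nonneg)
    obtain N where N: "\<forall>i\<ge>N. \<forall>j\<ge>N. l2_norm M (\<lambda>x. s i x - s j x) \<le> e / (1 + m)"
      using cauchy[OF p] by blast
    have "(LINT x|M. norm (s i x - s j x)) < e" if "i \<ge> N" "j \<ge> N" for i j
    proof -
      have "(LINT x|M. cmod (s i x - s j x)) \<le> m * l2_norm M (\<lambda>x. s i x - s j x)"
        unfolding m_def by (rule l2_imp_integrable) (intro l2_space_diff s)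
      also have "\<dots> \<le> m * (e / (1 + m))"
        using N that by (intro mult_left_mono) (auto simp: m_def)
      also have "\<dots> < e"
        using e by (simp add: m_def field_simps add_pos_nonneg)
      finally show ?thesis .
    qed
    then show ?thesis by blast
  qed
  then obtain r where r: "strict_mono r" "AE x in M. Cauchy (\<lambda>i. s (r i) x)"
    by (rule cauchy_L1_AE_cauchy_subseq[rotated]) (use l2_imp_integrable(1)[OF s] in auto)
  define g where "g = (\<lambda>x. lim (\<lambda>i. s (r i) x))"
  have gm [measurable]: "g \<in> borel_measurable M"
    unfolding g_def by measurable
  have conv: "AE x in M. (\<lambda>i. s (r i) x) \<longlonglongrightarrow> g x"
    using r(2) unfolding g_def
    by eventually_elim (simp add: Cauchy_convergent_iff convergent_LIMSEQ_iff)
  have bound: "(\<integral>\<^sup>+x. ennreal ((cmod (g x - s n x))\<^sup>2) \<partial>M) \<le> ennreal (e\<^sup>2)"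
    if e: "e > 0" and n: "\<forall>j\<ge>N. l2_norm M (\<lambda>x. s n x - s j x) \<le> e" for n e N
  proof -
    have "(\<integral>\<^sup>+x. ennreal ((cmod (g x - s n x))\<^sup>2) \<partial>M)
        = (\<integral>\<^sup>+x. liminf (\<lambda>i. ennreal ((cmod (s (r i) x - s n x))\<^sup>2)) \<partial>M)"
    proof (intro nn_integral_cong_AE)
      show "AE x in M. ennreal ((cmod (g x - s n x))\<^sup>2)
          = liminf (\<lambda>i. ennreal ((cmod (s (r i) x - s n x))\<^sup>2))"
        using conv
      proof eventually_elim
        case (elim x)
        then have "(\<lambda>i. ennreal ((cmod (s (r i) x - s n x))\<^sup>2)) \<longlonglongrightarrow> ennreal ((cmod (g x - s n x))\<^sup>2)"
          by (intro tendsto_intros)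
        then show ?case using lim_imp_Liminf[OF sequentially_bot] by metis
      qed
    qed
    also have "\<dots> \<le> liminf (\<lambda>i. \<integral>\<^sup>+x. ennreal ((cmod (s (r i) x - s n x))\<^sup>2) \<partial>M)"
      by (rule nn_integral_liminf) measurable
    also have "\<dots> \<le> ennreal (e\<^sup>2)"
    proof (rule Liminf_le)
      show "\<forall>\<^sub>F i in sequentially. (\<integral>\<^sup>+x. ennreal ((cmod (s (r i) x - s n x))\<^sup>2) \<partial>M) \<le> ennreal (e\<^sup>2)"
        using eventually_ge_at_top[of N]
      proof eventually_elim
        case (elim i)
        then have "r i \<ge> N" using seq_suble[OF r(1), of i] by simp
        then have "l2_norm M (\<lambda>x. s n x - s (r i) x) \<le> e" using n by blast
        then have "(l2_norm M (\<lambda>x. s (r i) x - s n x))\<^sup>2 \<le> e\<^sup>2"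
          by (subst l2_norm_minus_commute) (intro power_mono, auto)
        then show ?case
          by (subst ennreal_l2_norm_square[symmetric]) (auto intro!: l2_space_diff s ennreal_leI)
      qed
    qed simp
    finally show ?thesis .
  qed
  obtain N1 where N1: "\<forall>i\<ge>N1. \<forall>j\<ge>N1. l2_norm M (\<lambda>x. s i x - s j x) \<le> 1"
    using cauchy[of 1] by auto
  have "(\<integral>\<^sup>+x. ennreal ((cmod (g x - s N1 x))\<^sup>2) \<partial>M) \<le> ennreal (1\<^sup>2)"
    using bound[of 1 N1 N1] N1 by auto
  also have "\<dots> < \<infinity>" by simp
  finally have "(\<lambda>x. g x - s N1 x) \<in> l2_space M"
    unfolding l2_space_iff_nn_integral by simp
  from l2_space_add[OF this s[of N1]] have g: "g \<in> l2_space M" by simp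
  have "(\<lambda>n. l2_norm M (\<lambda>x. g x - s n x)) \<longlonglongrightarrow> 0"
  proof (rule LIMSEQ_I)
    fix e :: real assume e: "e > 0"
    then obtain N where N: "\<forall>i\<ge>N. \<forall>j\<ge>N. l2_norm M (\<lambda>x. s i x - s j x) \<le> e / 2"
      using cauchy[of "e / 2"] by auto
    have "norm (l2_norm M (\<lambda>x. g x - s n x) - 0) < e" if "n \<ge> N" for n
    proof -
      have "ennreal ((l2_norm M (\<lambda>x. g x - s n x))\<^sup>2) \<le> ennreal ((e / 2)\<^sup>2)"
        using bound[of "e / 2" N n] N that e
        by (subst ennreal_l2_norm_square) (auto intro!: l2_space_diff g s)
      then have "(l2_norm M (\<lambda>x. g x - s n x))\<^sup>2 \<le> (e / 2)\<^sup>2"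
        by (subst (asm) ennreal_le_iff) auto
      then have "l2_norm M (\<lambda>x. g x - s n x) \<le> e / 2"
        using e by (auto intro: power2_le_imp_le)
      then show ?thesis using e by simp
    qed
    then show "\<exists>N. \<forall>n\<ge>N. norm (l2_norm M (\<lambda>x. g x - s n x) - 0) < e" by blast
  qed
  with g show ?thesis by blast
qed

section \<open>Riesz systems\<close>

text \<open>
  A Riesz system is a Riesz basis described through finite linear combinations only. In this form
  the notion can be checked and transported without convergence of infinite series; on spaces of
  finite measure \<open>riesz_system_imp_basis\<close> recovers the series.
\<close>

definition l2_total :: "'a measure \<Rightarrow> ('i \<Rightarrow> 'a \<Rightarrow> complex) \<Rightarrow> 'i set \<Rightarrow> bool" where
  "l2_total M f I \<longleftrightarrow> l2_space M \<subseteq> l2_closure M (lin_span f I)"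

definition riesz_bounds ::
    "'a measure \<Rightarrow> ('i \<Rightarrow> 'a \<Rightarrow> complex) \<Rightarrow> 'i set \<Rightarrow> real \<Rightarrow> real \<Rightarrow> bool" where
  "riesz_bounds M f I \<alpha> \<beta> \<longleftrightarrow> 0 < \<alpha> \<and> 0 < \<beta> \<and>
     (\<forall>F c. finite F \<longrightarrow> F \<subseteq> I \<longrightarrow>
        \<alpha> * (\<Sum>n\<in>F. (cmod (c n))\<^sup>2) \<le> (l2_norm M (\<lambda>x. \<Sum>n\<in>F. c n * f n x))\<^sup>2 \<and>
        (l2_norm M (\<lambda>x. \<Sum>n\<in>F. c n * f n x))\<^sup>2 \<le> \<beta> * (\<Sum>n\<in>F. (cmod (c n))\<^sup>2))"

definition riesz_system :: "'a measure \<Rightarrow> ('i \<Rightarrow> 'a \<Rightarrow> complex) \<Rightarrow> 'i set \<Rightarrow> bool" where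
  "riesz_system M f I \<longleftrightarrow>
     (\<forall>n\<in>I. f n \<in> l2_space M) \<and> l2_total M f I \<and> (\<exists>\<alpha> \<beta>. riesz_bounds M f I \<alpha> \<beta>)"

lemma riesz_boundsD:
  assumes "riesz_bounds M f I \<alpha> \<beta>" "finite F" "F \<subseteq> I"
  shows "\<alpha> * (\<Sum>n\<in>F. (cmod (c n))\<^sup>2) \<le> (l2_norm M (\<lambda>x. \<Sum>n\<in>F. c n * f n x))\<^sup>2"
    "(l2_norm M (\<lambda>x. \<Sum>n\<in>F. c n * f n x))\<^sup>2 \<le> \<beta> * (\<Sum>n\<in>F. (cmod (c n))\<^sup>2)"
  using assms unfolding riesz_bounds_def by auto

lemma mem_l2_closure_iff:
  "g \<in> l2_closure M (lin_span f I) \<longleftrightarrow> g \<in> l2_space M \<and>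
     (\<forall>e>0. \<exists>F c. finite F \<and> F \<subseteq> I \<and> l2_norm M (\<lambda>x. g x - (\<Sum>n\<in>F. c n * f n x)) < e)"
  unfolding l2_closure_def lin_span_def by fastforce

lemma lin_span_subset_l2:
  assumes "\<And>n. n \<in> I \<Longrightarrow> f n \<in> l2_space M" "h \<in> lin_span f I"
  shows "h \<in> l2_space M"
  using assms by (auto simp: lin_span_def intro!: l2_space_lincomb)

lemma lincomb_mem_lin_span:
  "finite F \<Longrightarrow> F \<subseteq> I \<Longrightarrow> (\<lambda>x. \<Sum>n\<in>F. c n * f n x) \<in> lin_span f I"
  unfolding lin_span_def by blast

lemma lin_span_scale:
  assumes "h \<in> lin_span f I" shows "(\<lambda>x. a * h x) \<in> lin_span f I"
proof -
  obtain F c where "finite F" "F \<subseteq> I" "h = (\<lambda>x. \<Sum>n\<in>F. c n * f n x)"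
    using assms by (auto simp: lin_span_def)
  then show ?thesis
    by (auto simp: lin_span_def sum_distrib_left mult.assoc
        intro!: exI[of _ F] exI[of _ "\<lambda>n. a * c n"])
qed

lemma lin_span_add:
  assumes "h \<in> lin_span f I" "k \<in> lin_span f I"
  shows "(\<lambda>x. h x + k x) \<in> lin_span f I"
proof -
  obtain F c where F: "finite F" "F \<subseteq> I" "h = (\<lambda>x. \<Sum>n\<in>F. c n * f n x)"
    using assms by (auto simp: lin_span_def)
  obtain G d where G: "finite G" "G \<subseteq> I" "k = (\<lambda>x. \<Sum>n\<in>G. d n * f n x)"
    using assms by (auto simp: lin_span_def)
  define c' where "c' n = (if n \<in> F then c n else 0)" for n
  define d' where "d' n = (if n \<in> G then d n else 0)" for n
  have "h x = (\<Sum>n\<in>F \<union> G. c' n * f n x)" for x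
    unfolding F(3) using F(1) G(1) by (intro sum.mono_neutral_cong_left) (auto simp: c'_def)
  moreover have "k x = (\<Sum>n\<in>F \<union> G. d' n * f n x)" for x
    unfolding G(3) using F(1) G(1) by (intro sum.mono_neutral_cong_left) (auto simp: d'_def)
  ultimately have "(\<lambda>x. h x + k x) = (\<lambda>x. \<Sum>n\<in>F \<union> G. (c' n + d' n) * f n x)"
    by (simp add: sum.distrib distrib_right)
  then show ?thesis
    unfolding lin_span_def using F G by (auto intro!: exI[of _ "F \<union> G"] exI[of _ "\<lambda>n. c' n + d' n"])
qed

lemma l2_closure_limit:
  assumes f: "\<And>n. n \<in> I \<Longrightarrow> f n \<in> l2_space M" and g: "g \<in> l2_space M"
    and lim: "\<And>e. e > 0 \<Longrightarrow> \<exists>h\<in>l2_closure M (lin_span f I). l2_norm M (\<lambda>x. g x - h x) < e"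
  shows "g \<in> l2_closure M (lin_span f I)"
  unfolding l2_closure_def
proof (intro CollectI conjI allI impI g)
  fix e :: real assume e: "e > 0"
  obtain h where h: "h \<in> l2_closure M (lin_span f I)" "l2_norm M (\<lambda>x. g x - h x) < e / 2"
    using lim[of "e / 2"] e by auto
  then obtain k where k: "k \<in> lin_span f I" "l2_norm M (\<lambda>x. h x - k x) < e / 2"
    unfolding l2_closure_def using e half_gt_zero by blast
  have "l2_norm M (\<lambda>x. g x - k x) \<le> l2_norm M (\<lambda>x. g x - h x) + l2_norm M (\<lambda>x. h x - k x)"
    using g h(1) lin_span_subset_l2[OF f k(1)]
    by (intro l2_norm_triangle_diff) (auto simp: l2_closure_def)
  then show "\<exists>h\<in>lin_span f I. l2_norm M (\<lambda>x. g x - h x) < e"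
    using h(2) k by force
qed

lemma l2_closure_scale:
  assumes "g \<in> l2_closure M (lin_span f I)"
  shows "(\<lambda>x. a * g x) \<in> l2_closure M (lin_span f I)"
  unfolding l2_closure_def
proof (intro CollectI conjI allI impI)
  show "(\<lambda>x. a * g x) \<in> l2_space M"
    using assms by (auto simp: l2_closure_def intro: l2_space_scale)
  fix e :: real assume e: "e > 0"
  have "e / (1 + cmod a) > 0" using e by (simp add: add_pos_nonneg)
  then obtain h where h: "h \<in> lin_span f I" "l2_norm M (\<lambda>x. g x - h x) < e / (1 + cmod a)"
    using assms by (auto simp: l2_closure_def)
  have "l2_norm M (\<lambda>x. a * g x - a * h x) = cmod a * l2_norm M (\<lambda>x. g x - h x)"
    using l2_norm_scale[of M a "\<lambda>x. g x - h x"] by (simp add: algebra_simps)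
  also have "\<dots> \<le> cmod a * (e / (1 + cmod a))"
    using h(2) by (intro mult_left_mono) auto
  also have "\<dots> < e" using e by (simp add: field_simps add_pos_nonneg)
  finally show "\<exists>h\<in>lin_span f I. l2_norm M (\<lambda>x. a * g x - h x) < e"
    using lin_span_scale[OF h(1), of a] by (intro bexI[of _ "\<lambda>x. a * h x"]) auto
qed

lemma l2_closure_add:
  assumes f: "\<And>n. n \<in> I \<Longrightarrow> f n \<in> l2_space M"
    and "g \<in> l2_closure M (lin_span f I)" "h \<in> l2_closure M (lin_span f I)"
  shows "(\<lambda>x. g x + h x) \<in> l2_closure M (lin_span f I)"
  unfolding l2_closure_def
proof (intro CollectI conjI allI impI)
  have gh: "g \<in> l2_space M" "h \<in> l2_space M" using assms by (auto simp: l2_closure_def)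
  then show "(\<lambda>x. g x + h x) \<in> l2_space M" by (rule l2_space_add)
  fix e :: real assume e: "e > 0"
  obtain g' where g': "g' \<in> lin_span f I" "l2_norm M (\<lambda>x. g x - g' x) < e / 2"
    using assms e unfolding l2_closure_def using half_gt_zero by blast
  obtain h' where h': "h' \<in> lin_span f I" "l2_norm M (\<lambda>x. h x - h' x) < e / 2"
    using assms e unfolding l2_closure_def using half_gt_zero by blast
  have "l2_norm M (\<lambda>x. (g x - g' x) + (h x - h' x))
      \<le> l2_norm M (\<lambda>x. g x - g' x) + l2_norm M (\<lambda>x. h x - h' x)"
    using lin_span_subset_l2[OF f g'(1)] lin_span_subset_l2[OF f h'(1)] gh
    by (intro l2_norm_triangle l2_space_diff) auto
  then have "l2_norm M (\<lambda>x. g x + h x - (g' x + h' x)) < e"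
    using g'(2) h'(2) by (simp add: algebra_simps)
  then show "\<exists>k\<in>lin_span f I. l2_norm M (\<lambda>x. g x + h x - k x) < e"
    using lin_span_add[OF g'(1) h'(1)] by (intro bexI[of _ "\<lambda>x. g' x + h' x"]) auto
qed

lemma lin_span_subset_l2_closure:
  assumes "\<And>n. n \<in> I \<Longrightarrow> f n \<in> l2_space M" "h \<in> lin_span f I"
  shows "h \<in> l2_closure M (lin_span f I)"
  using lin_span_subset_l2[OF assms] assms(2)
  by (auto simp: l2_closure_def intro!: bexI[of _ h])

lemma generator_mem_lin_span:
  assumes "n \<in> I" shows "(\<lambda>x. a * f n x) \<in> lin_span f I"
  unfolding lin_span_def using assms by (auto intro!: exI[of _ "{n}"] exI[of _ "\<lambda>_. a"])

lemma zero_mem_l2_closure: "(\<lambda>x. 0) \<in> l2_closure M (lin_span f I)"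
  unfolding mem_l2_closure_iff by (auto intro!: l2_space_0 exI[of _ "{}"])

lemma l2_closure_sum:
  assumes "\<And>n. n \<in> I \<Longrightarrow> f n \<in> l2_space M"
    and "\<And>k. k \<in> K \<Longrightarrow> g k \<in> l2_closure M (lin_span f I)"
  shows "(\<lambda>x. \<Sum>k\<in>K. g k x) \<in> l2_closure M (lin_span f I)"
  using assms(2)
  by (induction K rule: infinite_finite_induct) (auto intro: zero_mem_l2_closure l2_closure_add[OF assms(1)])

lemma l2_closure_cong:
  assumes "g \<in> l2_closure M (lin_span f I)" "\<And>x. x \<in> space M \<Longrightarrow> g x = g' x"
  shows "g' \<in> l2_closure M (lin_span f I)"
proof -
  have "g' \<in> l2_space M"
    using assms unfolding l2_closure_def l2_space_def
    by (auto cong: measurable_cong Bochner_Integration.integrable_cong)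
  moreover have "l2_norm M (\<lambda>x. g' x - h x) = l2_norm M (\<lambda>x. g x - h x)" for h
    using assms(2) by (intro l2_norm_cong) auto
  ultimately show ?thesis using assms(1) by (auto simp: l2_closure_def)
qed

lemma l2_norm_indicator:
  assumes "finite_measure M" "A \<in> sets M"
  shows "l2_norm M (indicator A) = sqrt (measure M A)"
proof -
  interpret finite_measure M by fact
  have "(cmod (indicator A x))\<^sup>2 = indicator A x" for x by (simp add: indicator_def)
  then show ?thesis
    using assms(2) by (simp add: l2_norm_def)
qed

lemma indicator_mem_l2:
  assumes "finite_measure M" "A \<in> sets M"
  shows "indicator A \<in> l2_space M"
  by (rule l2_space_of_bounded[OF assms(1), of _ 1]) (use assms(2) in \<open>auto simp: indicator_def\<close>)

text \<open>
  A closed subspace that contains the indicator functions of all measurable sets contains all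
  simple functions, hence everything, by dominated convergence.
\<close>

lemma l2_total_of_indicators:
  assumes fin: "finite_measure M" and f: "\<And>n. n \<in> I \<Longrightarrow> f n \<in> l2_space M"
    and ind: "\<And>A. A \<in> sets M \<Longrightarrow> indicator A \<in> l2_closure M (lin_span f I)"
  shows "l2_total M f I"
  unfolding l2_total_def
proof
  interpret finite_measure M by fact
  fix g assume g: "g \<in> l2_space M"
  then have gm [measurable]: "g \<in> borel_measurable M" by (rule l2_spaceD)
  then obtain s where s: "\<And>i. simple_function M (s i)"
      "\<And>x. x \<in> space M \<Longrightarrow> (\<lambda>i. s i x) \<longlonglongrightarrow> g x"
      "\<And>i x. x \<in> space M \<Longrightarrow> dist (s i x) 0 \<le> 2 * dist (g x) 0"
    using borel_measurable_implies_sequence_metric[OF gm, of 0] by metis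
  have sm [measurable]: "s i \<in> borel_measurable M" for i
    using s(1) by (rule borel_measurable_simple_function)
  have smem: "s i \<in> l2_closure M (lin_span f I)" for i
  proof (rule l2_closure_cong)
    show "(\<lambda>x. \<Sum>y\<in>s i ` space M. y * indicator (s i -` {y} \<inter> space M) x) \<in> l2_closure M (lin_span f I)"
      using s(1)[of i] by (intro l2_closure_sum f l2_closure_scale ind) (auto dest: simple_functionD)
    show "(\<Sum>y\<in>s i ` space M. y * indicator (s i -` {y} \<inter> space M) x) = s i x" if "x \<in> space M" for x
      using simple_function_indicator_representation_banach[OF s(1) that, of i]
      by (simp add: indicator_def of_bool_def if_distrib[where f="\<lambda>c. c *\<^sub>R _"] if_distrib[where f="\<lambda>c. _ * c"] cong: if_cong)
  qed
  \<comment> \<open>The approximants satisfy \<open>|s i x| \<le> 2 * |g x|\<close>, hence \<open>|g x - s i x| \<le> 3 * |g x|\<close>.\<close>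
  have "(\<lambda>i. LINT x|M. (cmod (g x - s i x))\<^sup>2) \<longlonglongrightarrow> (LINT x|M. 0)"
  proof (rule integral_dominated_convergence[where w = "\<lambda>x. 9 * (cmod (g x))\<^sup>2"])
    show "integrable M (\<lambda>x. 9 * (cmod (g x))\<^sup>2)" using l2_spaceD(2)[OF g] by simp
    show "AE x in M. (\<lambda>i. (cmod (g x - s i x))\<^sup>2) \<longlonglongrightarrow> 0"
    proof (rule AE_I2)
      fix x assume "x \<in> space M"
      from tendsto_diff[OF tendsto_const s(2)[OF this], of "g x"]
      have "(\<lambda>i. g x - s i x) \<longlonglongrightarrow> 0" by simp
      from tendsto_power[OF tendsto_norm[OF this], of 2]
      show "(\<lambda>i. (cmod (g x - s i x))\<^sup>2) \<longlonglongrightarrow> 0" by simp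
    qed
    show "AE x in M. norm ((cmod (g x - s i x))\<^sup>2) \<le> 9 * (cmod (g x))\<^sup>2" for i
    proof (rule AE_I2)
      fix x assume "x \<in> space M"
      then have "cmod (g x - s i x) \<le> 3 * cmod (g x)"
        using s(3)[of x i] norm_triangle_ineq4[of "g x" "s i x"] by simp
      then have "(cmod (g x - s i x))\<^sup>2 \<le> (3 * cmod (g x))\<^sup>2" by (intro power_mono) auto
      then show "norm ((cmod (g x - s i x))\<^sup>2) \<le> 9 * (cmod (g x))\<^sup>2" by (simp add: power_mult_distrib)
    qed
  qed measurable
  from tendsto_real_sqrt[OF this] have lim: "(\<lambda>i. l2_norm M (\<lambda>x. g x - s i x)) \<longlonglongrightarrow> 0"
    by (simp add: l2_norm_def)
  show "g \<in> l2_closure M (lin_span f I)"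
  proof (rule l2_closure_limit[OF f g])
    fix e :: real assume "e > 0"
    from order_tendstoD(2)[OF lim this]
    obtain i where "l2_norm M (\<lambda>x. g x - s i x) < e" by (auto simp: eventually_sequentially)
    then show "\<exists>h\<in>l2_closure M (lin_span f I). l2_norm M (\<lambda>x. g x - h x) < e"
      using smem by blast
  qed auto
qed

text \<open>
  The sets whose indicators lie in a closed subspace containing the constants form a Dynkin
  system, so it is enough to look at a generator that is stable under intersections.
\<close>

lemma l2_total_of_generator:
  assumes fin: "finite_measure M" and f: "\<And>n. n \<in> I \<Longrightarrow> f n \<in> l2_space M"
    and G: "Int_stable G" "G \<subseteq> Pow (space M)" "sets M = sigma_sets (space M) G"
    and ind: "\<And>A. A \<in> G \<Longrightarrow> indicator A \<in> l2_closure M (lin_span f I)"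
    and top: "indicator (space M) \<in> l2_closure M (lin_span f I)"
  shows "l2_total M f I"
proof (rule l2_total_of_indicators[OF fin f])
  interpret finite_measure M by fact
  fix A assume "A \<in> sets M"
  then have "A \<in> sigma_sets (space M) G" using G(3) by simp
  from G(1,2) this show "indicator A \<in> l2_closure M (lin_span f I)"
  proof (induction rule: sigma_sets_induct_disjoint)
    case (basic A) then show ?case by (rule ind)
  next
    case empty then show ?case
      by (rule_tac l2_closure_cong[OF zero_mem_l2_closure]) simp
  next
    case (compl A)
    then have "(\<lambda>x. indicator (space M) x + (- 1) * indicator A x) \<in> l2_closure M (lin_span f I)"
      by (intro l2_closure_add[OF f] l2_closure_scale top) auto
    then show ?case by (rule l2_closure_cong) (auto simp: indicator_def)
  next
    case (union A)
    have A: "A i \<in> sets M" for i using union(2) G(3) by auto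
    define B where "B n = (\<Union>i. A i) - (\<Union>i<n. A i)" for n :: nat
    have B: "B n \<in> sets M" for n using A by (auto simp: B_def)
    have U: "indicator (\<Union>i. A i) \<in> l2_space M"
      by (rule indicator_mem_l2[OF fin]) (use A in auto)
    have "(\<lambda>n. measure M (B n)) \<longlonglongrightarrow> measure M (\<Inter>n. B n)"
      by (rule finite_Lim_measure_decseq) (use B in \<open>auto simp: decseq_def B_def\<close>)
    also have "(\<Inter>n. B n) = {}" by (auto simp: B_def)
    finally have "(\<lambda>n. sqrt (measure M (B n))) \<longlonglongrightarrow> sqrt 0"
      by (intro tendsto_real_sqrt) simp
    then have lim: "(\<lambda>n. sqrt (measure M (B n))) \<longlonglongrightarrow> 0" by simp
    show ?case
    proof (rule l2_closure_limit[OF f U])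
      fix e :: real assume "e > 0"
      from order_tendstoD(2)[OF lim this]
      obtain n where n: "sqrt (measure M (B n)) < e" by (auto simp: eventually_sequentially)
      have s: "(\<lambda>x. \<Sum>i<n. indicator (A i) x) \<in> l2_closure M (lin_span f I)"
        by (intro l2_closure_sum f) (use union(3) in auto)
      have "indicator (\<Union>i. A i) x - (\<Sum>i<n. indicator (A i) x) = (indicator (B n) x :: complex)" for x
      proof -
        have "(\<Sum>i<n. indicator (A i) x) = (indicator (\<Union>i<n. A i) x :: complex)"
          using union(1) by (intro indicator_UN_disjoint[symmetric])
            (auto simp: disjoint_family_on_def)
        then show ?thesis by (auto simp: B_def indicator_def)
      qed
      then have "l2_norm M (\<lambda>x. indicator (\<Union>i. A i) x - (\<Sum>i<n. indicator (A i) x)) = l2_norm M (indicator (B n))"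
        by simp
      then show "\<exists>h\<in>l2_closure M (lin_span f I). l2_norm M (\<lambda>x. indicator (\<Union>i. A i) x - h x) < e"
        using s n l2_norm_indicator[OF fin B, of n]
        by (intro bexI[of _ "\<lambda>x. \<Sum>i<n. indicator (A i) x"]) auto
    qed
  qed
qed auto

text \<open>
  If \<open>T\<close> carries \<open>c\<close> times the measure \<open>M\<close> to \<open>N\<close>, then composition with \<open>T\<close> multiplies square norms
  by \<open>1/c\<close>. So Riesz bounds on \<open>M\<close> yield those on \<open>N\<close>, and an element \<open>g\<close> of \<open>L\<^sup>2(N)\<close> is
  approximated by approximating \<open>g \<circ> T\<close> in \<open>L\<^sup>2(M)\<close>. The map \<open>\<pi>\<close> relabels the family.
\<close>

lemma riesz_system_transfer:
  assumes R: "riesz_system M f I"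
    and T [measurable]: "T \<in> M \<rightarrow>\<^sub>M N" and c: "0 < (c::real)"
    and int: "\<And>F. F \<in> borel_measurable N \<Longrightarrow> (\<integral>\<^sup>+y. F y \<partial>N) = ennreal c * (\<integral>\<^sup>+x. F (T x) \<partial>M)"
    and \<pi>: "inj_on \<pi> I"
    and meas: "\<And>n. n \<in> I \<Longrightarrow> f' (\<pi> n) \<in> borel_measurable N"
    and corr: "\<And>n x. n \<in> I \<Longrightarrow> x \<in> space M \<Longrightarrow> f' (\<pi> n) (T x) = f n x"
  shows "riesz_system N f' (\<pi> ` I)"
proof -
  have mem: "g \<in> l2_space N \<longleftrightarrow> (\<lambda>x. g (T x)) \<in> l2_space M" if [measurable]: "g \<in> borel_measurable N" for g
    unfolding l2_space_iff_nn_integral using c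
    by (subst int) (auto simp: ennreal_mult_less_top)
  have norm: "(l2_norm N g)\<^sup>2 = c * (l2_norm M (\<lambda>x. g (T x)))\<^sup>2" if g: "g \<in> l2_space N" for g
  proof -
    have gm [measurable]: "g \<in> borel_measurable N" using g by (rule l2_spaceD)
    have "ennreal ((l2_norm N g)\<^sup>2) = ennreal c * ennreal ((l2_norm M (\<lambda>x. g (T x)))\<^sup>2)"
      using g mem[OF gm] by (simp add: ennreal_l2_norm_square int)
    then show ?thesis using c by (simp add: ennreal_mult[symmetric])
  qed
  have f: "f n \<in> l2_space M" if "n \<in> I" for n using R that by (auto simp: riesz_system_def)
  have f': "f' m \<in> l2_space N" if m: "m \<in> \<pi> ` I" for m
  proof -
    obtain n where n: "n \<in> I" "m = \<pi> n" using m by auto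
    have "(\<lambda>x. f' m (T x)) \<in> l2_space M"
      by (rule l2_space_of_dominated[OF _ l2_spaceD(2)[OF f[OF n(1)]]])
         (use n meas corr in auto)
    then show ?thesis using mem meas n by auto
  qed
  define \<rho> where "\<rho> = inv_into I \<pi>"
  have \<rho>: "\<rho> (\<pi> n) = n" if "n \<in> I" for n using that \<pi> by (simp add: \<rho>_def)
  have lincomb: "(\<Sum>m\<in>\<pi> ` F. a m * f' m (T x)) = (\<Sum>n\<in>F. a (\<pi> n) * f n x)"
    if "F \<subseteq> I" "x \<in> space M" for F a x
    using that corr by (subst sum.reindex) (auto intro: inj_on_subset[OF \<pi>] intro!: sum.cong)
  obtain \<alpha> \<beta> where ab: "riesz_bounds M f I \<alpha> \<beta>" using R by (auto simp: riesz_system_def)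
  have "riesz_bounds N f' (\<pi> ` I) (c * \<alpha>) (c * \<beta>)"
    unfolding riesz_bounds_def
  proof (intro conjI allI impI)
    show "0 < c * \<alpha>" "0 < c * \<beta>" using c ab by (auto simp: riesz_bounds_def)
    fix F' a assume F': "finite F'" "F' \<subseteq> \<pi> ` I"
    then obtain F where F: "F \<subseteq> I" "finite F" "F' = \<pi> ` F"
      using finite_subset_image by metis
    have s: "(\<Sum>m\<in>F'. (cmod (a m))\<^sup>2) = (\<Sum>n\<in>F. (cmod (a (\<pi> n)))\<^sup>2)"
      unfolding F(3) by (subst sum.reindex) (auto intro: inj_on_subset[OF \<pi> F(1)])
    have n: "(l2_norm N (\<lambda>y. \<Sum>m\<in>F'. a m * f' m y))\<^sup>2 = c * (l2_norm M (\<lambda>x. \<Sum>n\<in>F. a (\<pi> n) * f n x))\<^sup>2"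
    proof -
      have "(l2_norm N (\<lambda>y. \<Sum>m\<in>F'. a m * f' m y))\<^sup>2 = c * (l2_norm M (\<lambda>x. \<Sum>m\<in>F'. a m * f' m (T x)))\<^sup>2"
        using F'(2) f' by (intro norm l2_space_lincomb) auto
      also have "l2_norm M (\<lambda>x. \<Sum>m\<in>F'. a m * f' m (T x)) = l2_norm M (\<lambda>x. \<Sum>n\<in>F. a (\<pi> n) * f n x)"
        by (rule l2_norm_cong) (simp add: F(3) lincomb[OF F(1)])
      finally show ?thesis .
    qed
    show "c * \<alpha> * (\<Sum>m\<in>F'. (cmod (a m))\<^sup>2) \<le> (l2_norm N (\<lambda>y. \<Sum>m\<in>F'. a m * f' m y))\<^sup>2"
      "(l2_norm N (\<lambda>y. \<Sum>m\<in>F'. a m * f' m y))\<^sup>2 \<le> c * \<beta> * (\<Sum>m\<in>F'. (cmod (a m))\<^sup>2)"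
      unfolding n s using riesz_boundsD[OF ab F(2,1), of "\<lambda>n. a (\<pi> n)"] c
      by (simp_all add: mult.assoc)
  qed
  moreover have "l2_total N f' (\<pi> ` I)"
    unfolding l2_total_def
  proof
    fix g assume g: "g \<in> l2_space N"
    have gT: "(\<lambda>x. g (T x)) \<in> l2_space M" using g mem l2_spaceD(1) by blast
    show "g \<in> l2_closure N (lin_span f' (\<pi> ` I))"
      unfolding mem_l2_closure_iff
    proof (intro conjI g allI impI)
      fix e :: real assume e: "e > 0"
      have "(\<lambda>x. g (T x)) \<in> l2_closure M (lin_span f I)"
        using R gT by (auto simp: riesz_system_def l2_total_def)
      moreover have "e / sqrt c > 0" using e c by simp
      ultimately obtain F b where F: "finite F" "F \<subseteq> I"
          "l2_norm M (\<lambda>x. g (T x) - (\<Sum>n\<in>F. b n * f n x)) < e / sqrt c"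
        unfolding mem_l2_closure_iff by blast
      define h where "h y = (\<Sum>m\<in>\<pi> ` F. b (\<rho> m) * f' m y)" for y
      have h: "h \<in> l2_space N"
        unfolding h_def using f' F(2) by (intro l2_space_lincomb) auto
      have "h (T x) = (\<Sum>n\<in>F. b n * f n x)" if "x \<in> space M" for x
        unfolding h_def lincomb[OF F(2) that] using \<rho> F(2) by (intro sum.cong) auto
      then have "l2_norm M (\<lambda>x. g (T x) - h (T x)) < e / sqrt c"
        using F(3) by (subst l2_norm_cong[of _ _ "\<lambda>x. g (T x) - (\<Sum>n\<in>F. b n * f n x)"]) auto
      then have "c * (l2_norm M (\<lambda>x. g (T x) - h (T x)))\<^sup>2 < c * (e / sqrt c)\<^sup>2"
        using c by (intro mult_strict_left_mono power_strict_mono) auto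
      also have "\<dots> = e\<^sup>2" using c by (simp add: power_divide)
      finally have "(l2_norm N (\<lambda>y. g y - h y))\<^sup>2 < e\<^sup>2"
        using norm[OF l2_space_diff[OF g h]] by simp
      then have "l2_norm N (\<lambda>y. g y - h y) < e"
        using e by (auto intro: power2_less_imp_less)
      then show "\<exists>F c. finite F \<and> F \<subseteq> \<pi> ` I \<and> l2_norm N (\<lambda>y. g y - (\<Sum>m\<in>F. c m * f' m y)) < e"
        unfolding h_def using F(1,2)
        by (intro exI[of _ "\<pi> ` F"] exI[of _ "\<lambda>m. b (\<rho> m)"]) auto
    qed
  qed
  ultimately show ?thesis using f' unfolding riesz_system_def by blast
qed

text \<open>
  The inequalities for finite sums control the difference of two partial sums by a piece of the
  tail of \<open>\<Sum>|c n|\<^sup>2\<close>; so the partial sums of an \<open>\<ell>\<^sup>2\<close> series are Cauchy, converge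
  by the completeness of \<open>L\<^sup>2\<close>, and the inequalities pass to the limit.
\<close>

lemma riesz_bounds_l2_sum:
  assumes fin: "finite_measure M" and f: "\<And>n. n \<in> I \<Longrightarrow> f n \<in> l2_space M"
    and R: "riesz_bounds M f I \<alpha> \<beta>" and c: "c \<in> ell2 I"
  shows "\<exists>g. has_l2_sum M (\<lambda>n x. c n * f n x) I g \<and>
     \<alpha> * (\<Sum>\<^sub>\<infinity>n\<in>I. (cmod (c n))\<^sup>2) \<le> (l2_norm M g)\<^sup>2 \<and>
     (l2_norm M g)\<^sup>2 \<le> \<beta> * (\<Sum>\<^sub>\<infinity>n\<in>I. (cmod (c n))\<^sup>2)"
proof -
  interpret finite_measure M by fact
  have \<beta>: "\<beta> > 0" using R by (simp add: riesz_bounds_def)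
  define a where "a n = (cmod (c n))\<^sup>2" for n
  define A where "A = (\<Sum>\<^sub>\<infinity>n\<in>I. a n)"
  define S where "S F x = (\<Sum>n\<in>F. c n * f n x)" for F x
  have S: "S F \<in> l2_space M" if "F \<subseteq> I" for F
    unfolding S_def using that f by (intro l2_space_lincomb) auto
  have "(a has_sum A) I"
    using c unfolding A_def a_def ell2_def by (auto intro: has_sum_infsum)
  then have lim: "(sum a \<longlongrightarrow> A) (finite_subsets_at_top I)"
    by (simp add: has_sum_def)
  have "\<exists>X. finite X \<and> X \<subseteq> I \<and> (\<forall>Y. finite Y \<and> X \<subseteq> Y \<and> Y \<subseteq> I \<longrightarrow> \<bar>sum a Y - A\<bar> < 1 / (real k + 1))" for k
  proof -
    have "\<forall>\<^sub>F Y in finite_subsets_at_top I. dist (sum a Y) A < 1 / (real k + 1)"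
      by (rule tendstoD[OF lim]) simp
    then show ?thesis by (simp add: eventually_finite_subsets_at_top dist_real_def)
  qed
  then obtain X0 where X0: "\<And>k. finite (X0 k)" "\<And>k. X0 k \<subseteq> I"
      "\<And>k Y. finite Y \<Longrightarrow> X0 k \<subseteq> Y \<Longrightarrow> Y \<subseteq> I \<Longrightarrow> \<bar>sum a Y - A\<bar> < 1 / (real k + 1)"
    by metis
  define X where "X k = (\<Union>i\<le>k. X0 i)" for k
  have X: "finite (X k)" "X k \<subseteq> I" for k using X0 by (auto simp: X_def)
  have Xmono: "X k \<subseteq> X j" if "k \<le> j" for k j
    unfolding X_def by (rule UN_mono) (use that in auto)
  have XA: "\<bar>sum a Y - A\<bar> < 1 / (real k + 1)" if "finite Y" "X k \<subseteq> Y" "Y \<subseteq> I" for k Y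
    using that by (intro X0) (auto simp: X_def)
  have close: "l2_norm M (\<lambda>x. S F x - S G x) \<le> sqrt (\<beta> * (2 / (real k + 1)))"
    if F: "finite F" "F \<subseteq> I" "X k \<subseteq> F" and G: "finite G" "G \<subseteq> I" "X k \<subseteq> G" for F G k
  proof -
    define D where "D = (F - G) \<union> (G - F)"
    define d where "d n = (if n \<in> F then c n else - c n)" for n
    have D: "finite D" "D \<subseteq> I" "D \<inter> X k = {}" using F G by (auto simp: D_def)
    have eq: "S F x - S G x = (\<Sum>n\<in>D. d n * f n x)" for x
    proof -
      have "S F x = (\<Sum>n\<in>F - G. c n * f n x) + (\<Sum>n\<in>F \<inter> G. c n * f n x)"
        unfolding S_def using F(1) by (subst sum.union_disjoint[symmetric]) (auto intro: arg_cong2[where f=sum])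
      moreover have "S G x = (\<Sum>n\<in>G - F. c n * f n x) + (\<Sum>n\<in>F \<inter> G. c n * f n x)"
        unfolding S_def using G(1) by (subst sum.union_disjoint[symmetric]) (auto intro: arg_cong2[where f=sum])
      moreover have "(\<Sum>n\<in>D. d n * f n x) = (\<Sum>n\<in>F - G. d n * f n x) + (\<Sum>n\<in>G - F. d n * f n x)"
        unfolding D_def using F(1) G(1) by (intro sum.union_disjoint) auto
      moreover have "(\<Sum>n\<in>F - G. d n * f n x) = (\<Sum>n\<in>F - G. c n * f n x)"
        by (intro sum.cong) (auto simp: d_def)
      moreover have "(\<Sum>n\<in>G - F. d n * f n x) = - (\<Sum>n\<in>G - F. c n * f n x)"
        by (subst sum_negf[symmetric], intro sum.cong) (auto simp: d_def)
      ultimately show ?thesis by simp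
    qed
    have "(l2_norm M (\<lambda>x. S F x - S G x))\<^sup>2 \<le> \<beta> * (\<Sum>n\<in>D. (cmod (d n))\<^sup>2)"
      unfolding eq by (rule riesz_boundsD[OF R D(1,2)])
    also have "(\<Sum>n\<in>D. (cmod (d n))\<^sup>2) = sum a D"
      by (intro sum.cong) (auto simp: a_def d_def)
    also have "sum a D = sum a (X k \<union> D) - sum a (X k)"
      using D X by (subst sum.union_disjoint) auto
    also have "\<dots> \<le> 2 / (real k + 1)"
      using XA[of "X k \<union> D" k] XA[of "X k" k] D X by (simp add: abs_if split: if_splits)
    finally have "(l2_norm M (\<lambda>x. S F x - S G x))\<^sup>2 \<le> \<beta> * (2 / (real k + 1))"
      using \<beta> by simp
    then show ?thesis by (simp add: real_le_rsqrt)
  qed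
  have small: "\<exists>k::nat. sqrt (\<beta> * (2 / (real k + 1))) \<le> e" if e: "e > 0" for e
  proof -
    obtain k :: nat where k: "2 * \<beta> / e\<^sup>2 < real k" using reals_Archimedean2 by blast
    then have "2 * \<beta> < real k * e\<^sup>2" using e by (simp add: field_simps)
    also have "\<dots> \<le> (real k + 1) * e\<^sup>2" by (intro mult_right_mono) auto
    finally have "\<beta> * (2 / (real k + 1)) \<le> e\<^sup>2" by (simp add: field_simps)
    then have "sqrt (\<beta> * (2 / (real k + 1))) \<le> sqrt (e\<^sup>2)" by (rule real_sqrt_le_mono)
    then show ?thesis using e by auto
  qed
  have "\<exists>g\<in>l2_space M. (\<lambda>k. l2_norm M (\<lambda>x. g x - S (X k) x)) \<longlonglongrightarrow> 0"
  proof (rule l2_complete)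
    fix e :: real assume "e > 0"
    then obtain k :: nat where "sqrt (\<beta> * (2 / (real k + 1))) \<le> e" using small by blast
    then show "\<exists>N. \<forall>i\<ge>N. \<forall>j\<ge>N. l2_norm M (\<lambda>x. S (X i) x - S (X j) x) \<le> e"
      using close[OF X(1) X(2) Xmono X(1) X(2) Xmono] by (meson order_trans)
  qed (intro S X)
  then obtain g where g: "g \<in> l2_space M" and glim: "(\<lambda>k. l2_norm M (\<lambda>x. g x - S (X k) x)) \<longlonglongrightarrow> 0"
    by blast
  have gS: "l2_norm M (\<lambda>x. g x - S F x) \<le> sqrt (\<beta> * (2 / (real k + 1)))"
    if F: "finite F" "F \<subseteq> I" "X k \<subseteq> F" for F k
  proof (rule LIMSEQ_le_const)
    show "(\<lambda>j. l2_norm M (\<lambda>x. g x - S (X j) x) + sqrt (\<beta> * (2 / (real k + 1)))) \<longlonglongrightarrow> sqrt (\<beta> * (2 / (real k + 1)))"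
      using tendsto_add[OF glim tendsto_const] by simp
    have "l2_norm M (\<lambda>x. g x - S F x) \<le> l2_norm M (\<lambda>x. g x - S (X j) x) + sqrt (\<beta> * (2 / (real k + 1)))"
      if "j \<ge> k" for j
      using l2_norm_triangle_diff[OF g S[OF X(2)] S[OF F(2)], of j] close[OF X(1) X(2) Xmono[OF that] F]
      by linarith
    then show "\<exists>N. \<forall>j\<ge>N. l2_norm M (\<lambda>x. g x - S F x) \<le> l2_norm M (\<lambda>x. g x - S (X j) x) + sqrt (\<beta> * (2 / (real k + 1)))"
      by blast
  qed
  have "((\<lambda>F. l2_norm M (\<lambda>x. g x - S F x)) \<longlongrightarrow> 0) (finite_subsets_at_top I)"
  proof (rule tendstoI)
    fix e :: real assume e: "e > 0"
    obtain k :: nat where k: "sqrt (\<beta> * (2 / (real k + 1))) \<le> e / 2" using small[of "e / 2"] e by auto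
    show "\<forall>\<^sub>F F in finite_subsets_at_top I. dist (l2_norm M (\<lambda>x. g x - S F x)) 0 < e"
      unfolding eventually_finite_subsets_at_top
    proof (intro exI[of _ "X k"] conjI allI impI X)
      fix Y assume "finite Y \<and> X k \<subseteq> Y \<and> Y \<subseteq> I"
      then have "l2_norm M (\<lambda>x. g x - S Y x) \<le> e / 2" using gS[of Y k] k by simp
      then show "dist (l2_norm M (\<lambda>x. g x - S Y x)) 0 < e" using e by simp
    qed
  qed
  then have sum: "has_l2_sum M (\<lambda>n x. c n * f n x) I g"
    using g by (simp add: has_l2_sum_def S_def)
  have "(\<lambda>k. l2_norm M (S (X k))) \<longlonglongrightarrow> l2_norm M g"
  proof (rule LIMSEQ_I)
    fix e :: real assume "e > 0"
    from order_tendstoD(2)[OF glim this] obtain N where N: "\<And>k. k \<ge> N \<Longrightarrow> l2_norm M (\<lambda>x. g x - S (X k) x) < e"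
      by (auto simp: eventually_sequentially)
    have "norm (l2_norm M (S (X k)) - l2_norm M g) < e" if "k \<ge> N" for k
      using l2_norm_le_diff[OF g S[OF X(2)], of k] l2_norm_le_diff[OF S[OF X(2)] g, of k] N[OF that]
      by (simp add: l2_norm_minus_commute[of M g "S (X k)"] abs_less_iff)
    then show "\<exists>N. \<forall>k\<ge>N. norm (l2_norm M (S (X k)) - l2_norm M g) < e" by blast
  qed
  then have normlim: "(\<lambda>k. (l2_norm M (S (X k)))\<^sup>2) \<longlonglongrightarrow> (l2_norm M g)\<^sup>2"
    by (rule tendsto_power)
  have sumlim: "(\<lambda>k. sum a (X k)) \<longlonglongrightarrow> A"
  proof (rule LIMSEQ_I)
    fix e :: real assume "e > 0"
    then obtain N :: nat where N: "1 / e < real N" using reals_Archimedean2 by blast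
    have "norm (sum a (X k) - A) < e" if "k \<ge> N" for k
    proof -
      have "1 < e * (real N + 1)" using N \<open>e > 0\<close> by (simp add: field_simps)
      then have "1 / (real N + 1) < e" by (simp add: field_simps)
      then show ?thesis using XA[OF X(1) Xmono[OF that] X(2)] by simp
    qed
    then show "\<exists>N. \<forall>k\<ge>N. norm (sum a (X k) - A) < e" by blast
  qed
  have "\<alpha> * A \<le> (l2_norm M g)\<^sup>2"
    by (rule LIMSEQ_le[OF tendsto_mult[OF tendsto_const sumlim] normlim])
       (use riesz_boundsD(1)[OF R X(1) X(2)] in \<open>auto simp: S_def[abs_def] a_def\<close>)
  moreover have "(l2_norm M g)\<^sup>2 \<le> \<beta> * A"
    by (rule LIMSEQ_le[OF normlim tendsto_mult[OF tendsto_const sumlim]])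
       (use riesz_boundsD(2)[OF R X(1) X(2)] in \<open>auto simp: S_def[abs_def] a_def\<close>)
  ultimately show ?thesis using sum unfolding A_def a_def by blast
qed

lemma riesz_system_imp_basis:
  assumes fin: "finite_measure M" and R: "riesz_system M f I" and "countable I"
  shows "l2_riesz_basis M f I"
proof -
  obtain \<alpha> \<beta>' where R': "riesz_bounds M f I \<alpha> \<beta>'" using R by (auto simp: riesz_system_def)
  define \<beta> where "\<beta> = max \<alpha> \<beta>'"
  have f: "f n \<in> l2_space M" if "n \<in> I" for n using R that by (auto simp: riesz_system_def)
  have b: "riesz_bounds M f I \<alpha> \<beta>"
  proof -
    have "\<beta>' * (\<Sum>n\<in>F. (cmod (c n))\<^sup>2) \<le> \<beta> * (\<Sum>n\<in>F. (cmod (c n))\<^sup>2)" for F :: "'b set" and c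
      by (intro mult_right_mono sum_nonneg) (auto simp: \<beta>_def)
    then show ?thesis using R' unfolding riesz_bounds_def \<beta>_def
      by (meson less_max_iff_disj order_trans)
  qed
  have "\<alpha> > 0" "\<alpha> \<le> \<beta>" using b by (auto simp: riesz_bounds_def \<beta>_def)
  moreover have "l2_closure M (lin_span f I) = l2_space M"
    using R by (auto simp: riesz_system_def l2_total_def l2_closure_def)
  ultimately show ?thesis
    unfolding l2_riesz_basis_def
    using \<open>countable I\<close> f riesz_bounds_l2_sum[OF fin f b]
    by (intro conjI exI[of _ \<alpha>] exI[of _ \<beta>]) auto
qed

section \<open>Perturbation of orthonormal systems\<close>

text \<open>
  A family that is within relative distance \<open>\<kappa> < 1\<close> of an orthonormal basis, in the sense of Paley
  and Wiener, is a Riesz system. For the totality, approximating \<open>g\<close> by \<open>\<Sum>c n * v n\<close> and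
  replacing \<open>v\<close> by \<open>u\<close> shows that the distance \<open>d\<close> from \<open>g\<close> to the span of \<open>u\<close> is at most
  \<open>\<kappa>\<close> times the norm of \<open>g\<close>. Since \<open>d\<close> does not change when an element of the span is subtracted
  from \<open>g\<close>, this gives \<open>d \<le> \<kappa> * d\<close> and hence \<open>d = 0\<close>.
\<close>

lemma paley_wiener_perturbation:
  assumes v: "\<And>n. n \<in> I \<Longrightarrow> v n \<in> l2_space M" and u: "\<And>n. n \<in> I \<Longrightarrow> u n \<in> l2_space M"
    and onb: "\<And>F c. finite F \<Longrightarrow> F \<subseteq> I \<Longrightarrow> (l2_norm M (\<lambda>x. \<Sum>n\<in>F. c n * v n x))\<^sup>2 = (\<Sum>n\<in>F. (cmod (c n))\<^sup>2)"
    and total: "l2_total M v I" and \<kappa>: "0 \<le> \<kappa>" "\<kappa> < 1"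
    and pert: "\<And>F c. finite F \<Longrightarrow> F \<subseteq> I \<Longrightarrow>
      l2_norm M (\<lambda>x. \<Sum>n\<in>F. c n * (u n x - v n x)) \<le> \<kappa> * sqrt (\<Sum>n\<in>F. (cmod (c n))\<^sup>2)"
  shows "riesz_system M u I"
proof -
  have onb': "l2_norm M (\<lambda>x. \<Sum>n\<in>F. c n * v n x) = sqrt (\<Sum>n\<in>F. (cmod (c n))\<^sup>2)"
    if "finite F" "F \<subseteq> I" for F c
    using onb[OF that, of c] real_sqrt_unique l2_norm_nonneg by metis
  have pert': "l2_norm M (\<lambda>x. (\<Sum>n\<in>F. c n * u n x) - (\<Sum>n\<in>F. c n * v n x)) \<le> \<kappa> * sqrt (\<Sum>n\<in>F. (cmod (c n))\<^sup>2)"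
    if "finite F" "F \<subseteq> I" for F c
    using pert[OF that, of c] by (simp add: sum_subtractf right_diff_distrib)
  have mem: "(\<lambda>x. \<Sum>n\<in>F. c n * u n x) \<in> l2_space M" "(\<lambda>x. \<Sum>n\<in>F. c n * v n x) \<in> l2_space M"
    if "F \<subseteq> I" for F c
    using that u v by (auto intro!: l2_space_lincomb)
  have "riesz_bounds M u I ((1 - \<kappa>)\<^sup>2) ((1 + \<kappa>)\<^sup>2)"
    unfolding riesz_bounds_def
  proof (intro conjI allI impI)
    show "0 < (1 - \<kappa>)\<^sup>2" "0 < (1 + \<kappa>)\<^sup>2" using \<kappa> by auto
    fix F c assume F: "finite F" "F \<subseteq> I"
    define s where "s = sqrt (\<Sum>n\<in>F. (cmod (c n))\<^sup>2)"
    have s: "s \<ge> 0" "s\<^sup>2 = (\<Sum>n\<in>F. (cmod (c n))\<^sup>2)" by (auto simp: s_def sum_nonneg)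
    have "s \<le> \<kappa> * s + l2_norm M (\<lambda>x. \<Sum>n\<in>F. c n * u n x)"
      using l2_norm_le_diff[OF mem(2,1)[OF F(2)], of c c] pert'[OF F, of c] onb'[OF F, of c]
      by (subst (asm) l2_norm_minus_commute) (simp add: s_def)
    then have "((1 - \<kappa>) * s)\<^sup>2 \<le> (l2_norm M (\<lambda>x. \<Sum>n\<in>F. c n * u n x))\<^sup>2"
      using \<kappa> s(1) by (intro power_mono mult_nonneg_nonneg) (auto simp: algebra_simps)
    then show "(1 - \<kappa>)\<^sup>2 * (\<Sum>n\<in>F. (cmod (c n))\<^sup>2) \<le> (l2_norm M (\<lambda>x. \<Sum>n\<in>F. c n * u n x))\<^sup>2"
      by (simp add: s(2) power_mult_distrib)
    have "l2_norm M (\<lambda>x. \<Sum>n\<in>F. c n * u n x) \<le> (1 + \<kappa>) * s"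
      using l2_norm_le_diff[OF mem(1,2)[OF F(2)], of c c] pert'[OF F, of c] onb'[OF F, of c]
      by (simp add: s_def algebra_simps)
    then have "(l2_norm M (\<lambda>x. \<Sum>n\<in>F. c n * u n x))\<^sup>2 \<le> ((1 + \<kappa>) * s)\<^sup>2"
      by (intro power_mono) auto
    then show "(l2_norm M (\<lambda>x. \<Sum>n\<in>F. c n * u n x))\<^sup>2 \<le> (1 + \<kappa>)\<^sup>2 * (\<Sum>n\<in>F. (cmod (c n))\<^sup>2)"
      by (simp add: s(2) power_mult_distrib)
  qed
  moreover have "l2_total M u I"
    unfolding l2_total_def
  proof
    define V where "V = lin_span u I"
    have V: "h \<in> l2_space M" if "h \<in> V" for h using lin_span_subset_l2[OF u] that by (auto simp: V_def)
    have approx: "\<exists>h\<in>V. l2_norm M (\<lambda>x. g x - h x) \<le> \<kappa> * l2_norm M g + e"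
      if g: "g \<in> l2_space M" and e: "e > 0" for g e
    proof -
      obtain F c where F: "finite F" "F \<subseteq> I" "l2_norm M (\<lambda>x. g x - (\<Sum>n\<in>F. c n * v n x)) < e / 2"
        using total g e half_gt_zero unfolding l2_total_def subset_iff mem_l2_closure_iff by metis
      define s where "s = sqrt (\<Sum>n\<in>F. (cmod (c n))\<^sup>2)"
      have "s \<le> l2_norm M g + e / 2"
        using l2_norm_le_diff[OF mem(2)[OF F(2)] g, of c] F(3) onb'[OF F(1,2), of c]
        by (subst (asm) l2_norm_minus_commute) (simp add: s_def)
      then have "\<kappa> * s \<le> \<kappa> * (l2_norm M g + e / 2)" using \<kappa> by (intro mult_left_mono)
      also have "\<dots> \<le> \<kappa> * l2_norm M g + e / 2"
        using \<kappa> e mult_right_mono[of \<kappa> 1 e] by (simp add: field_simps)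
      finally have "\<kappa> * s \<le> \<kappa> * l2_norm M g + e / 2" .
      moreover have "l2_norm M (\<lambda>x. g x - (\<Sum>n\<in>F. c n * u n x)) \<le> e / 2 + \<kappa> * s"
        using l2_norm_triangle_diff[OF g mem(2)[OF F(2)] mem(1)[OF F(2)], of c c] F(3) pert'[OF F(1,2), of c]
        by (subst (asm) (3) l2_norm_minus_commute) (simp add: s_def)
      moreover have "(\<lambda>x. \<Sum>n\<in>F. c n * u n x) \<in> V"
        using F(1,2) by (auto simp: V_def lin_span_def)
      ultimately show ?thesis
        by (intro bexI[of _ "\<lambda>x. \<Sum>n\<in>F. c n * u n x"]) linarith+
    qed
    fix g assume g: "g \<in> l2_space M"
    define d where "d = (INF h\<in>V. l2_norm M (\<lambda>x. g x - h x))"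
    have bdd: "bdd_below ((\<lambda>h. l2_norm M (\<lambda>x. g x - h x)) ` V)"
      by (rule bdd_belowI[of _ 0]) auto
    have d: "d \<le> l2_norm M (\<lambda>x. g x - h x)" if "h \<in> V" for h
      unfolding d_def using bdd that by (rule cINF_lower)
    have ne: "V \<noteq> {}" using approx[OF g, of 1] by auto
    have near: "\<exists>h\<in>V. l2_norm M (\<lambda>x. g x - h x) < d + e" if "e > 0" for e
    proof -
      have "(INF h\<in>V. l2_norm M (\<lambda>x. g x - h x)) < d + e" using that by (simp add: d_def)
      then show ?thesis using cINF_less_iff[OF ne bdd] by blast
    qed
    have "d \<le> \<kappa> * d"
    proof (rule field_le_epsilon)
      fix e :: real assume e: "e > 0"
      obtain h where h: "h \<in> V" "l2_norm M (\<lambda>x. g x - h x) < d + e / 2"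
        using near[of "e / 2"] e by auto
      obtain k where k: "k \<in> V" "l2_norm M (\<lambda>x. g x - h x - k x) \<le> \<kappa> * l2_norm M (\<lambda>x. g x - h x) + e / 2"
        using approx[OF l2_space_diff[OF g V[OF h(1)]], of "e / 2"] e by auto
      have "d \<le> l2_norm M (\<lambda>x. g x - (h x + k x))"
        using h(1) k(1) by (intro d) (auto simp: V_def intro: lin_span_add)
      also have "\<dots> = l2_norm M (\<lambda>x. g x - h x - k x)" by (simp add: algebra_simps)
      also have "\<dots> \<le> \<kappa> * (d + e / 2) + e / 2"
        using k(2) h(2) \<kappa> mult_left_mono[of "l2_norm M (\<lambda>x. g x - h x)" "d + e / 2" \<kappa>] by linarith
      also have "\<dots> \<le> \<kappa> * d + e"
        using \<kappa> e mult_right_mono[of \<kappa> 1 e] by (simp add: field_simps)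
      finally show "d \<le> \<kappa> * d + e" .
    qed
    then have "d \<le> 0"
      using \<kappa> mult_strict_right_mono[of \<kappa> 1 d] by (cases "d > 0") auto
    show "g \<in> l2_closure M (lin_span u I)"
      unfolding l2_closure_def V_def[symmetric]
    proof (intro CollectI conjI g allI impI)
      fix e :: real assume "e > 0"
      from near[OF this] \<open>d \<le> 0\<close> show "\<exists>h\<in>V. l2_norm M (\<lambda>x. g x - h x) < e" by force
    qed
  qed
  ultimately show ?thesis using u unfolding riesz_system_def by blast
qed

section \<open>Exponentials on an interval\<close>

abbreviation lborel_on :: "'a::euclidean_space set \<Rightarrow> 'a measure" where
  "lborel_on S \<equiv> restrict_space lborel S"

lemma finite_measure_lborel_on [intro]: "finite_measure (lborel_on {a..b::real})"
  by (rule finite_measureI) (simp add: space_restrict_space emeasure_restrict_space emeasure_lborel_Icc_eq)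

lemma borel_measurable_lborel_on: "f \<in> borel_measurable borel \<Longrightarrow> f \<in> borel_measurable (lborel_on S)"
  by (simp add: measurable_restrict_space1)

lemma nn_integral_lborel_on:
  assumes "S \<in> sets borel"
  shows "(\<integral>\<^sup>+x. F x \<partial>lborel_on S) = (\<integral>\<^sup>+x. F x * indicator S x \<partial>lborel)"
  using assms by (intro nn_integral_restrict_space) auto

lemma l2_space_subset:
  assumes "f \<in> borel_measurable borel" "f \<in> l2_space (lborel_on T)" "S \<subseteq> T" "S \<in> sets borel" "T \<in> sets borel"
  shows "f \<in> l2_space (lborel_on S)"
proof -
  have "(\<integral>\<^sup>+x. ennreal ((cmod (f x))\<^sup>2) \<partial>lborel_on S) \<le> (\<integral>\<^sup>+x. ennreal ((cmod (f x))\<^sup>2) \<partial>lborel_on T)"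
    using assms by (auto simp: nn_integral_lborel_on intro!: nn_integral_mono split: split_indicator)
  also have "\<dots> < \<infinity>" using assms(2) by (simp add: l2_space_iff_nn_integral)
  finally show ?thesis
    using assms(1) by (simp add: l2_space_iff_nn_integral borel_measurable_lborel_on)
qed

lemma l2_norm_split:
  fixes a b c :: real
  assumes f [measurable]: "f \<in> borel_measurable borel" and f2: "f \<in> l2_space (lborel_on {a..c})"
    and ab: "a \<le> b" "b \<le> c"
  shows "(l2_norm (lborel_on {a..c}) f)\<^sup>2 = (l2_norm (lborel_on {a..b}) f)\<^sup>2 + (l2_norm (lborel_on {b..c}) f)\<^sup>2"
proof -
  have sub: "f \<in> l2_space (lborel_on {a..b})" "f \<in> l2_space (lborel_on {b..c})"
    by (rule l2_space_subset[OF f f2]; use ab in auto)+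
  have "ennreal ((l2_norm (lborel_on {a..c}) f)\<^sup>2)
      = (\<integral>\<^sup>+x. ennreal ((cmod (f x))\<^sup>2) * indicator {a..b} x + ennreal ((cmod (f x))\<^sup>2) * indicator {b..c} x \<partial>lborel)"
  proof -
    have "AE x in lborel. ennreal ((cmod (f x))\<^sup>2) * indicator {a..c} x
        = ennreal ((cmod (f x))\<^sup>2) * indicator {a..b} x + ennreal ((cmod (f x))\<^sup>2) * indicator {b..c} x"
      using AE_lborel_singleton[of b] by eventually_elim (use ab in \<open>simp add: indicator_def\<close>)
    then show ?thesis
      unfolding ennreal_l2_norm_square[OF f2]
      by (subst nn_integral_lborel_on, simp, rule nn_integral_cong_AE)
  qed
  also have "\<dots> = ennreal ((l2_norm (lborel_on {a..b}) f)\<^sup>2) + ennreal ((l2_norm (lborel_on {b..c}) f)\<^sup>2)"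
    by (subst nn_integral_add) (auto simp: ennreal_l2_norm_square sub nn_integral_lborel_on)
  also have "\<dots> = ennreal ((l2_norm (lborel_on {a..b}) f)\<^sup>2 + (l2_norm (lborel_on {b..c}) f)\<^sup>2)"
    by simp
  finally show ?thesis by (subst (asm) ennreal_inj) auto
qed

lemma l2_norm_split_le:
  fixes a b c :: real
  assumes "f \<in> borel_measurable borel" "f \<in> l2_space (lborel_on {a..c})" "a \<le> b" "b \<le> c"
  shows "l2_norm (lborel_on {a..c}) f \<le> l2_norm (lborel_on {a..b}) f + l2_norm (lborel_on {b..c}) f"
  by (rule power2_le_imp_le) (simp_all add: l2_norm_split[OF assms] power2_sum)

lemma l2_norm_subset:
  fixes a b c d :: real
  assumes f: "f \<in> borel_measurable borel" and f2: "f \<in> l2_space (lborel_on {a..d})"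
    and abcd: "a \<le> b" "b \<le> c" "c \<le> d"
  shows "l2_norm (lborel_on {b..c}) f \<le> l2_norm (lborel_on {a..d}) f"
proof -
  have "f \<in> l2_space (lborel_on {a..c})" by (rule l2_space_subset[OF f f2]) (use abcd in auto)
  from l2_norm_split[OF f this, of b] l2_norm_split[OF f f2, of c] abcd
  have "(l2_norm (lborel_on {b..c}) f)\<^sup>2 \<le> (l2_norm (lborel_on {a..d}) f)\<^sup>2"
    by (simp add: add_increasing add_increasing2)
  then show ?thesis by (auto intro: power2_le_imp_le)
qed

lemma l2_shift:
  fixes a b s :: real
  assumes f [measurable]: "f \<in> borel_measurable borel" and f2: "f \<in> l2_space (lborel_on {a + s..b + s})"
  shows "(\<lambda>x. f (x + s)) \<in> l2_space (lborel_on {a..b})"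
    "l2_norm (lborel_on {a..b}) (\<lambda>x. f (x + s)) = l2_norm (lborel_on {a + s..b + s}) f"
proof -
  have "(\<integral>\<^sup>+x. ennreal ((cmod (f x))\<^sup>2) * indicator {a + s..b + s} x \<partial>lborel)
      = (\<integral>\<^sup>+x. ennreal ((cmod (f (s + 1 * x)))\<^sup>2) * indicator {a + s..b + s} (s + 1 * x) \<partial>lborel)"
    using nn_integral_real_affine[of "\<lambda>x. ennreal ((cmod (f x))\<^sup>2) * indicator {a + s..b + s} x" 1 s] by simp
  also have "\<dots> = (\<integral>\<^sup>+x. ennreal ((cmod (f (x + s)))\<^sup>2) * indicator {a..b} x \<partial>lborel)"
    by (intro nn_integral_cong) (auto simp: add.commute split: split_indicator)
  finally have eq: "(\<integral>\<^sup>+x. ennreal ((cmod (f (x + s)))\<^sup>2) \<partial>lborel_on {a..b})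
      = (\<integral>\<^sup>+x. ennreal ((cmod (f x))\<^sup>2) \<partial>lborel_on {a + s..b + s})"
    by (simp add: nn_integral_lborel_on)
  show f3: "(\<lambda>x. f (x + s)) \<in> l2_space (lborel_on {a..b})"
    using f2 unfolding l2_space_iff_nn_integral eq by (auto intro!: borel_measurable_lborel_on)
  have "ennreal ((l2_norm (lborel_on {a..b}) (\<lambda>x. f (x + s)))\<^sup>2) = ennreal ((l2_norm (lborel_on {a + s..b + s}) f)\<^sup>2)"
    unfolding ennreal_l2_norm_square[OF f2] ennreal_l2_norm_square[OF f3] eq ..
  then show "l2_norm (lborel_on {a..b}) (\<lambda>x. f (x + s)) = l2_norm (lborel_on {a + s..b + s}) f"
    by (simp add: power2_eq_iff_nonneg)
qed

definition wave :: "int \<Rightarrow> real \<Rightarrow> complex" where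
  "wave m t = cis (2 * pi * (of_int m * t))"

lemma norm_wave [simp]: "cmod (wave m t) = 1"
  by (simp add: wave_def)

lemma continuous_on_wave: "continuous_on S (wave m)"
  unfolding wave_def by (intro continuous_intros)

lemma borel_measurable_wave [measurable]: "wave m \<in> borel_measurable borel"
  by (rule borel_measurable_continuous_onI) (rule continuous_on_wave)

lemma wave_0 [simp]: "wave 0 t = 1"
  by (simp add: wave_def)

lemma wave_mult: "wave m t * wave k t = wave (m + k) t"
  by (simp add: wave_def cis_mult algebra_simps)

lemma wave_add: "wave m (s + t) = wave m s * wave m t"
  by (simp add: wave_def cis_mult algebra_simps)

lemma cnj_wave: "cnj (wave m t) = wave (- m) t"
  by (simp add: wave_def cis_cnj)

lemma wave_int: "wave m (of_int k) = 1"
proof -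
  have "wave m (of_int k) = cis (2 * pi * of_int (m * k))" by (simp add: wave_def)
  also have "\<dots> = 1" by (rule cis_multiple_2pi) (rule Ints_of_int)
  finally show ?thesis .
qed

lemma wave_add_1: "wave m (t + 1) = wave m t"
  using wave_int[of m 1] by (simp add: wave_add)

lemma wave_mem_l2: "(\<lambda>t. wave m t) \<in> l2_space (lborel_on {a..b})"
  by (rule l2_space_of_bounded[of _ _ 1]) (auto intro: borel_measurable_lborel_on)

lemma lborel_on_integral_FTC:
  fixes F f :: "real \<Rightarrow> complex"
  assumes "a \<le> b" "\<And>x. (F has_vector_derivative f x) (at x)" "continuous_on {a..b} f"
  shows "(LINT t|lborel_on {a..b}. f t) = F b - F a"
proof -
  have "(LINT t|lborel_on {a..b}. f t) = (\<integral>x. indicator {a..b} x *\<^sub>R f x \<partial>lborel)"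
    by (subst integral_restrict_space) auto
  also have "\<dots> = F b - F a"
    using assms by (intro integral_FTC_atLeastAtMost) (auto intro: has_vector_derivative_at_within)
  finally show ?thesis .
qed

lemma integral_wave: "(LINT t|lborel_on {0..1}. wave m t) = (if m = 0 then 1 else 0)"
proof (cases "m = 0")
  case True
  have "(LINT t|lborel_on {0..1::real}. (1::complex)) = 1 - 0"
    using lborel_on_integral_FTC[of 0 1 "\<lambda>x. of_real x" "\<lambda>x. 1"]
    by (auto intro!: derivative_eq_intros simp: has_vector_derivative_def scaleR_conv_of_real)
  then show ?thesis using True by simp
next
  case False
  define w where "w = 2 * pi * of_int m * \<i>"
  have w: "w \<noteq> 0" using False by (simp add: w_def)
  have we: "wave m t = exp (w * of_real t)" for t
    by (simp add: wave_def w_def cis_conv_exp algebra_simps)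
  have "(LINT t|lborel_on {0..1::real}. wave m t) = wave m 1 / w - wave m 0 / w"
  proof (rule lborel_on_integral_FTC)
    fix x :: real
    have "((\<lambda>z. exp (w * z) / w) has_field_derivative exp (w * of_real x)) (at (of_real x))"
      using w by (auto intro!: derivative_eq_intros)
    then show "((\<lambda>x. wave m x / w) has_vector_derivative wave m x) (at x)"
      unfolding we by (rule has_vector_derivative_real_field)
  qed (auto intro: continuous_on_wave)
  then show ?thesis using False wave_int[of m 0] wave_int[of m 1] by simp
qed

lemma norm_sum_wave:
  assumes "finite F"
  shows "(l2_norm (lborel_on {0..1}) (\<lambda>t. \<Sum>m\<in>F. c m * wave m t))\<^sup>2 = (\<Sum>m\<in>F. (cmod (c m))\<^sup>2)"
proof -
  have eq: "complex_of_real ((cmod (\<Sum>m\<in>F. c m * wave m t))\<^sup>2)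
      = (\<Sum>m\<in>F. \<Sum>k\<in>F. c m * cnj (c k) * wave (m - k) t)" for t
    unfolding complex_norm_square cnj_sum sum_product
    by (intro sum.cong) (auto simp: cnj_wave wave_mult[of m t "- k" for m k, simplified, symmetric] mult_ac)
  have i: "integrable (lborel_on {0..1}) (\<lambda>t. a * wave m t)" for a m
  proof -
    interpret finite_measure "lborel_on {0..1::real}" by (rule finite_measure_lborel_on)
    show ?thesis by (rule l2_imp_integrable(1)) (rule l2_space_scale[OF wave_mem_l2])
  qed
  have "complex_of_real (LINT t|lborel_on {0..1}. (cmod (\<Sum>m\<in>F. c m * wave m t))\<^sup>2)
      = (LINT t|lborel_on {0..1}. (\<Sum>m\<in>F. \<Sum>k\<in>F. c m * cnj (c k) * wave (m - k) t))"
    unfolding integral_complex_of_real[symmetric] eq ..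
  also have "\<dots> = (\<Sum>m\<in>F. \<Sum>k\<in>F. c m * cnj (c k) * (if m - k = 0 then 1 else 0))"
    by (subst Bochner_Integration.integral_sum, intro Bochner_Integration.integrable_sum i,
        intro sum.cong refl, subst Bochner_Integration.integral_sum, rule i,
        intro sum.cong refl, subst integral_mult_right_zero, subst integral_wave, rule refl)
  also have "\<dots> = (\<Sum>m\<in>F. complex_of_real ((cmod (c m))\<^sup>2))"
    using assms by (simp flip: complex_norm_square add: if_distrib[where f="\<lambda>x. _ * x"] sum.delta cong: if_cong)
  finally have "complex_of_real (LINT t|lborel_on {0..1}. (cmod (\<Sum>m\<in>F. c m * wave m t))\<^sup>2)
      = complex_of_real (\<Sum>m\<in>F. (cmod (c m))\<^sup>2)" by simp
  then show ?thesis unfolding l2_norm_square of_real_eq_iff .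
qed

section \<open>Totality of the exponentials with integer frequencies\<close>

text \<open>
  The error of the Fourier series of the sawtooth \<open>t - 1/2\<close>. Its square norm on the unit interval
  is the tail of \<open>\<Sum>1/(2\<pi>\<^sup>2n\<^sup>2)\<close>, because \<open>1/12 = (1/(2\<pi>\<^sup>2)) * (\<pi>\<^sup>2/6)\<close>.
\<close>

definition sawtooth_error :: "nat \<Rightarrow> real \<Rightarrow> real" where
  "sawtooth_error K t = t - 1 / 2 + (\<Sum>n<K. sin (2 * pi * real (Suc n) * t) / (pi * real (Suc n)))"

lemma has_integral_sin_mult_sin:
  assumes "m > 0" "n > 0"
  shows "((\<lambda>t. sin (2 * pi * real m * t) * sin (2 * pi * real n * t)) has_integral (if m = n then 1 / 2 else 0)) {0..1}"
proof -
  define F where "F k t = (if k = 0 then t else sin (2 * pi * of_int k * t) / (2 * pi * of_int k))" for k :: int and t :: real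
  have F: "(F k has_real_derivative cos (2 * pi * of_int k * t)) (at t within S)" for k t S
    by (cases "k = 0") (auto intro!: derivative_eq_intros simp: F_def[abs_def])
  have F01: "F k 1 - F k 0 = (if k = 0 then 1 else 0)" for k
  proof -
    have "sin (2 * pi * of_int k) = 0"
      by (rule sin_zero_iff_int2[THEN iffD2]) (rule exI[of _ "2 * k"], simp)
    then show ?thesis by (simp add: F_def)
  qed
  define k where "k = int m - int n"
  define l where "l = int m + int n"
  have "((\<lambda>t. (cos (2 * pi * of_int k * t) - cos (2 * pi * of_int l * t)) / 2) has_integral
      ((F k 1 - F l 1) / 2 - (F k 0 - F l 0) / 2)) {0..1}"
    by (rule fundamental_theorem_of_calculus)
       (auto intro!: derivative_eq_intros F simp: has_real_derivative_iff_has_vector_derivative[symmetric])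
  also have "(F k 1 - F l 1) / 2 - (F k 0 - F l 0) / 2 = (if m = n then 1 / 2 else 0)"
    using F01[of k] F01[of l] assms by (auto simp: k_def l_def diff_divide_distrib split: if_splits)
  also have "(\<lambda>t. (cos (2 * pi * of_int k * t) - cos (2 * pi * of_int l * t)) / 2)
      = (\<lambda>t. sin (2 * pi * real m * t) * sin (2 * pi * real n * t))"
    by (simp add: fun_eq_iff sin_times_sin k_def l_def algebra_simps)
  finally show ?thesis .
qed

lemma has_integral_linear_mult_sin:
  assumes "n > 0"
  shows "((\<lambda>t. (t - 1 / 2) * sin (2 * pi * real n * t)) has_integral (- 1 / (2 * pi * real n))) {0..1}"
proof -
  define w where "w = 2 * pi * real n"
  have w: "w \<noteq> 0" using assms by (simp add: w_def)
  define F where "F t = - (t - 1 / 2) * cos (w * t) / w + sin (w * t) / w\<^sup>2" for t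
  have "((\<lambda>t. (t - 1 / 2) * sin (w * t)) has_integral (F 1 - F 0)) {0..1}"
    by (rule fundamental_theorem_of_calculus)
       (use w in \<open>auto intro!: derivative_eq_intros
          simp: F_def[abs_def] has_real_derivative_iff_has_vector_derivative[symmetric] power2_eq_square field_simps\<close>)
  moreover have "sin w = 0" "cos w = 1"
    using sin_2npi[of n] cos_2npi[of n] by (simp_all add: w_def mult_ac)
  then have "F 1 - F 0 = - 1 / w" by (simp add: F_def field_simps)
  ultimately show ?thesis by (simp add: w_def)
qed

lemma has_integral_sawtooth_error:
  "((\<lambda>t. (sawtooth_error K t)\<^sup>2) has_integral (1 / 12 - (\<Sum>n<K. 1 / (2 * pi\<^sup>2 * (real (Suc n))\<^sup>2)))) {0..1}"
proof (induction K)
  case 0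
  have "((\<lambda>t. (t - 1 / 2)\<^sup>2) has_integral ((1 - 1 / 2) ^ 3 / 3 - (0 - 1 / 2) ^ 3 / (3::real))) {0..1}"
    by (rule fundamental_theorem_of_calculus)
       (auto intro!: derivative_eq_intros simp: has_real_derivative_iff_has_vector_derivative[symmetric])
  then show ?case by (simp add: sawtooth_error_def power3_eq_cube)
next
  case (Suc K)
  define s where "s t = sin (2 * pi * real (Suc K) * t)" for t
  define p where "p = pi * real (Suc K)"
  have p: "p > 0" by (simp add: p_def)
  have step: "sawtooth_error (Suc K) t = sawtooth_error K t + s t / p" for t
    by (simp add: sawtooth_error_def s_def p_def)
  have "((\<lambda>t. (t - 1 / 2) * s t + (\<Sum>n<K. sin (2 * pi * real (Suc n) * t) * s t / (pi * real (Suc n))))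
      has_integral (- 1 / (2 * p) + (\<Sum>n<K. (if Suc n = Suc K then 1 / 2 else 0) / (pi * real (Suc n))))) {0..1}"
    unfolding s_def
    using has_integral_linear_mult_sin[of "Suc K"]
    by (intro has_integral_add has_integral_sum has_integral_divide has_integral_sin_mult_sin)
       (simp_all add: p_def mult_ac)
  also have "(\<lambda>t. (t - 1 / 2) * s t + (\<Sum>n<K. sin (2 * pi * real (Suc n) * t) * s t / (pi * real (Suc n))))
      = (\<lambda>t. sawtooth_error K t * s t)"
    by (simp add: sawtooth_error_def fun_eq_iff distrib_right sum_distrib_right)
  also have "- 1 / (2 * p) + (\<Sum>n<K. (if Suc n = Suc K then 1 / 2 else 0) / (pi * real (Suc n))) = - 1 / (2 * p)"
    by simp
  finally have cross: "((\<lambda>t. sawtooth_error K t * s t) has_integral (- 1 / (2 * p))) {0..1}" .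
  have sq: "((\<lambda>t. s t * s t) has_integral (1 / 2)) {0..1}"
    using has_integral_sin_mult_sin[of "Suc K" "Suc K"] by (simp add: s_def)
  have "((\<lambda>t. (sawtooth_error K t)\<^sup>2 + (2 / p) * (sawtooth_error K t * s t) + (1 / p\<^sup>2) * (s t * s t)) has_integral
      (1 / 12 - (\<Sum>n<K. 1 / (2 * pi\<^sup>2 * (real (Suc n))\<^sup>2)) + (2 / p) * (- 1 / (2 * p)) + (1 / p\<^sup>2) * (1 / 2))) {0..1}"
    by (intro has_integral_add has_integral_mult_right Suc cross sq)
  also have "(\<lambda>t. (sawtooth_error K t)\<^sup>2 + (2 / p) * (sawtooth_error K t * s t) + (1 / p\<^sup>2) * (s t * s t))
      = (\<lambda>t. (sawtooth_error (Suc K) t)\<^sup>2)"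
    using p by (simp add: step fun_eq_iff power2_eq_square field_simps)
  also have "1 / 12 - (\<Sum>n<K. 1 / (2 * pi\<^sup>2 * (real (Suc n))\<^sup>2)) + (2 / p) * (- 1 / (2 * p)) + (1 / p\<^sup>2) * (1 / 2)
      = 1 / 12 - (\<Sum>n<Suc K. 1 / (2 * pi\<^sup>2 * (real (Suc n))\<^sup>2))"
  proof -
    have "(2 / p) * (- 1 / (2 * p)) + (1 / p\<^sup>2) * (1 / 2) = - (1 / (2 * p\<^sup>2))"
      using p by (simp add: power2_eq_square field_simps)
    then show ?thesis by (simp add: p_def power_mult_distrib)
  qed
  finally show ?case .
qed

lemma continuous_on_sawtooth_error: "continuous_on S (sawtooth_error K)"
  unfolding sawtooth_error_def by (intro continuous_intros) auto

lemma sawtooth_error_mem_l2: "(\<lambda>t. complex_of_real (sawtooth_error K t)) \<in> l2_space (lborel_on {0..1})"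
proof -
  have "compact ((\<lambda>t. complex_of_real (sawtooth_error K t)) ` {0..1})"
    by (intro compact_continuous_image continuous_intros continuous_on_sawtooth_error) auto
  then obtain B where "\<And>t. t \<in> {0..1} \<Longrightarrow> cmod (complex_of_real (sawtooth_error K t)) \<le> B"
    by (meson bounded_iff compact_imp_bounded imageI)
  then show ?thesis
    by (intro l2_space_of_bounded[of _ _ B] borel_measurable_lborel_on borel_measurable_continuous_onI
        continuous_intros continuous_on_sawtooth_error) (auto simp: space_restrict_space)
qed

lemma sawtooth_error_tendsto_0:
  "(\<lambda>K. l2_norm (lborel_on {0..1}) (\<lambda>t. complex_of_real (sawtooth_error K t))) \<longlonglongrightarrow> 0"
proof -
  have "(LINT t|lborel_on {0..1}. (cmod (complex_of_real (sawtooth_error K t)))\<^sup>2)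
      = 1 / 12 - (\<Sum>n<K. 1 / (2 * pi\<^sup>2 * (real (Suc n))\<^sup>2))" for K
  proof -
    have cont: "continuous_on {0..1} (\<lambda>t. (sawtooth_error K t)\<^sup>2)"
      by (intro continuous_intros continuous_on_sawtooth_error)
    have "(LINT t|lborel_on {0..1}. (cmod (complex_of_real (sawtooth_error K t)))\<^sup>2)
        = (LINT t:{0..1}|lborel. (sawtooth_error K t)\<^sup>2)"
      unfolding set_lebesgue_integral_def by (subst integral_restrict_space) auto
    also have "\<dots> = integral {0..1} (\<lambda>t. (sawtooth_error K t)\<^sup>2)"
      by (intro set_borel_integral_eq_integral)
         (unfold set_integrable_def, intro borel_integrable_compact cont compact_Icc)
    also have "\<dots> = 1 / 12 - (\<Sum>n<K. 1 / (2 * pi\<^sup>2 * (real (Suc n))\<^sup>2))"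
      by (rule integral_unique) (rule has_integral_sawtooth_error)
    finally show ?thesis .
  qed
  then have eq: "l2_norm (lborel_on {0..1}) (\<lambda>t. complex_of_real (sawtooth_error K t))
      = sqrt (1 / 12 - (\<Sum>n<K. 1 / (2 * pi\<^sup>2 * (real (Suc n))\<^sup>2)))" for K
    by (simp add: l2_norm_def)
  have "(\<lambda>n. (1 / (2 * pi\<^sup>2)) * (1 / (real n + 1)\<^sup>2)) sums ((1 / (2 * pi\<^sup>2)) * (pi\<^sup>2 / 6))"
    using inverse_squares_sums by (intro sums_mult) (simp add: add.commute)
  then have "(\<lambda>n. 1 / (2 * pi\<^sup>2 * (real (Suc n))\<^sup>2)) sums (1 / 12)"
    by (simp add: add.commute)
  then have "(\<lambda>K. sqrt (1 / 12 - (\<Sum>n<K. 1 / (2 * pi\<^sup>2 * (real (Suc n))\<^sup>2)))) \<longlonglongrightarrow> sqrt (1 / 12 - 1 / 12)"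
    unfolding sums_def by (intro tendsto_intros)
  then show ?thesis unfolding eq by simp
qed

lemma sin_mem_span_wave: "(\<lambda>t. complex_of_real (sin (2 * pi * real n * t))) \<in> lin_span wave UNIV"
proof -
  have "complex_of_real (sin (2 * pi * real n * t)) = - \<i> / 2 * wave (int n) t + \<i> / 2 * wave (- int n) t" for t
    by (auto simp: wave_def complex_eq_iff mult_ac)
  then show ?thesis
    by (simp only:) (intro lin_span_add generator_mem_lin_span UNIV_I)
qed

lemma lin_span_wave_shift:
  assumes "h \<in> lin_span wave I" shows "(\<lambda>t. h (t + s)) \<in> lin_span wave I"
proof -
  obtain F c where F: "finite F" "F \<subseteq> I" "h = (\<lambda>x. \<Sum>n\<in>F. c n * wave n x)"
    using assms by (auto simp: lin_span_def)
  have "h (t + s) = (\<Sum>n\<in>F. (c n * wave n s) * wave n t)" for t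
    unfolding F(3) by (simp add: wave_add mult_ac)
  then show ?thesis using F by (auto simp: lin_span_def fun_eq_iff)
qed

text \<open>
  Shifting the sawtooth cyclically by \<open>a\<close> and subtracting the sawtooth leaves the indicator function
  of an interval up to a constant. The span of the exponentials is invariant under cyclic shifts.
\<close>

lemma shifted_sawtooth_mem_closure:
  assumes a: "0 \<le> a" "a \<le> 1"
  shows "(\<lambda>t. complex_of_real (if t < a then t - a + 1 / 2 else t - a - 1 / 2))
    \<in> l2_closure (lborel_on {0..1}) (lin_span wave UNIV)"
proof -
  define r where "r t = complex_of_real (if t < a then t - a + 1 / 2 else t - a - 1 / 2)" for t
  have rm [measurable]: "r \<in> borel_measurable borel" unfolding r_def by measurable
  have r: "r \<in> l2_space (lborel_on {0..1})"
  proof (rule l2_space_of_bounded[OF finite_measure_lborel_on borel_measurable_lborel_on[OF rm]])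
    show "cmod (r t) \<le> 2" if "t \<in> space (lborel_on {0..1})" for t
      unfolding r_def norm_of_real using that a by (auto simp: space_restrict_space abs_if)
  qed
  define D where "D K t = complex_of_real (sawtooth_error K t)" for K t
  have Dm [measurable]: "D K \<in> borel_measurable borel" for K
    unfolding D_def by (intro borel_measurable_continuous_onI continuous_intros continuous_on_sawtooth_error)
  have D: "D K \<in> l2_space (lborel_on {0..1})" for K
    unfolding D_def by (rule sawtooth_error_mem_l2)
  define P where "P K t = complex_of_real (t - 1 / 2) - D K t" for K t
  have P: "P K \<in> lin_span wave UNIV" for K
  proof -
    have "P K = (\<lambda>t. \<Sum>n<K. (- 1 / (pi * real (Suc n))) * complex_of_real (sin (2 * pi * real (Suc n) * t)))"
      by (simp add: P_def D_def sawtooth_error_def fun_eq_iff sum_negf)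
    also have "\<dots> \<in> lin_span wave UNIV"
    proof (induction K)
      case 0 then show ?case by (auto simp: lin_span_def intro: exI[of _ "{}"])
    next
      case (Suc K) then show ?case
        by (simp only: sum.lessThan_Suc) (intro lin_span_add lin_span_scale sin_mem_span_wave)
    qed
    finally show ?thesis .
  qed
  have Pper: "P K (t + 1) = P K t" for K t
    using P[of K] by (auto simp: lin_span_def wave_add_1)
  define Q where "Q K t = P K (t - a)" for K t
  have Q: "Q K \<in> lin_span wave UNIV" for K
    using lin_span_wave_shift[OF P, of K "- a"] by (simp add: Q_def[abs_def])
  have Qm [measurable]: "Q K \<in> borel_measurable borel" for K
    unfolding Q_def P_def by measurable
  have Q2: "Q K \<in> l2_space (lborel_on {0..1})" for K
    using Q by (intro lin_span_subset_l2[OF wave_mem_l2])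
  have norm: "l2_norm (lborel_on {0..1}) (\<lambda>t. r t - Q K t) = l2_norm (lborel_on {0..1}) (D K)" for K
  proof -
    have D1: "D K \<in> l2_space (lborel_on {1 - a..1})" "D K \<in> l2_space (lborel_on {0..1 - a})"
      by (rule l2_space_subset[OF _ D]; use a in auto)+
    have "(l2_norm (lborel_on {0..1}) (\<lambda>t. r t - Q K t))\<^sup>2
        = (l2_norm (lborel_on {0..a}) (\<lambda>t. r t - Q K t))\<^sup>2 + (l2_norm (lborel_on {a..1}) (\<lambda>t. r t - Q K t))\<^sup>2"
      using a by (intro l2_norm_split l2_space_diff r Q2) auto
    also have "l2_norm (lborel_on {0..a}) (\<lambda>t. r t - Q K t) = l2_norm (lborel_on {0..a}) (\<lambda>t. D K (t + (1 - a)))"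
    proof (rule l2_norm_cong_AE)
      have "r t - Q K t = D K (t + (1 - a))" if "t < a" for t
        using that Pper[of K "t - a"] by (simp add: r_def Q_def P_def algebra_simps)
      moreover have "AE t in lborel_on {0..a}. t \<noteq> a"
        using AE_lborel_singleton[of a] by (auto simp: AE_restrict_space_iff)
      moreover have "AE t in lborel_on {0..a}. t \<in> space (lborel_on {0..a})" by (rule AE_space)
      ultimately show "AE t in lborel_on {0..a}. r t - Q K t = D K (t + (1 - a))"
        by (auto simp: space_restrict_space elim!: eventually_rev_mp)
    qed (auto intro!: borel_measurable_lborel_on)
    also have "\<dots> = l2_norm (lborel_on {1 - a..1}) (D K)"
      using l2_shift(2)[OF Dm, of K 0 "1 - a" a] D1 by simp
    also have "l2_norm (lborel_on {a..1}) (\<lambda>t. r t - Q K t) = l2_norm (lborel_on {a..1}) (\<lambda>t. D K (t + (- a)))"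
      by (rule l2_norm_cong) (auto simp: r_def Q_def P_def space_restrict_space)
    also have "\<dots> = l2_norm (lborel_on {0..1 - a}) (D K)"
      using l2_shift(2)[OF Dm, of K a "- a" 1] D1 by simp
    also have "(l2_norm (lborel_on {1 - a..1}) (D K))\<^sup>2 + (l2_norm (lborel_on {0..1 - a}) (D K))\<^sup>2
        = (l2_norm (lborel_on {0..1}) (D K))\<^sup>2"
      using l2_norm_split[OF Dm D, of "1 - a" K] a by simp
    finally show ?thesis by (simp add: power2_eq_iff_nonneg)
  qed
  have "r \<in> l2_closure (lborel_on {0..1}) (lin_span wave UNIV)"
    unfolding l2_closure_def
  proof (intro CollectI conjI r allI impI)
    fix e :: real assume "e > 0"
    from order_tendstoD(2)[OF sawtooth_error_tendsto_0 this]
    obtain K where "l2_norm (lborel_on {0..1}) (D K) < e"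
      by (auto simp: eventually_sequentially D_def[abs_def])
    then show "\<exists>h\<in>lin_span wave UNIV. l2_norm (lborel_on {0..1}) (\<lambda>t. r t - h t) < e"
      using Q norm by (intro bexI[of _ "Q K"]) auto
  qed
  then show ?thesis by (simp add: r_def[abs_def])
qed

lemma sets_lborel_on_interval:
  "sets (lborel_on {0..1::real}) = sigma_sets {0..1} (range (\<lambda>a. {0..1} \<inter> {..<a}))"
proof -
  have "sets (lborel_on {0..1::real}) = (\<inter>) {0..1} ` sets borel"
    by (simp add: sets_restrict_space)
  also have "\<dots> = (\<inter>) {0..1} ` sigma_sets UNIV (range (\<lambda>a::real. {..<a}))"
    by (subst borel_Iio) (simp add: sets_measure_of)
  also have "\<dots> = sigma_sets {0..1} ((\<inter>) {0..1} ` range (\<lambda>a. {..<a}))"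
  proof (rule sigma_sets_Int)
    have "{0..1::real} \<in> sets borel" by simp
    then show "{0..1::real} \<in> sigma_sets UNIV (range (\<lambda>a::real. {..<a}))"
      by (subst (asm) borel_Iio) (simp add: sets_measure_of)
  qed auto
  finally show ?thesis by (simp add: image_image)
qed

text \<open>
  The indicator function of \<open>[0,a)\<close> is the shifted sawtooth minus the sawtooth plus the constant
  \<open>a\<close>, and these intervals generate the Borel sets of the unit interval.
\<close>

lemma wave_total: "l2_total (lborel_on {0..1}) wave UNIV"
proof (rule l2_total_of_generator[OF finite_measure_lborel_on wave_mem_l2])
  let ?G = "range (\<lambda>a::real. {0..1} \<inter> {..<a})"
  let ?C = "l2_closure (lborel_on {0..1::real}) (lin_span wave UNIV)"
  have wC: "(\<lambda>t. c * wave m t) \<in> ?C" for c m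
    by (intro lin_span_subset_l2_closure wave_mem_l2 generator_mem_lin_span) auto
  show "Int_stable ?G"
    unfolding Int_stable_def
  proof safe
    fix a b :: real
    have "{0..1} \<inter> {..<a} \<inter> ({0..1} \<inter> {..<b}) = {0..1} \<inter> {..<min a b}" by auto
    then show "{0..1} \<inter> {..<a} \<inter> ({0..1} \<inter> {..<b}) \<in> ?G" by blast
  qed
  show "?G \<subseteq> Pow (space (lborel_on {0..1}))" by (auto simp: space_restrict_space)
  show "sets (lborel_on {0..1}) = sigma_sets (space (lborel_on {0..1})) ?G"
    using sets_lborel_on_interval by (simp add: space_restrict_space)
  show top: "indicator (space (lborel_on {0..1})) \<in> ?C"
    by (rule l2_closure_cong[OF wC[of 1 0]]) (simp add: space_restrict_space)
  fix A assume "A \<in> ?G"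
  then obtain a where A: "A = {0..1} \<inter> {..<a}" by auto
  consider "a \<le> 0" | "0 \<le> a" "a \<le> 1" | "1 < a" by linarith
  then show "indicator A \<in> ?C"
  proof cases
    case 1
    then have "A = {}" using A by auto
    then show ?thesis using l2_closure_cong[OF wC[of 0 0], of "indicator A"] by simp
  next
    case 3
    then have "A = {0..1}" using A by auto
    then show ?thesis using top by (simp add: space_restrict_space)
  next
    case 2
    let ?r = "\<lambda>a t. complex_of_real (if t < a then t - a + 1 / 2 else t - a - 1 / 2)"
    have "(\<lambda>t. (?r a t + - 1 * ?r 0 t) + of_real a * wave 0 t) \<in> ?C"
      using 2 by (intro l2_closure_add wave_mem_l2 l2_closure_scale wC shifted_sawtooth_mem_closure) auto
    then show ?thesis
      by (rule l2_closure_cong) (auto simp: A space_restrict_space indicator_def)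
  qed
qed

lemma wave_riesz_system: "riesz_system (lborel_on {0..1}) wave UNIV"
proof -
  have "riesz_bounds (lborel_on {0..1}) wave UNIV 1 1"
    unfolding riesz_bounds_def by (simp add: norm_sum_wave)
  then show ?thesis
    unfolding riesz_system_def using wave_total wave_mem_l2 by blast
qed

lemma nn_integral_lborel_on_scale:
  assumes [measurable]: "F \<in> borel_measurable (lborel_on {0..s})" and s: "s > 0"
  shows "(\<integral>\<^sup>+y. F y \<partial>lborel_on {0..s}) = ennreal s * (\<integral>\<^sup>+x. F (s * x) \<partial>lborel_on {0..1::real})"
proof -
  have m: "(\<lambda>x. F x * indicator {0..s} x) \<in> borel_measurable lborel"
    using assms(1) by (subst borel_measurable_restrict_space_iff_ennreal[symmetric]) auto
  have "(\<integral>\<^sup>+y. F y \<partial>lborel_on {0..s}) = (\<integral>\<^sup>+y. F y * indicator {0..s} y \<partial>lborel)"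
    by (simp add: nn_integral_lborel_on)
  also have "\<dots> = ennreal s * (\<integral>\<^sup>+x. F (s * x) * indicator {0..s} (s * x) \<partial>lborel)"
    using nn_integral_real_affine[OF m[unfolded measurable_lborel2], of s 0] s by simp
  also have "(\<integral>\<^sup>+x. F (s * x) * indicator {0..s} (s * x) \<partial>lborel) = (\<integral>\<^sup>+x. F (s * x) * indicator {0..1} x \<partial>lborel)"
    using s by (intro nn_integral_cong) (auto simp: indicator_def zero_le_mult_iff)
  finally show ?thesis by (simp add: nn_integral_lborel_on)
qed

lemma riesz_system_rescale:
  assumes R: "riesz_system (lborel_on {0..1}) f I" and s: "s > 0" and \<pi>: "inj_on \<pi> I"
    and corr: "\<And>n x. n \<in> I \<Longrightarrow> wave (\<pi> n) (s * x) = f n x"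
  shows "riesz_system (lborel_on {0..s}) wave (\<pi> ` I)"
proof (rule riesz_system_transfer[OF R _ s _ \<pi>])
  show "(\<lambda>x. s * x) \<in> lborel_on {0..1} \<rightarrow>\<^sub>M lborel_on {0..s}"
    by (rule measurable_restrict_space3) (use s in \<open>auto simp: mult_left_le\<close>)
qed (use corr s in \<open>auto intro: nn_integral_lborel_on_scale borel_measurable_lborel_on\<close>)

section \<open>Short intervals\<close>

text \<open>
  On \<open>[0,\<theta>]\<close> the exponentials with frequencies \<open>n/\<theta>\<close> are an orthogonal basis. Rounding \<open>n/\<theta>\<close> to an
  integer moves the frequency by at most \<open>1/2\<close>, which after rescaling to \<open>[0,1]\<close> is a perturbation
  \<open>\<delta> n\<close> of size at most \<open>\<theta>/2\<close>. Expanding \<open>cis (2 * pi * \<delta> n * t) - 1\<close> into powers of \<open>\<delta> n * t\<close>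
  bounds the effect on a linear combination by a geometric series with ratio
  \<open>2\<pi> * (1/20) \<le> 2/5\<close> and sum \<open>(2/5) / (1 - 2/5) = 2/3 < 1\<close>, where \<open>\<theta> \<le> 1/10\<close>.
\<close>

lemma rounded_frequencies_perturbation:
  fixes \<delta> :: "int \<Rightarrow> real"
  assumes F: "finite F" and \<delta>: "\<And>n. \<bar>\<delta> n\<bar> \<le> 1 / 20"
  shows "l2_norm (lborel_on {0..1}) (\<lambda>t. \<Sum>n\<in>F. c n * (wave n t * cis (2 * pi * \<delta> n * t) - wave n t))
    \<le> 2 / 3 * sqrt (\<Sum>n\<in>F. (cmod (c n))\<^sup>2)"
proof -
  let ?M = "lborel_on {0..1::real}"
  define s where "s = sqrt (\<Sum>n\<in>F. (cmod (c n))\<^sup>2)"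
  define g where "g t = (\<Sum>n\<in>F. c n * (wave n t * cis (2 * pi * \<delta> n * t) - wave n t))" for t
  define z where "z n t = 2 * pi * \<i> * of_real (\<delta> n * t)" for n t
  \<comment> \<open>The contribution of the \<open>k\<close>-th powers: a function bounded by \<open>(2 * pi) ^ k\<close> times a trigonometric
    polynomial whose coefficients are damped by \<open>\<delta> n ^ k\<close>.\<close>
  define G where "G k t = (2 * pi * \<i> * of_real t) ^ k / fact k * (\<Sum>n\<in>F. (c n * of_real (\<delta> n ^ k)) * wave n t)" for k t
  define x :: real where "x = 2 / 5"
  have pi4: "pi \<le> 4" using pi_less_4 by simp
  have zx: "cmod (z n t) \<le> x" if "t \<in> {0..1}" for n t
  proof -
    have "cmod (z n t) = 2 * pi * (\<bar>\<delta> n\<bar> * \<bar>t\<bar>)" by (simp add: z_def norm_mult abs_mult)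
    also have "\<dots> \<le> 2 * 4 * (1 / 20 * 1)"
      using that \<delta>[of n] pi4 by (intro mult_mono) auto
    finally show ?thesis by (simp add: x_def)
  qed
  have Gm: "G k \<in> borel_measurable ?M" for k
    unfolding G_def by (intro borel_measurable_lborel_on) measurable
  have lin: "(\<lambda>t. \<Sum>n\<in>F. (c n * of_real (\<delta> n ^ k)) * wave n t) \<in> l2_space ?M" for k
    by (intro l2_space_lincomb wave_mem_l2)
  have G: "G k \<in> l2_space ?M" "l2_norm ?M (G k) \<le> x ^ k * s" for k
  proof -
    let ?a = "(2 * pi) ^ k :: real"
    have bd: "cmod (G k t) \<le> cmod (?a * (\<Sum>n\<in>F. (c n * of_real (\<delta> n ^ k)) * wave n t))" if "t \<in> space ?M" for t
    proof -
      have t: "0 \<le> t" "t \<le> 1" using that by (auto simp: space_restrict_space)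
      have "cmod ((2 * pi * \<i> * of_real t) ^ k / fact k) = (2 * pi * t) ^ k / fact k"
        using t by (simp add: norm_divide norm_mult norm_power abs_mult)
      also have "\<dots> \<le> (2 * pi * 1) ^ k / 1"
        using t by (intro frac_le power_mono mult_left_mono) (auto simp: fact_ge_1)
      finally show ?thesis
        unfolding G_def norm_mult[of "_ / _"] norm_mult[of "of_real _"]
        by (intro mult_right_mono) (auto simp: norm_power norm_mult)
    qed
    have lin': "(\<lambda>t. ?a * (\<Sum>n\<in>F. (c n * of_real (\<delta> n ^ k)) * wave n t)) \<in> l2_space ?M"
      by (rule l2_space_scale[OF lin])
    have "(cmod (G k t))\<^sup>2 \<le> (cmod (?a * (\<Sum>n\<in>F. (c n * of_real (\<delta> n ^ k)) * wave n t)))\<^sup>2" if "t \<in> space ?M" for t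
      using bd[OF that] by (intro power_mono) auto
    then show "G k \<in> l2_space ?M" by (rule l2_space_of_dominated[OF Gm l2_spaceD(2)[OF lin']])
    have "l2_norm ?M (G k) \<le> l2_norm ?M (\<lambda>t. ?a * (\<Sum>n\<in>F. (c n * of_real (\<delta> n ^ k)) * wave n t))"
      by (rule l2_norm_mono[OF Gm lin' bd])
    also have "\<dots> = ?a * l2_norm ?M (\<lambda>t. \<Sum>n\<in>F. (c n * of_real (\<delta> n ^ k)) * wave n t)"
      by (subst l2_norm_scale) (simp add: norm_power norm_mult)
    also have "\<dots> \<le> ?a * ((1 / 20) ^ k * s)"
    proof (rule mult_left_mono, rule power2_le_imp_le)
      have "(l2_norm ?M (\<lambda>t. \<Sum>n\<in>F. (c n * of_real (\<delta> n ^ k)) * wave n t))\<^sup>2 = (\<Sum>n\<in>F. (cmod (c n))\<^sup>2 * (\<bar>\<delta> n\<bar> ^ k)\<^sup>2)"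
        by (subst norm_sum_wave[OF F]) (simp add: norm_mult norm_power power_mult_distrib)
      also have "\<dots> \<le> (\<Sum>n\<in>F. (cmod (c n))\<^sup>2 * ((1 / 20) ^ k)\<^sup>2)"
        using \<delta> by (intro sum_mono mult_left_mono power_mono) auto
      also have "\<dots> = ((1 / 20) ^ k * s)\<^sup>2"
        by (simp add: s_def power_mult_distrib sum_nonneg sum_distrib_left[symmetric] sum_distrib_right[symmetric])
      finally show "(l2_norm ?M (\<lambda>t. \<Sum>n\<in>F. (c n * of_real (\<delta> n ^ k)) * wave n t))\<^sup>2 \<le> ((1 / 20) ^ k * s)\<^sup>2" .
    qed (auto simp: s_def sum_nonneg)
    also have "\<dots> = (2 * pi * (1 / 20)) ^ k * s" by (simp only: power_mult_distrib mult.assoc)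
    also have "\<dots> \<le> x ^ k * s"
      using pi4 by (intro mult_right_mono power_mono) (auto simp: x_def s_def sum_nonneg)
    finally show "l2_norm ?M (G k) \<le> x ^ k * s" .
  qed
  define C where "C = (\<Sum>n\<in>F. cmod (c n))"
  have gm: "g \<in> borel_measurable ?M"
    unfolding g_def by (intro borel_measurable_lborel_on borel_measurable_continuous_onI continuous_intros continuous_on_wave)
  have "\<And>t. t \<in> space ?M \<Longrightarrow> cmod (g t) \<le> C * 2"
    unfolding g_def C_def sum_distrib_right
    by (rule order_trans[OF norm_sum])
       (auto simp: norm_mult intro!: sum_mono mult_left_mono order_trans[OF norm_triangle_ineq4])
  then have g: "g \<in> l2_space ?M" by (rule l2_space_of_bounded[OF finite_measure_lborel_on gm])
  have bound: "l2_norm ?M g \<le> C * x ^ K + 2 / 3 * s" for K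
  proof -
    define H where "H t = (\<Sum>k=1..K. G k t)" for t
    have H: "H \<in> l2_space ?M" unfolding H_def using G by (intro l2_space_sum) auto
    have "cmod (g t - H t) \<le> C * x ^ K" if t: "t \<in> space ?M" for t
    proof -
      have t01: "t \<in> {0..1}" using t by (simp add: space_restrict_space)
      have "(\<Sum>n\<in>F. c n * wave n t * (\<Sum>k\<le>K. z n t ^ k / fact k)) = (\<Sum>k\<le>K. G k t)"
        unfolding G_def z_def
        by (subst sum_distrib_left, subst sum.swap, subst sum_distrib_left)
           (auto intro!: sum.cong simp: power_mult_distrib mult_ac)
      also have "\<dots> = G 0 t + H t"
        unfolding H_def by (simp add: atMost_atLeast0 sum.atLeast_Suc_atMost)
      finally have "g t - H t = (\<Sum>n\<in>F. c n * wave n t * (exp (z n t) - (\<Sum>k\<le>K. z n t ^ k / fact k)))"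
        by (simp add: g_def G_def z_def cis_conv_exp right_diff_distrib sum_subtractf mult_ac)
      also have "cmod \<dots> \<le> (\<Sum>n\<in>F. cmod (c n) * x ^ K)"
      proof (rule order_trans[OF norm_sum], rule sum_mono)
        fix n
        have re: "Re (z n t) = 0" by (simp add: z_def)
        have "cmod (exp (z n t) - (\<Sum>k\<le>K. z n t ^ k / fact k)) \<le> cmod (z n t) ^ Suc K / fact K"
          using Taylor_exp[of "z n t" K] by (simp add: re)
        also have "\<dots> \<le> x ^ Suc K / 1"
          using zx[OF t01, of n] by (intro frac_le power_mono) (auto simp: fact_ge_1 x_def)
        also have "\<dots> \<le> x ^ K" by (simp add: x_def)
        finally show "cmod (c n * wave n t * (exp (z n t) - (\<Sum>k\<le>K. z n t ^ k / fact k))) \<le> cmod (c n) * x ^ K"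
          by (simp add: norm_mult mult_left_mono)
      qed
      finally show ?thesis by (simp add: C_def sum_distrib_right)
    qed
    then have "l2_norm ?M (\<lambda>t. g t - H t) \<le> C * x ^ K * sqrt (measure ?M (space ?M))"
      using l2_spaceD(1)[OF l2_space_diff[OF g H]]
      by (intro l2_norm_le_sup) (auto simp: C_def x_def sum_nonneg)
    also have "measure ?M (space ?M) = 1"
      by (simp add: space_restrict_space measure_restrict_space)
    finally have 1: "l2_norm ?M (\<lambda>t. g t - H t) \<le> C * x ^ K" by simp
    have "l2_norm ?M H \<le> (\<Sum>k=1..K. l2_norm ?M (G k))"
      unfolding H_def using G by (intro l2_norm_sum_le) auto
    also have "\<dots> \<le> (\<Sum>k=1..K. x ^ k * s)" by (intro sum_mono G)
    also have "\<dots> = (\<Sum>k=1..K. x ^ k) * s" by (simp add: sum_distrib_right)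
    also have "(\<Sum>k=1..K. x ^ k) = 2 / 3 * (1 - x ^ K)"
    proof (induction K)
      case (Suc K)
      have "(\<Sum>k=1..Suc K. x ^ k) = (\<Sum>k=1..K. x ^ k) + x ^ Suc K" by simp
      also have "\<dots> = 2 / 3 * (1 - x ^ K) + 2 / 5 * x ^ K"
        by (simp only: Suc power_Suc) (simp only: x_def)
      also have "\<dots> = 2 / 3 * (1 - 2 / 5 * x ^ K)" by (simp add: field_simps)
      also have "\<dots> = 2 / 3 * (1 - x ^ Suc K)" by (simp only: power_Suc) (simp only: x_def)
      finally show ?case .
    qed simp
    also have "\<dots> * s \<le> 2 / 3 * 1 * s"
      by (intro mult_right_mono mult_left_mono) (auto simp: x_def s_def sum_nonneg)
    finally show ?thesis using l2_norm_le_diff[OF g H] 1 by simp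
  qed
  have "(\<lambda>K. C * x ^ K + 2 / 3 * s) \<longlonglongrightarrow> C * 0 + 2 / 3 * s"
    by (intro tendsto_intros LIMSEQ_power_zero) (simp add: x_def)
  then have "l2_norm ?M g \<le> C * 0 + 2 / 3 * s"
    by (rule LIMSEQ_le_const) (use bound in auto)
  then show ?thesis by (simp add: g_def[abs_def] s_def)
qed

lemma short_interval_riesz_system:
  assumes \<theta>: "0 < \<theta>" "\<theta> \<le> 1 / 10" and N: "N > 0"
  shows "\<exists>\<Gamma>. (\<forall>m\<in>\<Gamma>. int N dvd m) \<and> riesz_system (lborel_on {0..\<theta> / N}) wave \<Gamma>"
proof -
  let ?M = "lborel_on {0..1::real}"
  define r where "r n = round (of_int n / \<theta>)" for n :: int
  define \<delta> where "\<delta> n = \<theta> * of_int (r n) - of_int n" for n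
  have \<delta>: "\<bar>\<delta> n\<bar> \<le> 1 / 20" for n
  proof -
    have "\<delta> n = \<theta> * (of_int (r n) - of_int n / \<theta>)" using \<theta> by (simp add: \<delta>_def algebra_simps)
    also have "\<bar>\<dots>\<bar> = \<theta> * \<bar>of_int (r n) - of_int n / \<theta>\<bar>" using \<theta> by (simp add: abs_mult)
    also have "\<dots> \<le> 1 / 10 * (1 / 2)"
      unfolding r_def using \<theta> of_int_round_abs_le by (intro mult_mono) auto
    finally show ?thesis by simp
  qed
  define u where "u n t = wave n t * cis (2 * pi * \<delta> n * t)" for n t
  have u: "u n t = cis (2 * pi * (\<theta> * of_int (r n)) * t)" for n t
    by (simp add: u_def wave_def cis_mult \<delta>_def algebra_simps)
  have "riesz_system ?M u UNIV"
  proof (rule paley_wiener_perturbation[where v = wave and \<kappa> = "2 / 3"])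
    show "u n \<in> l2_space ?M" for n
      by (rule l2_space_of_bounded[of _ _ 1])
         (auto simp: u[abs_def] intro!: borel_measurable_lborel_on borel_measurable_continuous_onI continuous_intros)
    show "l2_norm ?M (\<lambda>t. \<Sum>n\<in>F. c n * (u n t - wave n t)) \<le> 2 / 3 * sqrt (\<Sum>n\<in>F. (cmod (c n))\<^sup>2)"
      if "finite F" for F c
      unfolding u_def by (rule rounded_frequencies_perturbation[OF that \<delta>])
  qed (use wave_mem_l2 norm_sum_wave wave_total in auto)
  moreover have "inj (\<lambda>n. int N * r n)"
  proof (rule injI)
    fix n m assume "int N * r n = int N * r m"
    then have "r n = r m" using N by simp
    then have "\<bar>real_of_int n - real_of_int m\<bar> \<le> 1 / 10"
      using \<delta>[of n] \<delta>[of m] unfolding \<delta>_def abs_le_iff by simp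
    then show "n = m" by linarith
  qed
  ultimately have "riesz_system (lborel_on {0..\<theta> / N}) wave (range (\<lambda>n. int N * r n))"
  proof (rule_tac riesz_system_rescale)
    show "wave (int N * r n) (\<theta> / N * x) = u n x" for n x
      using N by (simp add: u wave_def mult_ac)
  qed (use \<theta> N in auto)
  then show ?thesis by (intro exI[of _ "range (\<lambda>n. int N * r n)"]) auto
qed

text \<open>The case \<open>\<theta> = 0\<close> of the previous lemma: the interval is a null set.\<close>

lemma degenerate_interval_riesz_system: "riesz_system (lborel_on {0..0::real}) wave {}"
proof -
  have zero: "l2_norm (lborel_on {0..0::real}) g = 0" for g
  proof -
    have "AE x in lborel_on {0..0::real}. False"
      using AE_lborel_singleton[of "0::real"] by (auto simp: AE_restrict_space_iff)
    then have "(LINT x|lborel_on {0..0::real}. (cmod (g x))\<^sup>2) = 0"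
      by (intro integral_eq_zero_AE) auto
    then show ?thesis by (simp add: l2_norm_def)
  qed
  then have "l2_total (lborel_on {0..0::real}) wave {}"
    by (auto simp: l2_total_def mem_l2_closure_iff zero)
  moreover have "riesz_bounds (lborel_on {0..0::real}) wave {} 1 1"
    by (auto simp: riesz_bounds_def zero)
  ultimately show ?thesis unfolding riesz_system_def by blast
qed

section \<open>Gluing intervals\<close>

text \<open>
  Let \<open>f = p + q\<close> with \<open>p\<close> in the span of \<open>\<Gamma>\<^sub>0\<close>, whose elements have period \<open>s\<close>, and \<open>q\<close> in the span
  of \<open>\<Gamma>\<^sub>1\<close>. The difference \<open>f (x + s) - f x\<close> only sees \<open>q\<close>, and it multiplies the coefficients of
  \<open>q\<close> by \<open>wave m s - 1\<close>, which stays away from 0. So \<open>q\<close> is controlled by the Riesz system on the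
  shorter interval \<open>[0, h - s]\<close>, and then \<open>p\<close> by its restriction to the single period \<open>[0, s]\<close>.
  For totality the same two steps produce an approximation whose error is small on \<open>[0, s]\<close> and
  has a small difference; so the error is small on the whole of \<open>[0, h]\<close>.
\<close>

lemma glue_riesz_systems:
  assumes s: "0 < s" "s \<le> h" "h \<le> 1"
    and R0: "riesz_system (lborel_on {0..s}) wave \<Gamma>\<^sub>0"
    and R1: "riesz_system (lborel_on {0..h - s}) wave \<Gamma>\<^sub>1"
    and per: "\<And>m. m \<in> \<Gamma>\<^sub>0 \<Longrightarrow> wave m s = 1"
    and gap: "\<And>m. m \<in> \<Gamma>\<^sub>1 \<Longrightarrow> \<kappa> \<le> cmod (wave m s - 1)" "0 < \<kappa>"
  shows "riesz_system (lborel_on {0..h}) wave (\<Gamma>\<^sub>0 \<union> \<Gamma>\<^sub>1)"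
proof -
  have disj: "\<Gamma>\<^sub>0 \<inter> \<Gamma>\<^sub>1 = {}" using per gap by force
  obtain \<alpha>\<^sub>0 \<beta>\<^sub>0 where b0: "riesz_bounds (lborel_on {0..s}) wave \<Gamma>\<^sub>0 \<alpha>\<^sub>0 \<beta>\<^sub>0"
    using R0 by (auto simp: riesz_system_def)
  obtain \<alpha>\<^sub>1 \<beta>\<^sub>1 where b1: "riesz_bounds (lborel_on {0..h - s}) wave \<Gamma>\<^sub>1 \<alpha>\<^sub>1 \<beta>\<^sub>1"
    using R1 by (auto simp: riesz_system_def)
  have \<alpha>: "\<alpha>\<^sub>0 > 0" "\<alpha>\<^sub>1 > 0" using b0 b1 by (auto simp: riesz_bounds_def)
  have lin_m: "(\<lambda>t. \<Sum>m\<in>F. c m * wave m t) \<in> borel_measurable borel" for F :: "int set" and c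
    by measurable
  have lin_2: "(\<lambda>t. \<Sum>m\<in>F. c m * wave m t) \<in> l2_space (lborel_on {x..y})" for F :: "int set" and c x y
    by (intro l2_space_lincomb wave_mem_l2)
  have shift_2: "(\<lambda>t. f (t + s)) \<in> l2_space (lborel_on {0..y})"
    "l2_norm (lborel_on {0..y}) (\<lambda>t. f (t + s)) = l2_norm (lborel_on {s..y + s}) f"
    if "f \<in> borel_measurable borel" "f \<in> l2_space (lborel_on {0..h})" "y \<le> h - s" for f y
  proof -
    have "f \<in> l2_space (lborel_on {0 + s..y + s})"
      by (rule l2_space_subset[OF that(1,2)]) (use s that in auto)
    from l2_shift[OF that(1) this] show "(\<lambda>t. f (t + s)) \<in> l2_space (lborel_on {0..y})"
      "l2_norm (lborel_on {0..y}) (\<lambda>t. f (t + s)) = l2_norm (lborel_on {s..y + s}) f" by auto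
  qed
  \<comment> \<open>With \<open>X\<close> the norm of \<open>f\<close>, the coefficients of \<open>q\<close> have norm at most \<open>a * X\<close>; hence \<open>p\<close> has
    norm at most \<open>(1 + a) * X\<close> on one period, and all coefficients together have square norm at
    most \<open>D * X\<^sup>2\<close>.\<close>
  define a where "a = 2 / (\<kappa> * sqrt \<alpha>\<^sub>1)"
  have a: "a > 0" using \<alpha> gap by (simp add: a_def)
  define D where "D = (1 + a)\<^sup>2 / \<alpha>\<^sub>0 + a\<^sup>2"
  have D: "D > 0" using a \<alpha> by (simp add: D_def add_pos_pos)
  have "riesz_bounds (lborel_on {0..h}) wave (\<Gamma>\<^sub>0 \<union> \<Gamma>\<^sub>1) (1 / D) 1"
    unfolding riesz_bounds_def
  proof (intro conjI allI impI)
    show "0 < 1 / D" "0 < (1::real)" using D by auto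
    fix F c assume F: "finite F" "F \<subseteq> \<Gamma>\<^sub>0 \<union> \<Gamma>\<^sub>1"
    define f where "f t = (\<Sum>m\<in>F. c m * wave m t)" for t
    have fm: "f \<in> borel_measurable borel" and f2: "f \<in> l2_space (lborel_on {x..y})" for x y
      using lin_m lin_2 unfolding f_def by auto
    define X where "X = l2_norm (lborel_on {0..h}) f"
    have X: "X \<ge> 0" by (simp add: X_def)
    have "X \<le> l2_norm (lborel_on {0..1}) f"
      unfolding X_def using s by (intro l2_norm_subset fm f2) auto
    then have "X\<^sup>2 \<le> (l2_norm (lborel_on {0..1}) f)\<^sup>2" using X by (intro power_mono)
    then show "(l2_norm (lborel_on {0..h}) (\<lambda>t. \<Sum>m\<in>F. c m * wave m t))\<^sup>2 \<le> 1 * (\<Sum>m\<in>F. (cmod (c m))\<^sup>2)"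
      using norm_sum_wave[OF F(1), of c] unfolding X_def f_def[abs_def] by linarith
    define F0 F1 where "F0 = F \<inter> \<Gamma>\<^sub>0" and "F1 = F \<inter> \<Gamma>\<^sub>1"
    have F01: "F = F0 \<union> F1" "F0 \<inter> F1 = {}" "finite F0" "finite F1" "F0 \<subseteq> \<Gamma>\<^sub>0" "F1 \<subseteq> \<Gamma>\<^sub>1"
      using F disj by (auto simp: F0_def F1_def)
    define S0 S1 where "S0 = (\<Sum>m\<in>F0. (cmod (c m))\<^sup>2)" and "S1 = (\<Sum>m\<in>F1. (cmod (c m))\<^sup>2)"
    have S: "(\<Sum>m\<in>F. (cmod (c m))\<^sup>2) = S0 + S1" "S0 \<ge> 0" "S1 \<ge> 0"
      unfolding S0_def S1_def F01(1) using F01 by (auto intro: sum.union_disjoint sum_nonneg)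
    define p q where "p t = (\<Sum>m\<in>F0. c m * wave m t)" and "q t = (\<Sum>m\<in>F1. c m * wave m t)" for t
    have f_pq: "f t = p t + q t" for t
      unfolding f_def p_def q_def F01(1) using F01 by (intro sum.union_disjoint)
    have diff: "f (t + s) - f t = (\<Sum>m\<in>F1. (c m * (wave m s - 1)) * wave m t)" for t
    proof -
      have "p (t + s) = p t"
        unfolding p_def using per F01(5) by (intro sum.cong) (auto simp: wave_add)
      then have "f (t + s) - f t = q (t + s) - q t" by (simp add: f_pq)
      also have "\<dots> = (\<Sum>m\<in>F1. (c m * (wave m s - 1)) * wave m t)"
        unfolding q_def sum_subtractf[symmetric] by (intro sum.cong) (auto simp: wave_add algebra_simps)
      finally show ?thesis .
    qed
    have "\<alpha>\<^sub>1 * (\<kappa>\<^sup>2 * S1) \<le> \<alpha>\<^sub>1 * (\<Sum>m\<in>F1. (cmod (c m * (wave m s - 1)))\<^sup>2)"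
    proof (rule mult_left_mono)
      show "\<kappa>\<^sup>2 * S1 \<le> (\<Sum>m\<in>F1. (cmod (c m * (wave m s - 1)))\<^sup>2)"
        unfolding S1_def sum_distrib_left
      proof (rule sum_mono)
        fix m assume "m \<in> F1"
        then have "\<kappa>\<^sup>2 \<le> (cmod (wave m s - 1))\<^sup>2" using gap F01(6) by (intro power_mono) auto
        from mult_right_mono[OF this, of "(cmod (c m))\<^sup>2"]
        show "\<kappa>\<^sup>2 * (cmod (c m))\<^sup>2 \<le> (cmod (c m * (wave m s - 1)))\<^sup>2"
          by (simp add: norm_mult power_mult_distrib mult.commute)
      qed
    qed (use \<alpha> in auto)
    also have "\<dots> \<le> (l2_norm (lborel_on {0..h - s}) (\<lambda>t. f (t + s) - f t))\<^sup>2"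
      unfolding diff by (rule riesz_boundsD(1)[OF b1 F01(4,6)])
    also have "\<dots> \<le> (2 * X)\<^sup>2"
    proof (rule power_mono)
      have "l2_norm (lborel_on {0..h - s}) (\<lambda>t. f (t + s) - f t)
          \<le> l2_norm (lborel_on {0..h - s}) (\<lambda>t. f (t + s)) + l2_norm (lborel_on {0..h - s}) f"
        using fm f2 by (intro l2_norm_diff_le shift_2) auto
      also have "l2_norm (lborel_on {0..h - s}) (\<lambda>t. f (t + s)) = l2_norm (lborel_on {s..h}) f"
        using shift_2(2)[OF fm f2, of "h - s"] by simp
      also have "\<dots> \<le> X" unfolding X_def using s by (intro l2_norm_subset fm f2) auto
      also have "l2_norm (lborel_on {0..h - s}) f \<le> X"
        unfolding X_def using s by (intro l2_norm_subset fm f2) auto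
      finally show "l2_norm (lborel_on {0..h - s}) (\<lambda>t. f (t + s) - f t) \<le> 2 * X" by simp
    qed simp
    finally have "S1 \<le> (a * X)\<^sup>2"
      using \<alpha> gap by (simp add: a_def power_mult_distrib power_divide field_simps)
    then have q: "sqrt S1 \<le> a * X"
      using a X by (intro real_le_lsqrt) auto
    have "l2_norm (lborel_on {0..s}) p \<le> l2_norm (lborel_on {0..s}) f + l2_norm (lborel_on {0..s}) q"
    proof -
      have "p = (\<lambda>t. f t - q t)" by (simp add: f_pq fun_eq_iff)
      then show ?thesis unfolding q_def using f2 lin_2 by (simp add: l2_norm_diff_le)
    qed
    also have "l2_norm (lborel_on {0..s}) f \<le> X"
      unfolding X_def using s by (intro l2_norm_subset fm f2) auto
    also have "l2_norm (lborel_on {0..s}) q \<le> l2_norm (lborel_on {0..1}) q"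
      using s lin_m lin_2 unfolding q_def by (intro l2_norm_subset) auto
    also have "\<dots> = sqrt S1"
      unfolding S1_def q_def by (intro real_sqrt_unique[symmetric] norm_sum_wave F01(4) l2_norm_nonneg)
    finally have "l2_norm (lborel_on {0..s}) p \<le> (1 + a) * X" using q by (simp add: algebra_simps)
    then have "(l2_norm (lborel_on {0..s}) p)\<^sup>2 \<le> ((1 + a) * X)\<^sup>2" by (intro power_mono) auto
    then have "\<alpha>\<^sub>0 * S0 \<le> ((1 + a) * X)\<^sup>2"
      using riesz_boundsD(1)[OF b0 F01(3,5), of c] unfolding S0_def p_def by linarith
    then have "\<alpha>\<^sub>0 * S0 \<le> (1 + a)\<^sup>2 * X\<^sup>2" by (simp only: power_mult_distrib)
    then have "S0 \<le> (1 + a)\<^sup>2 / \<alpha>\<^sub>0 * X\<^sup>2"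
      using \<alpha> by (simp add: pos_le_divide_eq mult.commute)
    with \<open>S1 \<le> (a * X)\<^sup>2\<close> have "S0 + S1 \<le> D * X\<^sup>2"
      by (simp add: D_def power_mult_distrib distrib_right)
    then show "1 / D * (\<Sum>m\<in>F. (cmod (c m))\<^sup>2) \<le> (l2_norm (lborel_on {0..h}) (\<lambda>t. \<Sum>m\<in>F. c m * wave m t))\<^sup>2"
      using D by (simp add: S(1) X_def f_def[abs_def] field_simps)
  qed
  moreover have "l2_total (lborel_on {0..h}) wave (\<Gamma>\<^sub>0 \<union> \<Gamma>\<^sub>1)"
    unfolding l2_total_def
  proof
    fix g0 assume g0: "g0 \<in> l2_space (lborel_on {0..h})"
    define g where "g t = (if t \<in> {0..h} then g0 t else 0)" for t
    have gm [measurable]: "g \<in> borel_measurable borel"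
      using l2_spaceD(1)[OF g0] unfolding g_def by (subst (asm) measurable_restrict_space_iff[of _ _ 0]) auto
    have g: "g \<in> l2_space (lborel_on {0..h})"
      by (rule l2_space_of_dominated[OF borel_measurable_lborel_on[OF gm] l2_spaceD(2)[OF g0]])
         (auto simp: g_def)
    have gsub: "g \<in> l2_space (lborel_on {0..y})" if "y \<le> h" for y
      by (rule l2_space_subset[OF gm g]) (use that in auto)
    show "g0 \<in> l2_closure (lborel_on {0..h}) (lin_span wave (\<Gamma>\<^sub>0 \<union> \<Gamma>\<^sub>1))"
      unfolding l2_closure_def
    proof (intro CollectI conjI g0 allI impI)
      fix e :: real assume e: "e > 0"
      obtain J :: nat where "h / s < real J" using reals_Archimedean2 by blast
      then have J: "h \<le> (real J + 1) * s" using s by (simp add: field_simps)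
      define \<eta> where "\<eta> = e / (2 * real J + 2)"
      have \<eta>: "\<eta> > 0" using e by (simp add: \<eta>_def)
      have dg: "(\<lambda>t. g (t + s) - g t) \<in> l2_space (lborel_on {0..h - s})"
        by (intro l2_space_diff shift_2 gm g gsub) (use s in auto)
      obtain F1 d where F1: "finite F1" "F1 \<subseteq> \<Gamma>\<^sub>1"
          "l2_norm (lborel_on {0..h - s}) (\<lambda>t. g (t + s) - g t - (\<Sum>m\<in>F1. d m * wave m t)) < \<eta>"
        using R1 dg \<eta> unfolding riesz_system_def l2_total_def subset_iff mem_l2_closure_iff by meson
      define q where "q t = (\<Sum>m\<in>F1. d m / (wave m s - 1) * wave m t)" for t
      have dq: "q (t + s) - q t = (\<Sum>m\<in>F1. d m * wave m t)" for t
        unfolding q_def sum_subtractf[symmetric]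
      proof (rule sum.cong[OF refl])
        fix m assume "m \<in> F1"
        then have "wave m s - 1 \<noteq> 0" using gap F1(2) by force
        then have "d m / (wave m s - 1) * (wave m s - 1) = d m" by simp
        then show "d m / (wave m s - 1) * wave m (t + s) - d m / (wave m s - 1) * wave m t = d m * wave m t"
          unfolding wave_add by (metis (no_types, lifting) left_diff_distrib mult.assoc mult.commute mult_1 right_diff_distrib)
      qed
      have q2: "q \<in> l2_space (lborel_on {x..y})" for x y unfolding q_def by (rule lin_2)
      have qm [measurable]: "q \<in> borel_measurable borel" unfolding q_def by (rule lin_m)
      have "(\<lambda>t. g t - q t) \<in> l2_space (lborel_on {0..s})"
        by (intro l2_space_diff gsub q2) (use s in auto)
      then obtain F0 c where F0: "finite F0" "F0 \<subseteq> \<Gamma>\<^sub>0"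
          "l2_norm (lborel_on {0..s}) (\<lambda>t. g t - q t - (\<Sum>m\<in>F0. c m * wave m t)) < \<eta>"
        using R0 \<eta> unfolding riesz_system_def l2_total_def subset_iff mem_l2_closure_iff by meson
      define p where "p t = (\<Sum>m\<in>F0. c m * wave m t)" for t
      have dp: "p (t + s) = p t" for t
        unfolding p_def using per F0(2) by (intro sum.cong) (auto simp: wave_add)
      have p2: "p \<in> l2_space (lborel_on {x..y})" for x y unfolding p_def by (rule lin_2)
      have pm [measurable]: "p \<in> borel_measurable borel" unfolding p_def by (rule lin_m)
      define r where "r t = g t - q t - p t" for t
      have rm [measurable]: "r \<in> borel_measurable borel" unfolding r_def by measurable
      have r2: "r \<in> l2_space (lborel_on {0..y})" if "y \<le> h" for y
        unfolding r_def by (intro l2_space_diff gsub p2 q2 that)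
      have r0: "l2_norm (lborel_on {0..s}) r < \<eta>" using F0(3) unfolding r_def[abs_def] p_def .
      have dr: "r (t + s) - r t = g (t + s) - g t - (\<Sum>m\<in>F1. d m * wave m t)" for t
        unfolding r_def dp dq[symmetric] by simp
      have dr2: "(\<lambda>t. r (t + s) - r t) \<in> l2_space (lborel_on {0..y})" if "y \<le> h - s" for y
        by (intro l2_space_diff shift_2 r2) (use that s in auto)
      have small: "l2_norm (lborel_on {0..y}) r \<le> (2 * real j + 1) * \<eta>"
        if "0 \<le> y" "y \<le> h" "y \<le> (real j + 1) * s" for y j
        using that
      proof (induction j arbitrary: y)
        case 0
        then have "l2_norm (lborel_on {0..y}) r \<le> l2_norm (lborel_on {0..s}) r"
          using s by (intro l2_norm_subset r2) auto
        then show ?case using r0 by simp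
      next
        case (Suc j)
        show ?case
        proof (cases "y \<le> s")
          case True
          then have "l2_norm (lborel_on {0..y}) r \<le> l2_norm (lborel_on {0..s}) r"
            using s Suc by (intro l2_norm_subset r2) auto
          also have "\<dots> \<le> (2 * real (Suc j) + 1) * \<eta>"
            using r0 \<eta> mult_right_mono[of 1 "2 * real (Suc j) + 1" \<eta>] by linarith
          finally show ?thesis .
        next
          case False
          have "l2_norm (lborel_on {0..y}) r \<le> l2_norm (lborel_on {0..s}) r + l2_norm (lborel_on {s..y}) r"
            using False s Suc by (intro l2_norm_split_le r2) auto
          also have "l2_norm (lborel_on {s..y}) r = l2_norm (lborel_on {0..y - s}) (\<lambda>t. r (t + s))"
            using shift_2(2)[OF rm r2, of "y - s"] Suc by simp
          also have "\<dots> \<le> l2_norm (lborel_on {0..y - s}) (\<lambda>t. r (t + s) - r t) + l2_norm (lborel_on {0..y - s}) r"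
            using s Suc by (intro l2_norm_le_diff shift_2 r2) auto
          also have "l2_norm (lborel_on {0..y - s}) (\<lambda>t. r (t + s) - r t)
              \<le> l2_norm (lborel_on {0..h - s}) (\<lambda>t. r (t + s) - r t)"
            using False Suc by (intro l2_norm_subset dr2) auto
          also have "\<dots> < \<eta>" using F1(3) by (simp add: dr)
          also have "l2_norm (lborel_on {0..y - s}) r \<le> (2 * real j + 1) * \<eta>"
            using Suc False s by (intro Suc.IH) (auto simp: algebra_simps)
          finally show ?thesis using r0 by (simp add: algebra_simps)
        qed
      qed
      have "l2_norm (lborel_on {0..h}) (\<lambda>t. g0 t - (q t + p t)) = l2_norm (lborel_on {0..h}) r"
        by (rule l2_norm_cong) (auto simp: r_def g_def space_restrict_space algebra_simps)
      also have "\<dots> \<le> (2 * real J + 1) * \<eta>" using small[of h J] J s by simp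
      also have "\<dots> < (2 * real J + 2) * \<eta>" using \<eta> by (intro mult_strict_right_mono) auto
      also have "\<dots> = e" by (simp add: \<eta>_def)
      finally have "l2_norm (lborel_on {0..h}) (\<lambda>t. g0 t - (q t + p t)) < e" .
      moreover have "(\<lambda>t. q t + p t) \<in> lin_span wave (\<Gamma>\<^sub>0 \<union> \<Gamma>\<^sub>1)"
        unfolding p_def q_def using F0(1,2) F1(1,2) by (intro lin_span_add lincomb_mem_lin_span) auto
      ultimately show "\<exists>k\<in>lin_span wave (\<Gamma>\<^sub>0 \<union> \<Gamma>\<^sub>1). l2_norm (lborel_on {0..h}) (\<lambda>t. g0 t - k t) < e"
        by (intro bexI[of _ "\<lambda>t. q t + p t"])
    qed
  qed
  ultimately show ?thesis using wave_mem_l2 unfolding riesz_system_def by blast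
qed

section \<open>Intervals of arbitrary length at most 1\<close>

lemma riesz_system_modulate:
  assumes R: "riesz_system M f I" and m [measurable]: "\<phi> \<in> borel_measurable M"
    and norm: "\<And>x. x \<in> space M \<Longrightarrow> cmod (\<phi> x) = 1"
  shows "riesz_system M (\<lambda>n x. \<phi> x * f n x) I"
proof -
  have f: "f n \<in> l2_space M" if "n \<in> I" for n using R that by (auto simp: riesz_system_def)
  have sum: "(\<Sum>n\<in>F. c n * (\<phi> x * f n x)) = \<phi> x * (\<Sum>n\<in>F. c n * f n x)" for F c x
    by (simp add: sum_distrib_left mult_ac)
  have "l2_norm M (\<lambda>x. \<Sum>n\<in>F. c n * (\<phi> x * f n x)) = l2_norm M (\<lambda>x. \<Sum>n\<in>F. c n * f n x)" for F c
    unfolding sum by (rule l2_norm_cong) (simp add: norm_mult norm)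
  then have "\<exists>\<alpha> \<beta>. riesz_bounds M (\<lambda>n x. \<phi> x * f n x) I \<alpha> \<beta>"
    using R unfolding riesz_system_def riesz_bounds_def by simp
  moreover have "l2_total M (\<lambda>n x. \<phi> x * f n x) I"
    unfolding l2_total_def
  proof
    fix g assume g: "g \<in> l2_space M"
    have g': "(\<lambda>x. cnj (\<phi> x) * g x) \<in> l2_space M"
    proof (rule l2_mult_unimodular[OF g])
      show "(\<lambda>x. cnj (\<phi> x)) \<in> borel_measurable M"
        by (rule measurable_compose[OF m borel_measurable_continuous_onI]) (intro continuous_intros)
    qed (use norm in simp)
    show "g \<in> l2_closure M (lin_span (\<lambda>n x. \<phi> x * f n x) I)"
      unfolding mem_l2_closure_iff
    proof (intro conjI g allI impI)
      fix e :: real assume "e > 0"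
      then obtain F c where F: "finite F" "F \<subseteq> I" "l2_norm M (\<lambda>x. cnj (\<phi> x) * g x - (\<Sum>n\<in>F. c n * f n x)) < e"
        using R g' unfolding riesz_system_def l2_total_def subset_iff mem_l2_closure_iff by meson
      have "l2_norm M (\<lambda>x. g x - (\<Sum>n\<in>F. c n * (\<phi> x * f n x))) = l2_norm M (\<lambda>x. cnj (\<phi> x) * g x - (\<Sum>n\<in>F. c n * f n x))"
      proof (rule l2_norm_cong)
        fix x assume "x \<in> space M"
        then have 1: "\<phi> x * cnj (\<phi> x) = 1"
          by (simp add: norm complex_norm_square[symmetric])
        have "g x - (\<Sum>n\<in>F. c n * (\<phi> x * f n x)) = (\<phi> x * cnj (\<phi> x)) * g x - \<phi> x * (\<Sum>n\<in>F. c n * f n x)"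
          by (simp add: 1 sum)
        also have "\<dots> = \<phi> x * (cnj (\<phi> x) * g x - (\<Sum>n\<in>F. c n * f n x))" by (simp add: algebra_simps)
        finally show "cmod (g x - (\<Sum>n\<in>F. c n * (\<phi> x * f n x))) = cmod (cnj (\<phi> x) * g x - (\<Sum>n\<in>F. c n * f n x))"
          using \<open>x \<in> space M\<close> by (simp add: norm_mult norm)
      qed
      then show "\<exists>F c. finite F \<and> F \<subseteq> I \<and> l2_norm M (\<lambda>x. g x - (\<Sum>n\<in>F. c n * (\<phi> x * f n x))) < e"
        using F by (intro exI[of _ F] exI[of _ c]) simp
    qed
  qed
  ultimately show ?thesis
    unfolding riesz_system_def using f norm by (auto intro!: l2_mult_unimodular)
qed

lemma wave_riesz_system_shift_frequencies:
  assumes "riesz_system (lborel_on {0..h}) wave \<Gamma>"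
  shows "riesz_system (lborel_on {0..h}) wave ((+) k ` \<Gamma>)"
proof (rule riesz_system_transfer[OF riesz_system_modulate[OF assms, of "wave k"]])
  show "(\<lambda>x. x) \<in> lborel_on {0..h} \<rightarrow>\<^sub>M lborel_on {0..h}" by simp
  show "(0::real) < 1" by simp
qed (auto simp: wave_mult intro: borel_measurable_lborel_on)

text \<open>
  A multiple of \<open>h\<close> that exceeds an integer by very little is found by Dirichlet's theorem. If the
  theorem produces a multiple that falls short of an integer by \<open>\<epsilon>\<close> instead, then repeating it
  \<open>\<lfloor>1/\<epsilon>\<rfloor>\<close> times accumulates a deficit that is just below 1.
\<close>

lemma multiple_slightly_above_integer:
  fixes h :: real
  assumes h: "0 < h"
  shows "\<exists>(N::nat) (k::nat) \<theta>. 0 < N \<and> real N * h = real k + \<theta> \<and> 0 \<le> \<theta> \<and> \<theta> \<le> 1 / 10"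
proof -
  have wrap: ?thesis if "0 < n" "of_int n * h = of_int k + \<theta>" "0 \<le> \<theta>" "\<theta> \<le> 1 / 10" for n k :: int and \<theta>
  proof -
    have "0 < of_int n * h" using that(1) h by (intro mult_pos_pos) auto
    then have "k \<ge> 0" using that by linarith
    then show ?thesis
      using that by (intro exI[of _ "nat n"] exI[of _ "nat k"] exI[of _ \<theta>]) auto
  qed
  have "\<exists>n p :: int. 0 < n \<and> \<bar>of_int n * h - of_int p\<bar> < 1 / real 10"
    by (rule Dirichlet_approx[of 10 h]) (simp, blast)
  then obtain n p :: int where n: "0 < n" "\<bar>of_int n * h - of_int p\<bar> < 1 / real 10" by blast
  show ?thesis
  proof (cases "of_int n * h \<ge> of_int p")
    case True
    then show ?thesis using n by (intro wrap[of n p "of_int n * h - of_int p"]) auto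
  next
    case False
    define \<epsilon> where "\<epsilon> = of_int p - of_int n * h"
    have \<epsilon>: "0 < \<epsilon>" "\<epsilon> < 1 / 10" using False n by (auto simp: \<epsilon>_def)
    define j where "j = \<lfloor>1 / \<epsilon>\<rfloor>"
    have j': "of_int j \<le> 1 / \<epsilon>" "1 / \<epsilon> < of_int j + 1" unfolding j_def by linarith+
    then have j: "of_int j * \<epsilon> \<le> 1" "1 < of_int j * \<epsilon> + \<epsilon>"
      using \<epsilon> by (auto simp: field_simps)
    have "10 < 1 / \<epsilon>" using \<epsilon> by (simp add: field_simps)
    then have "j > 0" using j'(2) by linarith
    moreover have "of_int (j * n) * h = of_int (j * p - 1) + (1 - of_int j * \<epsilon>)"
      by (simp add: \<epsilon>_def algebra_simps)
    moreover have "0 < j * n" using \<open>j > 0\<close> n(1) by simp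
    ultimately show ?thesis
      using j \<epsilon> by (intro wrap[of "j * n" "j * p - 1" "1 - of_int j * \<epsilon>"]) linarith+
  qed
qed

lemma wave_inverse_nat_cong:
  assumes "N > 0" shows "wave m (1 / real N) = wave (m mod int N) (1 / real N)"
proof -
  have "wave m (1 / real N) = wave (m div int N * int N + m mod int N) (1 / real N)" by simp
  also have "\<dots> = wave (m div int N * int N) (1 / real N) * wave (m mod int N) (1 / real N)"
    by (simp only: wave_mult)
  also have "wave (m div int N * int N) (1 / real N) = wave (m div int N) (of_int 1)"
    using assms by (simp add: wave_def)
  finally show ?thesis by (simp only: wave_int mult_1)
qed

lemma wave_inverse_nat_neq_1:
  assumes "0 < r" "r < int N" shows "wave r (1 / real N) \<noteq> 1"
proof
  have N: "N > 0" using assms by linarith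
  assume "wave r (1 / real N) = 1"
  then have "cos (2 * pi * (of_int r / real N)) = 1" by (simp add: wave_def complex_eq_iff)
  then obtain k :: int where "2 * pi * (of_int r / real N) = of_int k * 2 * pi"
    using cos_one_2pi_int by blast
  then have "real_of_int r = of_int (k * int N)" using N by (simp add: field_simps)
  then have "r = k * int N" by (simp only: of_int_eq_iff)
  then show False using assms by (simp add: zero_less_mult_iff mult_less_cancel_right2)
qed

text \<open>
  Write \<open>N * h = k + \<theta>\<close> with \<open>0 \<le> \<theta> \<le> 1/10\<close>. The interval \<open>[0, \<theta>/N]\<close> is short enough for frequencies
  in \<open>N\<int>\<close>. Each of \<open>k\<close> further steps lengthens the interval by one period \<open>1/N\<close>: the frequencies
  found so far are shifted by 1, which moves them out of \<open>N\<int>\<close>, and \<open>N\<int>\<close> is glued to them. Since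
  \<open>k < N\<close>, the residues modulo \<open>N\<close> never wrap around to 0.
\<close>

lemma interval_riesz_system:
  assumes h: "0 < h" "h \<le> 1"
  shows "\<exists>\<Gamma>. riesz_system (lborel_on {0..h}) wave \<Gamma>"
proof (cases "h = 1")
  case True
  then show ?thesis using wave_riesz_system by auto
next
  case False
  obtain N k :: nat and \<theta> where N: "0 < N" "real N * h = real k + \<theta>" "0 \<le> \<theta>" "\<theta> \<le> 1 / 10"
    using multiple_slightly_above_integer h by blast
  define s where "s = 1 / real N"
  have s: "s > 0" using N by (simp add: s_def)
  have "real N * h < real N * 1" using False h N by (intro mult_strict_left_mono) auto
  then have kN: "k < N" using N by simp
  have "\<exists>\<kappa>>0. \<forall>r\<in>{0<..<int N}. \<kappa> \<le> cmod (wave r s - 1)"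
  proof (cases "{0<..<int N} = {}")
    case True then show ?thesis by (auto intro: exI[of _ 1])
  next
    case False
    define \<kappa> where "\<kappa> = Min ((\<lambda>r. cmod (wave r s - 1)) ` {0<..<int N})"
    have "\<kappa> > 0" using False wave_inverse_nat_neq_1 by (auto simp: \<kappa>_def s_def)
    moreover have "\<forall>r\<in>{0<..<int N}. \<kappa> \<le> cmod (wave r s - 1)" by (auto simp: \<kappa>_def)
    ultimately show ?thesis by blast
  qed
  then obtain \<kappa> where \<kappa>: "\<kappa> > 0" "\<And>r. 0 < r \<Longrightarrow> r < int N \<Longrightarrow> \<kappa> \<le> cmod (wave r s - 1)" by auto
  have multiples: "riesz_system (lborel_on {0..s}) wave (range (\<lambda>n. int N * n))"
    by (rule riesz_system_rescale[OF wave_riesz_system s])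
       (use N in \<open>auto simp: s_def wave_def inj_def\<close>)
  have "\<exists>\<Gamma>. riesz_system (lborel_on {0..(\<theta> + real j) / N}) wave \<Gamma> \<and> (\<forall>m\<in>\<Gamma>. m mod int N \<le> int j)"
    if "j \<le> k" for j
    using that
  proof (induction j)
    case 0
    have "\<exists>\<Gamma>. (\<forall>m\<in>\<Gamma>. int N dvd m) \<and> riesz_system (lborel_on {0..\<theta> / N}) wave \<Gamma>"
    proof (cases "\<theta> = 0")
      case True
      then show ?thesis using degenerate_interval_riesz_system by auto
    next
      case False
      then show ?thesis using N by (intro short_interval_riesz_system) auto
    qed
    then show ?case by auto
  next
    case (Suc j)
    then obtain \<Gamma> where \<Gamma>: "riesz_system (lborel_on {0..(\<theta> + real j) / N}) wave \<Gamma>"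
        "\<And>m. m \<in> \<Gamma> \<Longrightarrow> m mod int N \<le> int j"
      by auto
    define \<Gamma>' where "\<Gamma>' = (+) 1 ` \<Gamma>"
    have \<Gamma>': "0 < m mod int N \<and> m mod int N \<le> int (Suc j)" if m: "m \<in> \<Gamma>'" for m
    proof -
      obtain n where n: "n \<in> \<Gamma>" "m = n + 1" using m by (auto simp: \<Gamma>'_def)
      have "n mod int N + 1 < int N" using \<Gamma>(2)[OF n(1)] Suc.prems kN by simp
      then have "m mod int N = n mod int N + 1"
        using N(1) unfolding n(2) by (subst mod_add_left_eq[symmetric]) (simp add: mod_pos_pos_trivial)
      then show ?thesis using \<Gamma>(2)[OF n(1)] N(1) by (simp add: pos_mod_sign)
    qed
    let ?h = "(\<theta> + real (Suc j)) / N"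
    have "riesz_system (lborel_on {0..?h}) wave (range (\<lambda>n. int N * n) \<union> \<Gamma>')"
    proof (rule glue_riesz_systems[OF s _ _ multiples])
      show "s \<le> ?h" using N by (simp add: s_def divide_right_mono)
      have "\<theta> + real (Suc j) \<le> real N * h" using N Suc.prems by simp
      also have "\<dots> \<le> real N * 1" using h by (intro mult_left_mono) auto
      finally show "?h \<le> 1" using N by (simp add: field_simps)
      have "?h - s = (\<theta> + real j) / N" by (simp add: s_def add_divide_distrib)
      then show "riesz_system (lborel_on {0..?h - s}) wave \<Gamma>'"
        using wave_riesz_system_shift_frequencies[OF \<Gamma>(1)] by (simp add: \<Gamma>'_def)
      show "wave m s = 1" if "m \<in> range (\<lambda>n. int N * n)" for m
        using that wave_inverse_nat_cong[OF N(1), of m] by (auto simp: s_def)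
      show "\<kappa> \<le> cmod (wave m s - 1)" if "m \<in> \<Gamma>'" for m
        using \<Gamma>'[OF that] N(1) \<kappa>(2)[of "m mod int N"] wave_inverse_nat_cong[OF N(1), of m] by (simp add: s_def)
      show "\<kappa> > 0" by (rule \<kappa>)
    qed
    moreover have "m mod int N \<le> int (Suc j)" if "m \<in> range (\<lambda>n. int N * n) \<union> \<Gamma>'" for m
      using that \<Gamma>' by auto
    ultimately show ?case by blast
  qed
  moreover have "(\<theta> + real k) / N = h" using N by (simp add: field_simps)
  ultimately show ?thesis by (metis order_refl)
qed

section \<open>Products twisted by a phase\<close>

lemma l2_product:
  assumes fin: "finite_measure M" and g: "g \<in> l2_space N" and k: "k \<in> l2_space M"
  shows "(\<lambda>z. g (fst z) * k (snd z)) \<in> l2_space (N \<Otimes>\<^sub>M M)"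
    "l2_norm (N \<Otimes>\<^sub>M M) (\<lambda>z. g (fst z) * k (snd z)) = l2_norm N g * l2_norm M k"
proof -
  interpret finite_measure M by fact
  have [measurable]: "g \<in> borel_measurable N" "k \<in> borel_measurable M"
    using g k by (auto dest: l2_spaceD)
  have "(\<integral>\<^sup>+z. ennreal ((cmod (g (fst z) * k (snd z)))\<^sup>2) \<partial>(N \<Otimes>\<^sub>M M))
      = (\<integral>\<^sup>+x. (\<integral>\<^sup>+y. ennreal ((cmod (g x))\<^sup>2) * ennreal ((cmod (k y))\<^sup>2) \<partial>M) \<partial>N)"
    by (subst nn_integral_fst[symmetric]) (auto simp: norm_mult power_mult_distrib ennreal_mult)
  also have "\<dots> = (\<integral>\<^sup>+x. ennreal ((cmod (g x))\<^sup>2) \<partial>N) * (\<integral>\<^sup>+y. ennreal ((cmod (k y))\<^sup>2) \<partial>M)"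
    by (simp add: nn_integral_cmult nn_integral_multc)
  finally have eq: "(\<integral>\<^sup>+z. ennreal ((cmod (g (fst z) * k (snd z)))\<^sup>2) \<partial>(N \<Otimes>\<^sub>M M))
      = ennreal ((l2_norm N g)\<^sup>2) * ennreal ((l2_norm M k)\<^sup>2)"
    using g k by (simp add: ennreal_l2_norm_square)
  show mem: "(\<lambda>z. g (fst z) * k (snd z)) \<in> l2_space (N \<Otimes>\<^sub>M M)"
    unfolding l2_space_iff_nn_integral eq by (auto simp: ennreal_mult_less_top)
  have "ennreal ((l2_norm (N \<Otimes>\<^sub>M M) (\<lambda>z. g (fst z) * k (snd z)))\<^sup>2) = ennreal ((l2_norm N g * l2_norm M k)\<^sup>2)"
    unfolding ennreal_l2_norm_square[OF mem] eq by (simp add: ennreal_mult power_mult_distrib)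
  then show "l2_norm (N \<Otimes>\<^sub>M M) (\<lambda>z. g (fst z) * k (snd z)) = l2_norm N g * l2_norm M k"
    by (simp add: power2_eq_iff_nonneg)
qed

text \<open>
  For a fixed first coordinate \<open>x\<close>, a linear combination of the products is a linear combination of
  the \<open>v m\<close> with coefficients \<open>\<phi> m x * (\<Sum>n. c (n, m) * u n x)\<close>. The phases do not affect the absolute
  values of these coefficients, so the two pairs of Riesz bounds multiply. For totality, a product
  \<open>g x * v m y\<close> with a single fixed \<open>m\<close> is approximated by expanding \<open>cnj (\<phi> m) * g\<close> in the \<open>u n\<close>,
  and the indicator of a rectangle is approximated by linear combinations of such products.
\<close>

lemma riesz_system_twisted_product:
  fixes M1 :: "'a measure" and M2 :: "'b measure" and I :: "'i set" and J :: "'j set"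
  assumes fin1: "finite_measure M1" and fin2: "finite_measure M2"
    and R1: "riesz_system M1 u I" and R2: "riesz_system M2 v J"
    and \<phi>m: "\<And>m. m \<in> J \<Longrightarrow> \<phi> m \<in> borel_measurable M1"
    and \<phi>n: "\<And>m x. m \<in> J \<Longrightarrow> x \<in> space M1 \<Longrightarrow> cmod (\<phi> m x) = 1"
  shows "riesz_system (M1 \<Otimes>\<^sub>M M2)
    (\<lambda>p z. \<phi> (snd p) (fst z) * u (fst p) (fst z) * v (snd p) (snd z)) (I \<times> J)"
proof -
  interpret M2: finite_measure M2 by fact
  interpret M1: finite_measure M1 by fact
  let ?M = "M1 \<Otimes>\<^sub>M M2"
  let ?w = "\<lambda>p z. \<phi> (snd p) (fst z) * u (fst p) (fst z) * v (snd p) (snd z)"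
  have fin: "finite_measure ?M"
    by (rule finite_measureI)
       (simp add: space_pair_measure M2.emeasure_pair_measure_Times ennreal_mult_eq_top_iff M1.emeasure_finite M2.emeasure_finite)
  have u: "u n \<in> l2_space M1" if "n \<in> I" for n using R1 that by (auto simp: riesz_system_def)
  have v: "v m \<in> l2_space M2" if "m \<in> J" for m using R2 that by (auto simp: riesz_system_def)
  have w: "?w p \<in> l2_space ?M" if "p \<in> I \<times> J" for p
    using that by (intro l2_product fin2 v l2_mult_unimodular u \<phi>m \<phi>n) auto
  obtain \<alpha>1 \<beta>1 where b1: "riesz_bounds M1 u I \<alpha>1 \<beta>1" using R1 by (auto simp: riesz_system_def)
  obtain \<alpha>2 \<beta>2 where b2: "riesz_bounds M2 v J \<alpha>2 \<beta>2" using R2 by (auto simp: riesz_system_def)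
  have pos: "\<alpha>1 > 0" "\<alpha>2 > 0" "\<beta>1 > 0" "\<beta>2 > 0" using b1 b2 by (auto simp: riesz_bounds_def)
  have "riesz_bounds ?M ?w (I \<times> J) (\<alpha>2 * \<alpha>1) (\<beta>2 * \<beta>1)"
    unfolding riesz_bounds_def
  proof (intro conjI allI impI)
    show "0 < \<alpha>2 * \<alpha>1" "0 < \<beta>2 * \<beta>1" using pos by auto
    fix F and c :: "'i \<times> 'j \<Rightarrow> complex" assume F: "finite F" "F \<subseteq> I \<times> J"
    define A B where "A = fst ` F" and "B = snd ` F"
    have AB: "finite A" "finite B" "A \<subseteq> I" "B \<subseteq> J" "F \<subseteq> A \<times> B"
      using F by (force simp: A_def B_def)+
    define d where "d n m = (if (n, m) \<in> F then c (n, m) else 0)" for n m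
    define a where "a m x = (\<Sum>n\<in>A. d n m * u n x)" for m x
    have a: "a m \<in> l2_space M1" for m
      unfolding a_def using AB by (intro l2_space_lincomb u) auto
    define W where "W z = (\<Sum>p\<in>F. c p * ?w p z)" for z
    have W2: "W \<in> l2_space ?M" unfolding W_def using F w by (intro l2_space_lincomb) auto
    have W: "W (x, y) = (\<Sum>m\<in>B. (\<phi> m x * a m x) * v m y)" for x y
    proof -
      have "W (x, y) = (\<Sum>p\<in>A \<times> B. d (fst p) (snd p) * ?w p (x, y))"
        unfolding W_def using AB by (intro sum.mono_neutral_cong_left) (auto simp: d_def)
      also have "\<dots> = (\<Sum>n\<in>A. \<Sum>m\<in>B. d n m * ?w (n, m) (x, y))"
        by (simp add: sum.cartesian_product split_beta)
      also have "\<dots> = (\<Sum>m\<in>B. (\<phi> m x * a m x) * v m y)"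
        by (subst sum.swap) (simp add: a_def sum_distrib_left sum_distrib_right mult_ac)
      finally show ?thesis .
    qed
    have c: "(\<Sum>p\<in>F. (cmod (c p))\<^sup>2) = (\<Sum>m\<in>B. \<Sum>n\<in>A. (cmod (d n m))\<^sup>2)"
    proof -
      have "(\<Sum>p\<in>F. (cmod (c p))\<^sup>2) = (\<Sum>p\<in>A \<times> B. (cmod (d (fst p) (snd p)))\<^sup>2)"
        using AB by (intro sum.mono_neutral_cong_left) (auto simp: d_def)
      then show ?thesis by (subst sum.swap) (simp add: sum.cartesian_product split_beta)
    qed
    define Q where "Q = (\<Sum>m\<in>B. (l2_norm M1 (a m))\<^sup>2)"
    have Q: "(\<integral>\<^sup>+x. ennreal (\<Sum>m\<in>B. (cmod (a m x))\<^sup>2) \<partial>M1) = ennreal Q"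
    proof -
      have [measurable]: "a m \<in> borel_measurable M1" for m by (rule l2_spaceD(1)[OF a])
      have "(\<integral>\<^sup>+x. ennreal (\<Sum>m\<in>B. (cmod (a m x))\<^sup>2) \<partial>M1) = (\<integral>\<^sup>+x. (\<Sum>m\<in>B. ennreal ((cmod (a m x))\<^sup>2)) \<partial>M1)"
        by (intro nn_integral_cong) (simp add: sum_ennreal)
      also have "\<dots> = (\<Sum>m\<in>B. \<integral>\<^sup>+x. ennreal ((cmod (a m x))\<^sup>2) \<partial>M1)"
        by (rule nn_integral_sum) measurable
      also have "\<dots> = (\<Sum>m\<in>B. ennreal ((l2_norm M1 (a m))\<^sup>2))"
        by (intro sum.cong) (simp_all add: ennreal_l2_norm_square a)
      also have "\<dots> = ennreal Q" by (simp add: Q_def sum_ennreal)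
      finally show ?thesis .
    qed
    have am: "(\<lambda>x. ennreal (\<Sum>m\<in>B. (cmod (a m x))\<^sup>2)) \<in> borel_measurable M1"
      using l2_spaceD(1)[OF a] by measurable
    have N: "ennreal ((l2_norm ?M W)\<^sup>2) = (\<integral>\<^sup>+x. (\<integral>\<^sup>+y. ennreal ((cmod (W (x, y)))\<^sup>2) \<partial>M2) \<partial>M1)"
      using l2_spaceD(1)[OF W2] unfolding ennreal_l2_norm_square[OF W2]
      by (subst M2.nn_integral_fst) auto
    have inner: "(\<integral>\<^sup>+y. ennreal ((cmod (W (x, y)))\<^sup>2) \<partial>M2) = ennreal ((l2_norm M2 (\<lambda>y. \<Sum>m\<in>B. (\<phi> m x * a m x) * v m y))\<^sup>2)" for x
      unfolding W using AB by (subst ennreal_l2_norm_square) (auto intro!: l2_space_lincomb v)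
    have phase: "(\<Sum>m\<in>B. (cmod (\<phi> m x * a m x))\<^sup>2) = (\<Sum>m\<in>B. (cmod (a m x))\<^sup>2)" if "x \<in> space M1" for x
      using AB \<phi>n that by (intro sum.cong) (auto simp: norm_mult)
    have slice: "\<alpha>2 * (\<Sum>m\<in>B. (cmod (a m x))\<^sup>2) \<le> (l2_norm M2 (\<lambda>y. \<Sum>m\<in>B. (\<phi> m x * a m x) * v m y))\<^sup>2"
      "(l2_norm M2 (\<lambda>y. \<Sum>m\<in>B. (\<phi> m x * a m x) * v m y))\<^sup>2 \<le> \<beta>2 * (\<Sum>m\<in>B. (cmod (a m x))\<^sup>2)"
      if "x \<in> space M1" for x
      using riesz_boundsD[OF b2 AB(2,4), of "\<lambda>m. \<phi> m x * a m x"] unfolding phase[OF that] by auto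
    have scaled: "(\<integral>\<^sup>+x. ennreal (\<gamma> * (\<Sum>m\<in>B. (cmod (a m x))\<^sup>2)) \<partial>M1) = ennreal (\<gamma> * Q)" if "\<gamma> > 0" for \<gamma>
    proof -
      have "(\<integral>\<^sup>+x. ennreal (\<gamma> * (\<Sum>m\<in>B. (cmod (a m x))\<^sup>2)) \<partial>M1)
          = (\<integral>\<^sup>+x. ennreal \<gamma> * ennreal (\<Sum>m\<in>B. (cmod (a m x))\<^sup>2) \<partial>M1)"
        using that by (intro nn_integral_cong ennreal_mult) (auto intro: sum_nonneg)
      also have "\<dots> = ennreal \<gamma> * ennreal Q"
        by (subst nn_integral_cmult[OF am]) (simp only: Q)
      also have "\<dots> = ennreal (\<gamma> * Q)"
        using that by (intro ennreal_mult[symmetric]) (auto simp: Q_def intro: sum_nonneg)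
      finally show ?thesis .
    qed
    have "ennreal (\<alpha>2 * Q) \<le> ennreal ((l2_norm ?M W)\<^sup>2)"
      unfolding N inner scaled[OF pos(2), symmetric]
      by (intro nn_integral_mono ennreal_leI slice)
    then have low: "\<alpha>2 * Q \<le> (l2_norm ?M W)\<^sup>2" by (simp add: ennreal_le_iff)
    have "ennreal ((l2_norm ?M W)\<^sup>2) \<le> ennreal (\<beta>2 * Q)"
      unfolding N inner scaled[OF pos(4), symmetric]
      by (intro nn_integral_mono ennreal_leI slice)
    then have up: "(l2_norm ?M W)\<^sup>2 \<le> \<beta>2 * Q"
      using pos by (subst (asm) ennreal_le_iff) (auto simp: Q_def intro!: mult_nonneg_nonneg sum_nonneg)
    have "\<alpha>1 * (\<Sum>p\<in>F. (cmod (c p))\<^sup>2) \<le> Q" "Q \<le> \<beta>1 * (\<Sum>p\<in>F. (cmod (c p))\<^sup>2)"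
      unfolding c Q_def a_def sum_distrib_left[of \<alpha>1] sum_distrib_left[of \<beta>1]
      by (intro sum_mono riesz_boundsD[OF b1 AB(1,3), unfolded sum_distrib_left])+
    then have "\<alpha>2 * (\<alpha>1 * (\<Sum>p\<in>F. (cmod (c p))\<^sup>2)) \<le> \<alpha>2 * Q" "\<beta>2 * Q \<le> \<beta>2 * (\<beta>1 * (\<Sum>p\<in>F. (cmod (c p))\<^sup>2))"
      using pos by (auto intro!: mult_left_mono)
    with low up show "\<alpha>2 * \<alpha>1 * (\<Sum>p\<in>F. (cmod (c p))\<^sup>2) \<le> (l2_norm ?M (\<lambda>z. \<Sum>p\<in>F. c p * ?w p z))\<^sup>2"
      "(l2_norm ?M (\<lambda>z. \<Sum>p\<in>F. c p * ?w p z))\<^sup>2 \<le> \<beta>2 * \<beta>1 * (\<Sum>p\<in>F. (cmod (c p))\<^sup>2)"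
      unfolding W_def[abs_def] by (simp_all add: mult.assoc)
  qed
  moreover have "l2_total ?M ?w (I \<times> J)"
  proof (rule l2_total_of_generator[OF fin w])
    let ?G = "{a \<times> b | a b. a \<in> sets M1 \<and> b \<in> sets M2}"
    let ?C = "l2_closure ?M (lin_span ?w (I \<times> J))"
    show "Int_stable ?G" by (rule Int_stable_pair_measure_generator)
    show "?G \<subseteq> Pow (space ?M)"
      by (auto simp: space_pair_measure dest: sets.sets_into_space)
    show "sets ?M = sigma_sets (space ?M) ?G" by (simp add: sets_pair_measure space_pair_measure)
    have elem: "(\<lambda>z. g (fst z) * v m (snd z)) \<in> ?C" if g: "g \<in> l2_space M1" and m: "m \<in> J" for g m
      unfolding mem_l2_closure_iff
    proof (intro conjI allI impI)
      show gv: "(\<lambda>z. g (fst z) * v m (snd z)) \<in> l2_space ?M" by (intro l2_product fin2 g v m)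
      fix e :: real assume "e > 0"
      then have e: "e / (1 + l2_norm M2 (v m)) > 0" by (simp add: add_pos_nonneg)
      have "(\<lambda>x. cnj (\<phi> m x)) \<in> borel_measurable M1"
        by (rule measurable_compose[OF \<phi>m[OF m] borel_measurable_continuous_onI]) (intro continuous_intros)
      then have g': "(\<lambda>x. cnj (\<phi> m x) * g x) \<in> l2_space M1"
        using g \<phi>n[OF m] by (intro l2_mult_unimodular) auto
      obtain F a where F: "finite F" "F \<subseteq> I"
          "l2_norm M1 (\<lambda>x. cnj (\<phi> m x) * g x - (\<Sum>n\<in>F. a n * u n x)) < e / (1 + l2_norm M2 (v m))"
        using R1 g' e unfolding riesz_system_def l2_total_def subset_iff mem_l2_closure_iff by meson
      define r where "r x = cnj (\<phi> m x) * g x - (\<Sum>n\<in>F. a n * u n x)" for x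
      have r: "r \<in> l2_space M1"
        unfolding r_def using F(2) by (intro l2_space_diff g' l2_space_lincomb u) auto
      define c where "c p = a (fst p)" for p :: "'i \<times> 'j"
      have sum: "(\<Sum>p\<in>F \<times> {m}. c p * ?w p z) = \<phi> m (fst z) * (\<Sum>n\<in>F. a n * u n (fst z)) * v m (snd z)" for z
        by (simp add: sum.cartesian_product[symmetric] split_beta c_def sum_distrib_left sum_distrib_right mult_ac
            flip: sum.cartesian_product[of "\<lambda>x y. c (x, y) * ?w (x, y) z", simplified])
      have "l2_norm ?M (\<lambda>z. g (fst z) * v m (snd z) - (\<Sum>p\<in>F \<times> {m}. c p * ?w p z))
          = l2_norm ?M (\<lambda>z. r (fst z) * v m (snd z))"
      proof (rule l2_norm_cong)
        fix z assume "z \<in> space ?M"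
        then have z: "cmod (\<phi> m (fst z)) = 1" using \<phi>n[OF m] by (auto simp: space_pair_measure)
        then have 1: "\<phi> m (fst z) * cnj (\<phi> m (fst z)) = 1" by (simp flip: complex_norm_square)
        have "g (fst z) * v m (snd z) - (\<Sum>p\<in>F \<times> {m}. c p * ?w p z)
            = ((\<phi> m (fst z) * cnj (\<phi> m (fst z))) * g (fst z) - \<phi> m (fst z) * (\<Sum>n\<in>F. a n * u n (fst z))) * v m (snd z)"
          unfolding sum 1 by (simp add: algebra_simps)
        also have "\<dots> = \<phi> m (fst z) * (r (fst z) * v m (snd z))"
          by (simp add: r_def algebra_simps)
        finally show "cmod (g (fst z) * v m (snd z) - (\<Sum>p\<in>F \<times> {m}. c p * ?w p z)) = cmod (r (fst z) * v m (snd z))"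
          by (simp add: norm_mult z)
      qed
      also have "\<dots> = l2_norm M1 r * l2_norm M2 (v m)" by (rule l2_product[OF fin2 r v[OF m]])
      also have "\<dots> \<le> e / (1 + l2_norm M2 (v m)) * l2_norm M2 (v m)"
        using F(3) by (intro mult_right_mono) (auto simp: r_def[abs_def])
      also have "\<dots> < e" using \<open>e > 0\<close> by (simp add: field_simps add_pos_nonneg)
      finally show "\<exists>F c. finite F \<and> F \<subseteq> I \<times> J \<and>
          l2_norm ?M (\<lambda>z. g (fst z) * v m (snd z) - (\<Sum>p\<in>F. c p * ?w p z)) < e"
        using F(1,2) m by (intro exI[of _ "F \<times> {m}"] exI[of _ c]) auto
    qed
    have rect: "indicator (A \<times> B) \<in> ?C" if A: "A \<in> sets M1" and B: "B \<in> sets M2" for A B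
    proof (rule l2_closure_limit[OF w])
      have iA: "indicator A \<in> l2_space M1" and iB: "indicator B \<in> l2_space M2"
        using indicator_mem_l2[OF fin1 A] indicator_mem_l2[OF fin2 B] by auto
      show "indicator (A \<times> B) \<in> l2_space ?M" using A B by (intro indicator_mem_l2 fin) auto
      fix e :: real assume "e > 0"
      let ?a = "l2_norm M1 (indicator A)"
      have e: "e / (1 + ?a) > 0" using \<open>e > 0\<close> by (simp add: add_pos_nonneg)
      obtain F b where F: "finite F" "F \<subseteq> J"
          "l2_norm M2 (\<lambda>y. indicator B y - (\<Sum>m\<in>F. b m * v m y)) < e / (1 + ?a)"
        using R2 iB e unfolding riesz_system_def l2_total_def subset_iff mem_l2_closure_iff by meson
      define h where "h z = (\<Sum>m\<in>F. b m * (indicator A (fst z) * v m (snd z)))" for z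
      have h: "h \<in> ?C"
        unfolding h_def using F(2) by (intro l2_closure_sum[OF w] l2_closure_scale elem iA) auto
      have "indicator (A \<times> B) z - h z = indicator A (fst z) * (indicator B (snd z) - (\<Sum>m\<in>F. b m * v m (snd z)))" for z
        by (cases z) (simp add: h_def indicator_times sum_distrib_left mult_ac right_diff_distrib)
      then have "l2_norm ?M (\<lambda>z. indicator (A \<times> B) z - h z)
          = l2_norm ?M (\<lambda>z. indicator A (fst z) * (indicator B (snd z) - (\<Sum>m\<in>F. b m * v m (snd z))))"
        by simp
      also have "\<dots> = ?a * l2_norm M2 (\<lambda>y. indicator B y - (\<Sum>m\<in>F. b m * v m y))"
        using F(2) by (intro l2_product fin2 iA l2_space_diff iB l2_space_lincomb v) auto
      also have "\<dots> \<le> ?a * (e / (1 + ?a))"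
        using F(3) by (intro mult_left_mono) auto
      also have "\<dots> < e" using \<open>e > 0\<close> by (simp add: field_simps add_pos_nonneg)
      finally show "\<exists>h\<in>?C. l2_norm ?M (\<lambda>z. indicator (A \<times> B) z - h z) < e"
        using h by blast
    qed
    show "indicator S \<in> ?C" if "S \<in> ?G" for S using that rect by auto
    show "indicator (space ?M) \<in> ?C" by (simp add: space_pair_measure rect)
  qed
  ultimately show ?thesis using w unfolding riesz_system_def by blast
qed

section \<open>Triangular systems of exponentials on the unit cube\<close>

text \<open>
  For \<open>A = UNIV\<close> this is the exponential with frequency \<open>\<gamma>\<close> at the point \<open>H x\<close>. The sums are restricted
  to \<open>A\<close> so that the coordinates can be added one at a time.
\<close>

definition triangular_wave ::
    "('n \<Rightarrow> 'n \<Rightarrow> real) \<Rightarrow> 'n set \<Rightarrow> ('n \<Rightarrow> int) \<Rightarrow> ('n \<Rightarrow> real) \<Rightarrow> complex" where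
  "triangular_wave H A \<gamma> x = cis (2 * pi * (\<Sum>i\<in>A. \<Sum>l\<in>A. of_int (\<gamma> i) * H i l * x l))"

abbreviation cube_measure :: "'n set \<Rightarrow> ('n \<Rightarrow> real) measure" where
  "cube_measure A \<equiv> PiM A (\<lambda>_. lborel_on {0..1::real})"

lemma borel_measurable_coordinate:
  assumes "l \<in> A" shows "(\<lambda>x. x l) \<in> borel_measurable (cube_measure A)"
  by (rule measurable_compose[OF measurable_component_singleton[OF assms]])
     (rule borel_measurable_lborel_on, simp)

lemma borel_measurable_triangular_wave: "triangular_wave H A \<gamma> \<in> borel_measurable (cube_measure A)"
proof -
  have "(\<lambda>x. \<Sum>i\<in>A. \<Sum>l\<in>A. of_int (\<gamma> i) * H i l * x l) \<in> borel_measurable (cube_measure A)"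
    by (intro borel_measurable_sum borel_measurable_times borel_measurable_const borel_measurable_coordinate)
  moreover have "(\<lambda>s. cis (2 * pi * s)) \<in> borel_measurable borel"
    by (intro borel_measurable_continuous_onI continuous_intros)
  ultimately show ?thesis
    unfolding triangular_wave_def by (rule measurable_compose)
qed

lemma finite_measure_cube_measure: "finite A \<Longrightarrow> finite_measure (cube_measure A)"
proof -
  assume A: "finite A"
  interpret product_sigma_finite "\<lambda>_::'a. lborel_on {0..1::real}"
    by (simp add: product_sigma_finite_def finite_measure.axioms(1)[of "lborel_on {0..1}"] finite_measure_lborel_on)
  have "emeasure (cube_measure A) (\<Pi>\<^sub>E i\<in>A. {0..1}) = (\<Prod>i\<in>A. emeasure (lborel_on {0..1::real}) {0..1})"
    using A by (intro emeasure_PiM) (auto simp: sets_restrict_space)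
  then show ?thesis
    by (intro finite_measureI) (simp add: space_PiM space_restrict_space emeasure_restrict_space)
qed

lemma riesz_system_cube_empty:
  "riesz_system (cube_measure {}) (triangular_wave H {}) (PiE {} \<Gamma>)"
proof -
  let ?M = "cube_measure {} :: ('a \<Rightarrow> real) measure"
  have norm: "(l2_norm ?M g)\<^sup>2 = (cmod (g (\<lambda>_. undefined)))\<^sup>2" for g
    by (simp add: l2_norm_square PiM_empty lebesgue_integral_count_space_finite)
  have mem: "g \<in> l2_space ?M" for g
    by (simp add: l2_space_def PiM_empty integrable_count_space)
  have bounds: "riesz_bounds ?M (triangular_wave H {}) (PiE {} \<Gamma>) 1 1"
    unfolding riesz_bounds_def
  proof (intro conjI allI impI)
    fix F :: "('a \<Rightarrow> int) set" and c :: "('a \<Rightarrow> int) \<Rightarrow> complex"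
    assume "finite F" "F \<subseteq> PiE {} \<Gamma>"
    then have "F = {} \<or> F = {\<lambda>_. undefined}" by auto
    then show "1 * (\<Sum>n\<in>F. (cmod (c n))\<^sup>2) \<le> (l2_norm ?M (\<lambda>x. \<Sum>n\<in>F. c n * triangular_wave H {} n x))\<^sup>2"
      "(l2_norm ?M (\<lambda>x. \<Sum>n\<in>F. c n * triangular_wave H {} n x))\<^sup>2 \<le> 1 * (\<Sum>n\<in>F. (cmod (c n))\<^sup>2)"
      by (auto simp: norm triangular_wave_def)
  qed auto
  moreover have "l2_total ?M (triangular_wave H {}) (PiE {} \<Gamma>)"
    unfolding l2_total_def
  proof
    fix g :: "('a \<Rightarrow> real) \<Rightarrow> complex"
    let ?n = "\<lambda>_::'a. undefined :: int"
    have "(\<lambda>x. g (\<lambda>_. undefined) * triangular_wave H {} ?n x) \<in> l2_closure ?M (lin_span (triangular_wave H {}) (PiE {} \<Gamma>))"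
      by (intro lin_span_subset_l2_closure mem generator_mem_lin_span) simp
    then show "g \<in> l2_closure ?M (lin_span (triangular_wave H {}) (PiE {} \<Gamma>))"
      by (rule l2_closure_cong) (auto simp: triangular_wave_def space_PiM)
  qed
  ultimately show ?thesis unfolding riesz_system_def using mem by blast
qed

text \<open>
  Adding a coordinate \<open>b\<close> larger than all earlier ones multiplies the earlier exponentials by
  \<open>cis (2 * pi * m * H b b * t)\<close>, with \<open>t\<close> the new coordinate, and by a phase that depends on the
  earlier coordinates and on \<open>m\<close>. Triangularity of \<open>H\<close> enters here: the new coordinate does not
  occur in the rows of the earlier indices.
\<close>

lemma triangular_riesz_system:
  fixes H :: "'n::linorder \<Rightarrow> 'n \<Rightarrow> real"
  assumes A: "finite A" and tri: "\<And>i l. i < l \<Longrightarrow> H i l = 0"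
    and R: "\<And>i. riesz_system (lborel_on {0..1}) (\<lambda>m t. cis (2 * pi * (of_int m * (H i i * t)))) (\<Gamma> i)"
  shows "riesz_system (cube_measure A) (triangular_wave H A) (PiE A \<Gamma>)"
  using A
proof (induction A rule: finite_linorder_max_induct)
  case empty
  show ?case by (rule riesz_system_cube_empty)
next
  case (insert b A)
  have b: "b \<notin> A" using insert.hyps by auto
  interpret product_sigma_finite "\<lambda>_::'n. lborel_on {0..1::real}"
    by (simp add: product_sigma_finite_def finite_measure.axioms(1)[of "lborel_on {0..1}"] finite_measure_lborel_on)
  have L: "sigma_finite_measure (lborel_on {0..1::real})"
    by (rule finite_measure.axioms(1)) (rule finite_measure_lborel_on)
  let ?M = "cube_measure A \<Otimes>\<^sub>M lborel_on {0..1::real}"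
  define \<phi> where "\<phi> m x = cis (2 * pi * (\<Sum>l\<in>A. of_int m * H b l * x l))" for m :: int and x
  let ?w = "\<lambda>p z. \<phi> (snd p) (fst z) * triangular_wave H A (fst p) (fst z) * cis (2 * pi * (of_int (snd p) * (H b b * snd z)))"
  have \<phi>m: "\<phi> m \<in> borel_measurable (cube_measure A)" for m
  proof -
    have "(\<lambda>x. \<Sum>l\<in>A. of_int m * H b l * x l) \<in> borel_measurable (cube_measure A)"
      by (intro borel_measurable_sum borel_measurable_times borel_measurable_const borel_measurable_coordinate)
    moreover have "(\<lambda>s. cis (2 * pi * s)) \<in> borel_measurable borel"
      by (intro borel_measurable_continuous_onI continuous_intros)
    ultimately show ?thesis unfolding \<phi>_def by (rule measurable_compose)
  qed
  have product: "riesz_system ?M ?w (PiE A \<Gamma> \<times> \<Gamma> b)"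
    by (rule riesz_system_twisted_product[OF finite_measure_cube_measure finite_measure_lborel_on insert.IH R \<phi>m])
       (use insert.hyps in \<open>auto simp: \<phi>_def\<close>)
  define T where "T z = (fst z)(b := snd z)" for z :: "('n \<Rightarrow> real) \<times> real"
  define \<pi> where "\<pi> p = (fst p)(b := snd p)" for p :: "('n \<Rightarrow> int) \<times> int"
  have T: "T \<in> ?M \<rightarrow>\<^sub>M cube_measure (insert b A)"
    using measurable_add_dim[of b A "\<lambda>_. lborel_on {0..1::real}"] by (simp add: T_def[abs_def] case_prod_beta')
  have "riesz_system (cube_measure (insert b A)) (triangular_wave H (insert b A)) (\<pi> ` (PiE A \<Gamma> \<times> \<Gamma> b))"
  proof (rule riesz_system_transfer[OF product T, of 1])
    show "(\<integral>\<^sup>+y. F y \<partial>cube_measure (insert b A)) = ennreal 1 * (\<integral>\<^sup>+z. F (T z) \<partial>?M)"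
      if F: "F \<in> borel_measurable (cube_measure (insert b A))" for F
    proof -
      have "(\<integral>\<^sup>+y. F y \<partial>cube_measure (insert b A))
          = (\<integral>\<^sup>+x. (\<integral>\<^sup>+t. F (T (x, t)) \<partial>lborel_on {0..1}) \<partial>cube_measure A)"
        using product_nn_integral_insert[OF insert.hyps(1) b F] by (simp add: T_def)
      also have "\<dots> = (\<integral>\<^sup>+z. F (T z) \<partial>?M)"
        by (rule sigma_finite_measure.nn_integral_fst[OF L]) (rule measurable_compose[OF T F])
      finally show ?thesis by simp
    qed
    show "inj_on \<pi> (PiE A \<Gamma> \<times> \<Gamma> b)"
    proof (rule inj_onI)
      fix p q assume p: "p \<in> PiE A \<Gamma> \<times> \<Gamma> b" and q: "q \<in> PiE A \<Gamma> \<times> \<Gamma> b" and eq: "\<pi> p = \<pi> q"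
      have "fst p i = fst q i" for i
      proof (cases "i = b")
        case True
        have "fst p \<in> PiE A \<Gamma>" "fst q \<in> PiE A \<Gamma>" using p q by auto
        then show ?thesis using PiE_arb b True by metis
      next
        case False
        then show ?thesis using fun_cong[OF eq, of i] by (simp add: \<pi>_def)
      qed
      moreover have "snd p = snd q" using fun_cong[OF eq, of b] by (simp add: \<pi>_def)
      ultimately show "p = q" by (simp add: prod_eq_iff fun_eq_iff)
    qed
    show "triangular_wave H (insert b A) (\<pi> p) (T z) = ?w p z" for p z
    proof -
      define x t g m where xt: "x = fst z" "t = snd z" "g = fst p" "m = snd p"
      have row: "(\<Sum>l\<in>insert b A. of_int (\<pi> p i) * H i l * T z l) = (\<Sum>l\<in>A. of_int (g i) * H i l * x l)"
        if i: "i \<in> A" for i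
      proof -
        have "H i b = 0" using tri insert.hyps i by blast
        moreover have "\<pi> p i = g i" using i b by (auto simp: \<pi>_def xt)
        moreover have "(\<Sum>l\<in>A. of_int (g i) * H i l * T z l) = (\<Sum>l\<in>A. of_int (g i) * H i l * x l)"
          using b by (intro sum.cong) (auto simp: T_def xt)
        ultimately show ?thesis using insert.hyps(1) b by simp
      qed
      have "(\<Sum>l\<in>insert b A. of_int (\<pi> p b) * H b l * T z l) = of_int m * H b b * t + (\<Sum>l\<in>A. of_int m * H b l * T z l)"
        using insert.hyps(1) b by (simp add: \<pi>_def T_def xt)
      also have "(\<Sum>l\<in>A. of_int m * H b l * T z l) = (\<Sum>l\<in>A. of_int m * H b l * x l)"
        using b by (intro sum.cong) (auto simp: T_def xt)
      finally have "(\<Sum>i\<in>insert b A. \<Sum>l\<in>insert b A. of_int (\<pi> p i) * H i l * T z l)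
          = (\<Sum>l\<in>A. of_int m * H b l * x l) + (\<Sum>i\<in>A. \<Sum>l\<in>A. of_int (g i) * H i l * x l) + of_int m * (H b b * t)"
        using insert.hyps(1) b row by simp
      then show ?thesis
        unfolding triangular_wave_def \<phi>_def xt[symmetric]
        by (simp only: cis_mult distrib_left[symmetric])
    qed
  qed (use borel_measurable_triangular_wave in auto)
  also have "\<pi> ` (PiE A \<Gamma> \<times> \<Gamma> b) = PiE (insert b A) \<Gamma>"
    unfolding PiE_insert_eq \<pi>_def by (force simp: image_iff)
  finally show ?case .
qed

section \<open>Linear images of the cube\<close>

lemma borel_measurable_chi:
  assumes "\<And>i. (\<lambda>x. x i) \<in> borel_measurable M"
  shows "(\<lambda>x. \<chi> i. x i) \<in> M \<rightarrow>\<^sub>M (borel :: (real^'n) measure)"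
proof (subst borel_measurable_euclidean_space, rule ballI)
  fix b :: "real^'n" assume "b \<in> Basis"
  then obtain i where "b = axis i 1" by (auto simp: Basis_vec_def)
  then show "(\<lambda>x. (\<chi> i. x i) \<bullet> b) \<in> borel_measurable M"
    using assms by (simp add: inner_axis)
qed

lemma lborel_vec_eq_distr_PiM:
  "(lborel :: (real^'n) measure) = distr (PiM UNIV (\<lambda>_::'n. lborel)) borel (\<lambda>x. \<chi> i. x i)"
proof (rule lborel_eqI)
  interpret product_sigma_finite "\<lambda>_::'n. lborel :: real measure"
    by (simp add: product_sigma_finite_def sigma_finite_lborel)
  have m: "(\<lambda>x. \<chi> i. x i) \<in> PiM UNIV (\<lambda>_::'n. lborel) \<rightarrow>\<^sub>M (borel :: (real^'n) measure)"
    by (rule borel_measurable_chi) simp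
  fix l u :: "real^'n"
  assume lu: "\<And>b. b \<in> Basis \<Longrightarrow> l \<bullet> b \<le> u \<bullet> b"
  have lu': "l $ i \<le> u $ i" for i using lu[of "axis i 1"] by (simp add: inner_axis)
  have "emeasure (distr (PiM UNIV (\<lambda>_::'n. lborel)) borel (\<lambda>x. \<chi> i. x i)) (box l u)
      = emeasure (PiM UNIV (\<lambda>_::'n. lborel)) (\<Pi>\<^sub>E i\<in>UNIV. {l $ i<..<u $ i})"
    using m by (subst emeasure_distr) (auto simp: space_PiM mem_box_cart PiE_iff intro!: arg_cong2[where f=emeasure])
  also have "\<dots> = (\<Prod>i\<in>UNIV. ennreal (u $ i - l $ i))"
    using lu' by (subst emeasure_PiM) auto
  also have "\<dots> = ennreal (\<Prod>i\<in>UNIV. u $ i - l $ i)"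
    using lu' by (intro prod_ennreal) auto
  also have "(\<Prod>i\<in>UNIV. u $ i - l $ i) = (\<Prod>b\<in>Basis. (u - l) \<bullet> b)"
  proof -
    have "(\<Prod>b\<in>Basis. (u - l) \<bullet> b) = (\<Prod>b\<in>range (\<lambda>i. axis i 1). (u - l) \<bullet> b)"
      by (rule prod.cong) (auto simp: Basis_vec_def)
    also have "\<dots> = (\<Prod>i\<in>UNIV. (u - l) \<bullet> axis i 1)"
      by (subst prod.reindex) (auto simp: inj_def axis_eq_axis)
    finally show ?thesis by (simp add: inner_axis)
  qed
  finally show "emeasure (distr (PiM UNIV (\<lambda>_::'n. lborel)) borel (\<lambda>x. \<chi> i. x i)) (box l u)
      = ennreal (\<Prod>b\<in>Basis. (u - l) \<bullet> b)" .
qed simp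

lemma measurable_vec_nth_cube:
  "vec_nth \<in> lborel_on unit_cube \<rightarrow>\<^sub>M cube_measure (UNIV :: 'n::finite set)"
proof (rule measurable_PiM_single')
  show "(\<lambda>v. v $ i) \<in> lborel_on unit_cube \<rightarrow>\<^sub>M lborel_on {0..1}" for i :: 'n
    by (rule measurable_restrict_space3) (auto simp: unit_cube_def mem_box_cart)
qed (auto simp: unit_cube_def mem_box_cart space_restrict_space)

lemma cube_measure_eq_distr:
  "cube_measure (UNIV :: 'n::finite set) = distr (lborel_on unit_cube) (cube_measure UNIV) vec_nth"
proof (rule sym)
  interpret L: product_sigma_finite "\<lambda>_::'n. lborel :: real measure"
    by (simp add: product_sigma_finite_def sigma_finite_lborel)
  interpret product_sigma_finite "\<lambda>_::'n. lborel_on {0..1::real}"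
    by (simp add: product_sigma_finite_def finite_measure.axioms(1)[of "lborel_on {0..1}"] finite_measure_lborel_on)
  have m: "(\<lambda>x. \<chi> i. x i) \<in> PiM UNIV (\<lambda>_::'n. lborel) \<rightarrow>\<^sub>M (borel :: (real^'n) measure)"
    by (rule borel_measurable_chi) simp
  have cube: "v \<in> unit_cube \<longleftrightarrow> (\<forall>i. v $ i \<in> {0..1})" for v :: "real^'n"
    by (simp add: unit_cube_def mem_box_cart)
  show "distr (lborel_on unit_cube) (cube_measure UNIV) vec_nth = cube_measure (UNIV :: 'n set)"
  proof (rule PiM_eqI)
    fix A :: "'n \<Rightarrow> real set" assume A: "\<And>i. i \<in> UNIV \<Longrightarrow> A i \<in> sets (lborel_on {0..1})"
    have A': "A i \<in> sets borel" "A i \<subseteq> {0..1}" for i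
      using A[of i] by (auto simp: sets_restrict_space_iff)
    define V where "V = {v :: real^'n. \<forall>i. v $ i \<in> A i}"
    have V: "V \<subseteq> unit_cube" using A'(2) by (force simp: V_def cube)
    have Vm: "V \<in> sets borel"
    proof -
      have "V = (\<Inter>i. (\<lambda>v. v $ i) -` A i \<inter> space borel)" by (auto simp: V_def)
      moreover have "(\<lambda>v::real^'n. v $ i) -` A i \<inter> space borel \<in> sets borel" for i
        using A'(1) by (intro measurable_sets[OF borel_measurable_nth]) 
      ultimately show ?thesis by (simp only:) (intro sets.finite_INT, auto)
    qed
    have "emeasure (distr (lborel_on unit_cube) (cube_measure UNIV) vec_nth) (PiE UNIV A)
        = emeasure (lborel_on unit_cube) (vec_nth -` (PiE UNIV A) \<inter> space (lborel_on unit_cube))"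
      by (rule emeasure_distr[OF measurable_vec_nth_cube]) (rule sets_PiM_I_finite, use A in auto)
    also have "vec_nth -` (PiE UNIV A) \<inter> space (lborel_on unit_cube) = V"
      using V by (auto simp: V_def space_restrict_space)
    also have "emeasure (lborel_on unit_cube) V = emeasure lborel V"
      using V by (intro emeasure_restrict_space) (auto simp: unit_cube_def)
    also have "\<dots> = emeasure (PiM UNIV (\<lambda>_::'n. lborel)) (PiE UNIV A)"
      using m Vm by (subst lborel_vec_eq_distr_PiM, subst emeasure_distr)
        (auto simp: space_PiM V_def PiE_iff intro!: arg_cong2[where f=emeasure])
    also have "\<dots> = (\<Prod>i\<in>UNIV. emeasure lborel (A i))"
      using A' by (intro L.emeasure_PiM) auto
    also have "\<dots> = (\<Prod>i\<in>UNIV. emeasure (lborel_on {0..1}) (A i))"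
      using A' by (intro prod.cong refl emeasure_restrict_space[symmetric]) auto
    finally show "emeasure (distr (lborel_on unit_cube) (cube_measure UNIV) vec_nth) (PiE UNIV A)
        = (\<Prod>i\<in>UNIV. emeasure (lborel_on {0..1}) (A i))" .
  qed auto
qed

lemma lborel_eq_scaled_linear_distr:
  fixes B :: "real ^ 'n::{finite,wellorder} ^ 'n::{finite,wellorder}"
  assumes "invertible B"
  shows "lborel = scale_measure (ennreal \<bar>det B\<bar>) (distr lborel borel ((*v) B))"
proof (rule lborel_eqI)
  obtain C where C: "B ** C = mat 1" "C ** B = mat 1"
    using assms by (auto simp: invertible_def)
  have det: "det B * det C = 1" using C(1) det_mul[of B C] by (simp add: det_I)
  have m: "(*v) B \<in> borel_measurable borel"
    by (intro borel_measurable_continuous_onI linear_continuous_on matrix_vector_mul_bounded_linear)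
  fix l u :: "real ^ 'n::{finite,wellorder}"
  assume lu: "\<And>b. b \<in> Basis \<Longrightarrow> l \<bullet> b \<le> u \<bullet> b"
  have pre: "(*v) B -` box l u = (*v) C ` box l u"
  proof safe
    fix x assume "B *v x \<in> box l u"
    moreover have "x = C *v (B *v x)" by (simp add: matrix_vector_mul_assoc C)
    ultimately show "x \<in> (*v) C ` box l u" by blast
  qed (simp add: matrix_vector_mul_assoc C)
  have lm: "(*v) C ` box l u \<in> lmeasurable"
    by (rule measurable_linear_image[OF matrix_vector_mul_linear]) simp
  have borel: "(*v) C ` box l u \<in> sets borel"
    using measurable_sets[OF m, of "box l u"] pre by simp
  have "emeasure lborel ((*v) C ` box l u) = ennreal (measure lebesgue ((*v) C ` box l u))"
    using lm borel by (subst emeasure_eq_measure2[symmetric]) (auto simp: fmeasurable_def)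
  also have "measure lebesgue ((*v) C ` box l u) = \<bar>det C\<bar> * measure lebesgue (box l u)"
    by (subst measure_linear_image) auto
  also have "measure lebesgue (box l u) = (\<Prod>b\<in>Basis. (u - l) \<bullet> b)"
    using lu by (simp add: measure_lborel_box_eq)
  finally have "emeasure (scale_measure (ennreal \<bar>det B\<bar>) (distr lborel borel ((*v) B))) (box l u)
      = ennreal \<bar>det B\<bar> * ennreal (\<bar>det C\<bar> * (\<Prod>b\<in>Basis. (u - l) \<bullet> b))"
    using m pre by (simp add: emeasure_distr)
  also have "\<dots> = ennreal (\<bar>det B * det C\<bar> * (\<Prod>b\<in>Basis. (u - l) \<bullet> b))"
    using lu by (subst ennreal_mult[symmetric]) (auto simp: abs_mult mult.assoc inner_diff_left intro!: mult_nonneg_nonneg prod_nonneg)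
  finally show "emeasure (scale_measure (ennreal \<bar>det B\<bar>) (distr lborel borel ((*v) B))) (box l u)
      = ennreal (\<Prod>b\<in>Basis. (u - l) \<bullet> b)"
    by (simp add: det)
qed simp

lemma compact_linear_image_cube: "compact ((\<lambda>x. B *v x) ` (unit_cube :: (real^'n) set))"
  for B :: "real^'n^'m"
  unfolding unit_cube_def
  by (intro compact_continuous_image linear_continuous_on matrix_vector_mul_bounded_linear compact_cbox)

lemma measurable_linear_cube:
  fixes B :: "real^'n^'m"
  shows "(\<lambda>x. B *v (\<chi> i. x i)) \<in> cube_measure UNIV \<rightarrow>\<^sub>M lborel_on ((\<lambda>x. B *v x) ` unit_cube)"
proof (rule measurable_restrict_space2)
  have "(\<lambda>x. \<chi> i. x i) \<in> cube_measure UNIV \<rightarrow>\<^sub>M (borel :: (real^'n) measure)"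
    by (intro borel_measurable_chi borel_measurable_coordinate) simp
  moreover have "(\<lambda>x. B *v x) \<in> borel_measurable borel"
    by (intro borel_measurable_continuous_onI linear_continuous_on matrix_vector_mul_bounded_linear)
  ultimately show "(\<lambda>x. B *v (\<chi> i. x i)) \<in> cube_measure UNIV \<rightarrow>\<^sub>M lborel"
    by (simp add: measurable_compose)
  show "(\<lambda>x. B *v (\<chi> i. x i)) \<in> space (cube_measure UNIV) \<rightarrow> (\<lambda>x. B *v x) ` unit_cube"
    by (auto simp: space_PiM space_restrict_space PiE_iff unit_cube_def mem_box_cart)
qed

lemma nn_integral_linear_image_cube:
  fixes B :: "real ^ 'n::{finite,wellorder} ^ 'n::{finite,wellorder}"
  assumes B: "invertible B"
    and F: "F \<in> borel_measurable (lborel_on ((\<lambda>x. B *v x) ` unit_cube))"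
  shows "(\<integral>\<^sup>+y. F y \<partial>lborel_on ((\<lambda>x. B *v x) ` unit_cube))
    = ennreal \<bar>det B\<bar> * (\<integral>\<^sup>+x. F (B *v (\<chi> i. x i)) \<partial>cube_measure UNIV)"
proof -
  let ?S = "(\<lambda>x. B *v x) ` (unit_cube :: (real ^ 'n::{finite,wellorder}) set)"
  have S: "?S \<in> sets borel"
    using compact_linear_image_cube by (intro borel_closed compact_imp_closed)
  have cube: "(unit_cube :: (real ^ 'n::{finite,wellorder}) set) \<in> sets borel" by (simp add: unit_cube_def)
  have inj: "inj ((*v) B)"
    using B by (simp add: inj_matrix_vector_mult)
  have F': "(\<lambda>y. F y * indicator ?S y) \<in> borel_measurable borel"
    using F S by (subst (asm) borel_measurable_restrict_space_iff_ennreal) auto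
  have Bm: "(*v) B \<in> borel_measurable borel"
    by (intro borel_measurable_continuous_onI linear_continuous_on matrix_vector_mul_bounded_linear)
  have "(\<integral>\<^sup>+y. F y \<partial>lborel_on ?S) = (\<integral>\<^sup>+y. F y * indicator ?S y \<partial>lborel)"
    by (rule nn_integral_lborel_on[OF S])
  also have "\<dots> = (\<integral>\<^sup>+y. F y * indicator ?S y \<partial>scale_measure (ennreal \<bar>det B\<bar>) (distr lborel borel ((*v) B)))"
    using lborel_eq_scaled_linear_distr[OF B] by simp
  also have "\<dots> = ennreal \<bar>det B\<bar> * (\<integral>\<^sup>+x. F (B *v x) * indicator ?S (B *v x) \<partial>lborel)"
    using F' Bm by (subst nn_integral_scale_measure) (simp_all add: nn_integral_distr)
  also have "(\<integral>\<^sup>+x. F (B *v x) * indicator ?S (B *v x) \<partial>lborel) = (\<integral>\<^sup>+x. F (B *v x) \<partial>lborel_on unit_cube)"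
    unfolding nn_integral_lborel_on[OF cube]
    by (intro nn_integral_cong) (simp add: indicator_def inj_image_mem_iff[OF inj])
  also have "\<dots> = (\<integral>\<^sup>+x. F (B *v (\<chi> i. x i)) \<partial>distr (lborel_on unit_cube) (cube_measure UNIV) vec_nth)"
    using measurable_compose[OF measurable_linear_cube F] measurable_vec_nth_cube by (subst nn_integral_distr) simp_all
  also have "distr (lborel_on unit_cube) (cube_measure UNIV) vec_nth = cube_measure (UNIV :: 'n::{finite,wellorder} set)"
    by (rule cube_measure_eq_distr[symmetric])
  finally show ?thesis .
qed

text \<open>
  A Lebesgue measurable function agrees almost everywhere with a Borel function, so passing to the
  completion of the measure changes nothing.
\<close>

lemma riesz_system_lebesgue_on:
  assumes S: "S \<in> sets borel" and R: "riesz_system (lborel_on S) f I"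
    and f: "\<And>n. n \<in> I \<Longrightarrow> f n \<in> borel_measurable borel"
  shows "riesz_system (lebesgue_on S) f I"
proof -
  have int: "(LINT x|lebesgue_on S. (cmod (g x))\<^sup>2) = (LINT x|lborel_on S. (cmod (g x))\<^sup>2)"
    and int': "integrable (lebesgue_on S) (\<lambda>x. (cmod (g x))\<^sup>2) \<longleftrightarrow> integrable (lborel_on S) (\<lambda>x. (cmod (g x))\<^sup>2)"
    if [measurable]: "g \<in> borel_measurable borel" for g :: "'a \<Rightarrow> complex"
  proof -
    have [measurable]: "(\<lambda>x. indicator S x *\<^sub>R (cmod (g x))\<^sup>2) \<in> borel_measurable lborel"
      using S by measurable
    show "(LINT x|lebesgue_on S. (cmod (g x))\<^sup>2) = (LINT x|lborel_on S. (cmod (g x))\<^sup>2)"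
      using S by (simp add: integral_restrict_space integral_completion)
    show "integrable (lebesgue_on S) (\<lambda>x. (cmod (g x))\<^sup>2) \<longleftrightarrow> integrable (lborel_on S) (\<lambda>x. (cmod (g x))\<^sup>2)"
      using S by (simp add: integrable_restrict_space integrable_completion)
  qed
  have leb: "g \<in> borel_measurable (lebesgue_on S)" if "g \<in> borel_measurable borel" for g :: "'a \<Rightarrow> complex"
    using that by (intro measurable_restrict_space1 measurable_completion) simp
  have norm: "l2_norm (lebesgue_on S) g = l2_norm (lborel_on S) g" if "g \<in> borel_measurable borel" for g
    using int[OF that] by (simp add: l2_norm_def)
  have mem: "g \<in> l2_space (lebesgue_on S) \<longleftrightarrow> g \<in> l2_space (lborel_on S)" if "g \<in> borel_measurable borel" for g
    using int'[OF that] leb[OF that] borel_measurable_lborel_on[OF that] by (simp add: l2_space_def)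
  have lin: "(\<lambda>x. \<Sum>n\<in>F. c n * f n x) \<in> borel_measurable borel" if "F \<subseteq> I" for F c
    using that f by (intro borel_measurable_sum borel_measurable_times borel_measurable_const) auto
  have fL: "f n \<in> l2_space (lebesgue_on S)" if "n \<in> I" for n
    using R mem[OF f[OF that]] that by (auto simp: riesz_system_def)
  obtain \<alpha> \<beta> where "riesz_bounds (lborel_on S) f I \<alpha> \<beta>" using R by (auto simp: riesz_system_def)
  then have "riesz_bounds (lebesgue_on S) f I \<alpha> \<beta>"
    by (simp add: riesz_bounds_def norm[OF lin])
  moreover have "l2_total (lebesgue_on S) f I"
    unfolding l2_total_def
  proof
    fix g assume g: "g \<in> l2_space (lebesgue_on S)"
    define g0 where "g0 x = (if x \<in> S then g x else 0)" for x
    have g0: "g0 \<in> borel_measurable lebesgue"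
      using l2_spaceD(1)[OF g] S unfolding g0_def
      by (subst (asm) measurable_restrict_space_iff[of _ _ 0]) auto
    have "(\<lambda>x. Re (g0 x)) \<in> borel_measurable lebesgue" "(\<lambda>x. Im (g0 x)) \<in> borel_measurable lebesgue"
      using g0 by (auto intro: measurable_compose[OF _ borel_measurable_Re] measurable_compose[OF _ borel_measurable_Im])
    then obtain r i where ri: "r \<in> borel_measurable lborel" "AE x in lborel. Re (g0 x) = r x"
        "i \<in> borel_measurable lborel" "AE x in lborel. Im (g0 x) = i x"
      using completion_ex_borel_measurable_real by metis
    define g' where "g' x = Complex (r x) (i x)" for x
    have g'm: "g' \<in> borel_measurable borel"
      using ri(1,3) unfolding g'_def Complex_eq by simp
    have "AE x in lborel. g0 x = g' x"
      using ri(2,4) by eventually_elim (simp add: g'_def complex_eq_iff)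
    then have "AE x in lebesgue. g0 x = g' x" by (rule AE_completion)
    then have ae: "AE x in lebesgue_on S. g x = g' x"
      using S by (subst AE_restrict_space_iff) (auto simp: g0_def elim!: eventually_mono)
    have norm_eq: "l2_norm (lebesgue_on S) (\<lambda>x. g x - h x) = l2_norm (lborel_on S) (\<lambda>x. g' x - h x)"
      if h: "h \<in> borel_measurable borel" for h
    proof -
      have "l2_norm (lebesgue_on S) (\<lambda>x. g x - h x) = l2_norm (lebesgue_on S) (\<lambda>x. g' x - h x)"
        using ae l2_spaceD(1)[OF g] leb[OF g'm] leb[OF h]
        by (intro l2_norm_cong_AE borel_measurable_diff) (auto elim!: eventually_mono)
      also have "\<dots> = l2_norm (lborel_on S) (\<lambda>x. g' x - h x)"
        using g'm h by (intro norm borel_measurable_diff)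
      finally show ?thesis .
    qed
    have "integrable (lebesgue_on S) (\<lambda>x. (cmod (g' x))\<^sup>2)"
      using l2_spaceD[OF g] leb[OF g'm] ae
      by (subst integrable_cong_AE[where g="\<lambda>x. (cmod (g x))\<^sup>2"]) (auto elim!: eventually_mono)
    then have "g' \<in> l2_space (lborel_on S)"
      using mem[OF g'm] leb[OF g'm] by (simp add: l2_space_def)
    then have g'C: "g' \<in> l2_closure (lborel_on S) (lin_span f I)"
      using R by (auto simp: riesz_system_def l2_total_def)
    show "g \<in> l2_closure (lebesgue_on S) (lin_span f I)"
      unfolding mem_l2_closure_iff
    proof (intro conjI g allI impI)
      fix e :: real assume "e > 0"
      then obtain F c where F: "finite F" "F \<subseteq> I" "l2_norm (lborel_on S) (\<lambda>x. g' x - (\<Sum>n\<in>F. c n * f n x)) < e"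
        using g'C unfolding mem_l2_closure_iff by blast
      then show "\<exists>F c. finite F \<and> F \<subseteq> I \<and> l2_norm (lebesgue_on S) (\<lambda>x. g x - (\<Sum>n\<in>F. c n * f n x)) < e"
        using norm_eq[OF lin[OF F(2), of c]] by (intro exI[of _ F] exI[of _ c]) simp
    qed
  qed
  ultimately show ?thesis using fL unfolding riesz_system_def by blast
qed

lemma borel_measurable_exponential: "exponential \<gamma> \<in> borel_measurable borel"
  unfolding exponential_def by (intro borel_measurable_continuous_onI continuous_intros)

section \<open>Parallelepipeds\<close>

theorem theorem3:
  fixes A R H :: "real ^ 'n::{finite,wellorder} ^ 'n::{finite,wellorder}"
  assumes "invertible A"
    and "\<forall>i j. R $ i $ j \<in> \<int>" and "invertible R"
    and "lower_triangular H" and "\<forall>i. 0 < H $ i $ i \<and> H $ i $ i \<le> 1"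
    and "(\<lambda>x. A *v x) ` unit_cube = (\<lambda>x. (matrix_inv R ** H) *v x) ` unit_cube"
  shows "\<exists>\<Gamma>. \<Gamma> \<subseteq> integer_lattice \<and>
    l2_riesz_basis (lebesgue_on ((\<lambda>x. A *v x) ` unit_cube)) exponential \<Gamma>"
proof -
  define B where "B = matrix_inv R ** H"
  define S where "S = (\<lambda>x. B *v x) ` (unit_cube :: (real ^ 'n::{finite,wellorder}) set)"
  have RB: "R ** B = H"
  proof -
    have "R ** matrix_inv R = mat 1"
      using \<open>invertible R\<close> unfolding invertible_def matrix_inv_def by (rule someI2_ex) simp
    then show ?thesis by (simp add: B_def matrix_mul_assoc)
  qed
  have "det H = (\<Prod>i\<in>UNIV. H $ i $ i)"
    using \<open>lower_triangular H\<close> by (intro det_lowerdiagonal) (auto simp: lower_triangular_def)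
  also have "\<dots> > 0" using assms(5) by (intro prod_pos) auto
  finally have "det B \<noteq> 0" using RB det_mul[of R B] by auto
  then have B: "invertible B" and detB: "\<bar>det B\<bar> > 0" by (auto simp: invertible_det_nz)
  have compS: "compact S" unfolding S_def by (rule compact_linear_image_cube)
  have "\<forall>i. \<exists>\<Delta>. riesz_system (lborel_on {0..1}) (\<lambda>m t. cis (2 * pi * (of_int m * (H $ i $ i * t)))) \<Delta>"
  proof
    fix i
    have h: "0 < H $ i $ i" "H $ i $ i \<le> 1" using assms(5) by auto
    obtain \<Delta> where \<Delta>: "riesz_system (lborel_on {0..H $ i $ i}) wave \<Delta>"
      using interval_riesz_system[OF h] by auto
    have "riesz_system (lborel_on {0..1}) (\<lambda>m t. cis (2 * pi * (of_int m * (H $ i $ i * t)))) ((\<lambda>m. m) ` \<Delta>)"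
    proof (rule riesz_system_transfer[OF \<Delta>, where T = "\<lambda>x. x / H $ i $ i" and c = "1 / H $ i $ i"])
      show T: "(\<lambda>x. x / H $ i $ i) \<in> lborel_on {0..H $ i $ i} \<rightarrow>\<^sub>M lborel_on {0..1}"
        by (rule measurable_restrict_space3) (use h in \<open>auto simp: field_simps\<close>)
      show "(\<integral>\<^sup>+y. F y \<partial>lborel_on {0..1}) = ennreal (1 / H $ i $ i) * (\<integral>\<^sup>+x. F (x / H $ i $ i) \<partial>lborel_on {0..H $ i $ i})"
        if F: "F \<in> borel_measurable (lborel_on {0..1})" for F
      proof -
        have "ennreal (1 / H $ i $ i) * (\<integral>\<^sup>+x. F (x / H $ i $ i) \<partial>lborel_on {0..H $ i $ i})
            = ennreal (1 / H $ i $ i) * (ennreal (H $ i $ i) * (\<integral>\<^sup>+y. F y \<partial>lborel_on {0..1}))"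
          using nn_integral_lborel_on_scale[OF measurable_compose[OF T F] h(1)] h(1) by simp
        then show ?thesis
          using h(1) by (simp add: mult.assoc[symmetric] ennreal_mult[symmetric])
      qed
    qed (use h in \<open>auto simp: wave_def intro!: borel_measurable_lborel_on borel_measurable_continuous_onI continuous_intros\<close>)
    then show "\<exists>\<Delta>. riesz_system (lborel_on {0..1}) (\<lambda>m t. cis (2 * pi * (of_int m * (H $ i $ i * t)))) \<Delta>"
      by auto
  qed
  then obtain \<Delta> where \<Delta>: "\<And>i. riesz_system (lborel_on {0..1}) (\<lambda>m t. cis (2 * pi * (of_int m * (H $ i $ i * t)))) (\<Delta> i)"
    by metis
  have cube: "riesz_system (cube_measure UNIV) (triangular_wave (\<lambda>i l. H $ i $ l) UNIV) (PiE UNIV \<Delta>)"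
    using \<open>lower_triangular H\<close> by (intro triangular_riesz_system \<Delta>) (auto simp: lower_triangular_def)
  \<comment> \<open>The frequency \<open>R\<^sup>T k\<close> is an integer vector, and its inner product with \<open>B x = R\<^sup>-\<^sup>1 H x\<close> is that
    of \<open>k\<close> with \<open>H x\<close>.\<close>
  define \<pi> where "\<pi> k = (\<chi> i. of_int (k i)) v* R" for k :: "'n::{finite,wellorder} \<Rightarrow> int"
  define \<Gamma> where "\<Gamma> = \<pi> ` PiE UNIV \<Delta>"
  have inj: "inj \<pi>"
  proof (rule injI)
    fix k k' assume "\<pi> k = \<pi> k'"
    then have eq: "transpose R *v (\<chi> i. of_int (k i)) = transpose R *v (\<chi> i. of_int (k' i))"
      by (simp add: \<pi>_def)
    have "inj ((*v) (transpose R))"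
      using \<open>invertible R\<close> by (intro inj_matrix_vector_mult) (simp add: invertible_det_nz)
    from injD[OF this eq] have "(\<chi> i. real_of_int (k i)) = (\<chi> i. real_of_int (k' i))" .
    then show "k = k'" by (simp add: vec_eq_iff fun_eq_iff)
  qed
  have lattice: "\<Gamma> \<subseteq> integer_lattice"
    using assms(2) by (auto simp: \<Gamma>_def \<pi>_def integer_lattice_def vector_matrix_mult_def intro!: Ints_sum Ints_mult)
  have "riesz_system (lborel_on S) exponential \<Gamma>"
    unfolding \<Gamma>_def
  proof (rule riesz_system_transfer[OF cube _ detB])
    show "(\<lambda>x. B *v (\<chi> i. x i)) \<in> cube_measure UNIV \<rightarrow>\<^sub>M lborel_on S"
      unfolding S_def by (rule measurable_linear_cube)
    show "(\<integral>\<^sup>+y. F y \<partial>lborel_on S) = ennreal \<bar>det B\<bar> * (\<integral>\<^sup>+x. F (B *v (\<chi> i. x i)) \<partial>cube_measure UNIV)"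
      if "F \<in> borel_measurable (lborel_on S)" for F
      using nn_integral_linear_image_cube[OF B] that unfolding S_def by blast
    show "inj_on \<pi> (PiE UNIV \<Delta>)" using inj by (rule inj_on_subset) simp
    show "exponential (\<pi> k) \<in> borel_measurable (lborel_on S)" for k
      by (rule borel_measurable_lborel_on[OF borel_measurable_exponential])
    show "exponential (\<pi> k) (B *v (\<chi> i. x i)) = triangular_wave (\<lambda>i l. H $ i $ l) UNIV k x" for k x
    proof -
      have "\<pi> k \<bullet> (B *v (\<chi> i. x i)) = (\<chi> i. of_int (k i)) \<bullet> (H *v (\<chi> i. x i))"
        by (simp add: \<pi>_def dot_lmul_matrix matrix_vector_mul_assoc RB)
      also have "\<dots> = (\<Sum>i\<in>UNIV. \<Sum>l\<in>UNIV. of_int (k i) * H $ i $ l * x l)"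
        by (simp add: inner_vec_def matrix_vector_mult_def sum_distrib_left mult.assoc)
      finally show ?thesis
        by (simp add: exponential_def triangular_wave_def cis_conv_exp mult_ac)
    qed
  qed
  then have "riesz_system (lebesgue_on S) exponential \<Gamma>"
    using compS by (intro riesz_system_lebesgue_on borel_measurable_exponential borel_closed compact_imp_closed)
  moreover have "finite_measure (lebesgue_on S)"
    using compS by (intro finite_measure_lebesgue_on lmeasurable_compact)
  moreover have "countable \<Gamma>"
    unfolding \<Gamma>_def by (intro countable_image countable_PiE) auto
  ultimately have "l2_riesz_basis (lebesgue_on S) exponential \<Gamma>"
    by (intro riesz_system_imp_basis)
  then show ?thesis
    using lattice assms(6) by (auto simp: S_def B_def)
qed

end
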